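(* Let $G,F,Q,\omega,\sigma$ and the algebra $A=k^Q\#_\sigma kF$ be as described in the context. The set of isomorphism classes of irreducible $A^{\mathrm{op}}$-modules is parametrized by the modules $$U_{p,W}=V_{p,W}^*=\bigl(A\otimes_{k^Q\#_\sigma kF^p}(p\otimes W)\bigr)^*,$$ where $p\in Q$ runs over a set of representatives of the double cosets of $F$ in $G$, $F^p=F\cap p^{-1}Fp$, and $W$ runs over a system of representatives of isomorphism classes of irreducible left $k_{\sigma_p}F^p$-modules. The character of the irreducible $A^{\mathrm{op}}$-module $U_{p,W}$ is given, for $q\in Q$ and $z\in F$, by $$\chi_{p,W}(\delta_qz)=\sum_{y^{-1}zy\in F^p}\delta_{p,\,q\triangleleft y}\ \sigma_q(z,y)\,\sigma_q(y,y^{-1}zy)^{-1}\,\chi_W(y^{-1}zy),$$ where the sum is over those $y$, in a set of representatives in $F$ of the cosets $yF^p$ of $F^p$ in $F$, such that $y^{-1}zy\in F^p$, and $\chi_W$ is the character of $W$.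
   Context: Setting. $k$ is an algebraically closed field of characteristic zero; $G$ is a finite group with identity $e$; $F\subseteq G$ is a subgroup; $Q\subseteq G$ with $e\in Q$ is simultaneously a set of representatives of the cosets $Fg$ and of the cosets $gF$, so every $g\in G$ factors uniquely as $g=xq$ with $x\in F$, $q\in Q$. Define $\triangleright:Q\times F\to F$ and $\triangleleft:Q\times F\to Q$ by $qx=(q\triangleright x)(q\triangleleft x)$; $\triangleleft$ is a right action of $F$ on the set $Q$. $\omega:G\times G\times G\to k^\times$ is a normalized 3-cocycle, i.e. $\omega(ab,c,d)\omega(a,b,cd)=\omega(a,b,c)\omega(a,bc,d)\omega(b,c,d)$ and $\omega(e,a,b)=\omega(a,e,b)=\omega(a,b,e)=1$, satisfying $\omega|_{F\times G\times G}=1$ and $\omega|_{G\times F\times Q}=1$. Put $\sigma_p(x,y)=\omega(p,x,y)$ for $p\in Q$, $x,y\in F$. $A=k^Q\#_\sigma kF$ is the vector space $k^Q\otimes kF$ with basis $\delta_px:=\delta_p\otimes x$ ($p\in Q$, $x\in F$) and multiplication $(\delta_px).(\delta_qy)=\delta_{p\triangleleft x,\,q}\,\sigma_p(x,y)\,\delta_p\,xy$ (first $\delta$ a Kronecker delta), with unit $\sum_{p\in Q}\delta_pe$. $A^{\mathrm{op}}$ is the opposite algebra. For $p\in Q$, $F^p=\{x\in F: p\triangleleft x=p\}=F\cap p^{-1}Fp$ is the isotropy subgroup, and $\sigma_p$ restricts to a normalized 2-cocycle on $F^p$; $k_{\sigma_p}F^p$ is the corresponding twisted group algebra, with basis $F^p$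 and product $x\cdot y=\sigma_p(x,y)\,xy$. $k^Q\#_\sigma kF^p\subseteq A$ is the subalgebra spanned by $\delta_qx$, $q\in Q$, $x\in F^p$. For a left $k_{\sigma_p}F^p$-module $W$, $p\otimes W$ denotes the space $W$ with the left $k^Q\#_\sigma kF^p$-action $(\delta_qx).(p\otimes w)=\delta_{q,p}\,p\otimes x.w$, and $V_{p,W}=A\otimes_{k^Q\#_\sigma kF^p}(p\otimes W)$ is the induced left $A$-module. For a left $A$-module $V$, the dual space $V^*$ is a left $A^{\mathrm{op}}$-module where $a$ acts by the transpose of the action of $a$ on $V$. "Parametrized" means that the listed modules are irreducible, pairwise non-isomorphic, and every irreducible $A^{\mathrm{op}}$-module is isomorphic to one of them. *)

theory Defs
  imports
    "Jordan_Normal_Form.VS_Connect"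
    "HOL-Algebra.Left_Coset"
    "HOL-Algebra.AbelCoset"
    "HOL-Computational_Algebra.Polynomial"
begin

text \<open>
  The ground field is a type \<open>'k\<close>; \<open>class_ring\<close> is that type viewed as a ring record. Vector
  spaces over it are the carrier-based ones of \<open>VectorSpace\<close>. The ring components of a module record
  are used only when it represents an algebra.
\<close>

section \<open>Left modules over algebras\<close>

record ('k, 'a, 'v) lmodule = "('k, 'v) module" +
  act :: "'a \<Rightarrow> 'v \<Rightarrow> 'v"

locale left_module = vectorspace class_ring M
  for A :: "('k::field, 'a, 'm) module_scheme"
    and M :: "('k, 'a, 'v, 'n) lmodule_scheme" +
  assumes act_closed: "a \<in> carrier A \<Longrightarrow> v \<in> carrier M \<Longrightarrow> act M a v \<in> carrier M"
    and act_add_right: "a \<in> carrier A \<Longrightarrow> v \<in> carrier M \<Longrightarrow> w \<in> carrier M \<Longrightarrow>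
      act M a (v \<oplus>\<^bsub>M\<^esub> w) = act M a v \<oplus>\<^bsub>M\<^esub> act M a w"
    and act_smult_right: "a \<in> carrier A \<Longrightarrow> v \<in> carrier M \<Longrightarrow>
      act M a (c \<odot>\<^bsub>M\<^esub> v) = c \<odot>\<^bsub>M\<^esub> act M a v"
    and act_add_left: "a \<in> carrier A \<Longrightarrow> b \<in> carrier A \<Longrightarrow> v \<in> carrier M \<Longrightarrow>
      act M (a \<oplus>\<^bsub>A\<^esub> b) v = act M a v \<oplus>\<^bsub>M\<^esub> act M b v"
    and act_smult_left: "a \<in> carrier A \<Longrightarrow> v \<in> carrier M \<Longrightarrow>
      act M (c \<odot>\<^bsub>A\<^esub> a) v = c \<odot>\<^bsub>M\<^esub> act M a v"
    and act_one: "v \<in> carrier M \<Longrightarrow> act M \<one>\<^bsub>A\<^esub> v = v"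
    and act_mult: "a \<in> carrier A \<Longrightarrow> b \<in> carrier A \<Longrightarrow> v \<in> carrier M \<Longrightarrow>
      act M (a \<otimes>\<^bsub>A\<^esub> b) v = act M a (act M b v)"

definition irreducible_lmodule ::
  "('k::field, 'a, 'm) module_scheme \<Rightarrow> ('k, 'a, 'v, 'n) lmodule_scheme \<Rightarrow> bool" where
  "irreducible_lmodule A M \<longleftrightarrow> left_module A M \<and> carrier M \<noteq> {\<zero>\<^bsub>M\<^esub>} \<and>
     (\<forall>N. LinearCombinations.submodule class_ring N M \<and> (\<forall>a\<in>carrier A. \<forall>v\<in>N. act M a v \<in> N) \<longrightarrow>
        N = {\<zero>\<^bsub>M\<^esub>} \<or> N = carrier M)"

definition iso_lmodule ::
  "('k::field, 'a, 'm) module_scheme \<Rightarrow> ('k, 'a, 'v, 'n) lmodule_scheme \<Rightarrow>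
   ('k, 'a, 'w, 'l) lmodule_scheme \<Rightarrow> bool" where
  "iso_lmodule A M N \<longleftrightarrow> (\<exists>\<phi>\<in>LinearCombinations.module_hom class_ring M N. bij_betw \<phi> (carrier M) (carrier N) \<and>
     (\<forall>a\<in>carrier A. \<forall>v\<in>carrier M. \<phi> (act M a v) = act N a (\<phi> v)))"

text \<open>
  \<open>parametrizes_irreducibles TYPE('u) A I M\<close>: the modules \<open>M i\<close>, \<open>i \<in> I\<close>, are irreducible, pairwise
  non-isomorphic, and every irreducible \<open>A\<close>-module is isomorphic to one of them. HOL cannot quantify
  over carrier types inside a formula, so the modules tested in the last clause have their carrier
  in the type \<open>'u\<close>. If \<open>A\<close> is finite-dimensional, its irreducible modules are so too, and
  then each of them has an isomorphic copy with carrier a subspace of \<open>nat \<Rightarrow> 'k\<close>: with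
  \<open>'u = nat \<Rightarrow> 'k\<close> the predicate speaks about all irreducible modules.
\<close>

definition parametrizes_irreducibles ::
  "'u itself \<Rightarrow> ('k::field, 'a, 'm) module_scheme \<Rightarrow> 'i set \<Rightarrow> ('i \<Rightarrow> ('k, 'a, 'v) lmodule) \<Rightarrow> bool" where
  "parametrizes_irreducibles (_ :: 'u itself) A I M \<longleftrightarrow>
     (\<forall>i\<in>I. irreducible_lmodule A (M i)) \<and>
     (\<forall>i\<in>I. \<forall>j\<in>I. i \<noteq> j \<longrightarrow> \<not> iso_lmodule A (M i) (M j)) \<and>
     (\<forall>N :: ('k, 'a, 'u) lmodule. irreducible_lmodule A N \<longrightarrow> (\<exists>i\<in>I. iso_lmodule A N (M i)))"

definition opposite_algebra :: "('k, 'a) module \<Rightarrow> ('k, 'a) module" where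
  "opposite_algebra A = A\<lparr>mult := \<lambda>a b. b \<otimes>\<^bsub>A\<^esub> a\<rparr>"

text \<open>
  The dual space consists of the linear functionals, as functions \<open>undefined\<close> outside the carrier; for an
  \<open>A\<close>-module it is an \<open>opposite_algebra A\<close>-module under the transposed action.
\<close>

definition dual_lmodule :: "('k::field, 'a, 'v) lmodule \<Rightarrow> ('k, 'a, 'v \<Rightarrow> 'k) lmodule" where
  "dual_lmodule M =
    \<lparr>carrier = {\<phi> \<in> extensional (carrier M).
        (\<forall>v\<in>carrier M. \<forall>w\<in>carrier M. \<phi> (v \<oplus>\<^bsub>M\<^esub> w) = \<phi> v + \<phi> w) \<and>
        (\<forall>c. \<forall>v\<in>carrier M. \<phi> (c \<odot>\<^bsub>M\<^esub> v) = c * \<phi> v)},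
     mult = undefined, one = undefined,
     zero = (\<lambda>v\<in>carrier M. 0),
     add = (\<lambda>\<phi> \<psi>. \<lambda>v\<in>carrier M. \<phi> v + \<psi> v),
     smult = (\<lambda>c \<phi>. \<lambda>v\<in>carrier M. c * \<phi> v),
     act = (\<lambda>a \<phi>. \<lambda>v\<in>carrier M. \<phi> (act M a v))\<rparr>"

text \<open>
  The coordinates of \<open>v\<close> in a finite basis \<open>B\<close>, and the trace of an endomorphism of a
  finite-dimensional space, i.e. the sum of the diagonal entries of its matrix in some (any) basis.
\<close>

definition coordinates :: "('k::field, 'v, 'm) module_scheme \<Rightarrow> 'v set \<Rightarrow> 'v \<Rightarrow> 'v \<Rightarrow> 'k" where
  "coordinates V B v = (THE c. c \<in> B \<rightarrow>\<^sub>E UNIV \<and> LinearCombinations.module.lincomb V c B = v)"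

definition trace :: "('k::field, 'v, 'm) module_scheme \<Rightarrow> ('v \<Rightarrow> 'v) \<Rightarrow> 'k" where
  "trace V f = (let B = (SOME B. finite B \<and> vectorspace.basis class_ring V B)
                in \<Sum>b\<in>B. coordinates V B (f b) b)"

definition character :: "('k::field, 'a, 'v) lmodule \<Rightarrow> 'a \<Rightarrow> 'k" where
  "character M a = trace M (act M a)"

section \<open>Spaces and algebras with a given basis; tensor products\<close>

text \<open>
  The vector space with basis \<open>S\<close> consists of the finitely supported functions vanishing off \<open>S\<close>;
  \<open>\<ee> s\<close> is the basis vector belonging to \<open>s\<close>.
\<close>

definition free_vs :: "'s set \<Rightarrow> ('k::field, 's \<Rightarrow> 'k) module" where
  "free_vs S =
    \<lparr>carrier = {f. finite {s. f s \<noteq> 0} \<and> {s. f s \<noteq> 0} \<subseteq> S},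
     mult = undefined, one = undefined,
     zero = (\<lambda>s. 0),
     add = (\<lambda>f g s. f s + g s),
     smult = (\<lambda>c f s. c * f s)\<rparr>"

definition basis_vec :: "'s \<Rightarrow> 's \<Rightarrow> 'k::field" (\<open>\<ee>\<close>) where
  "\<ee> s = (\<lambda>t. if t = s then 1 else 0)"

definition linear_extension :: "('s \<Rightarrow> 't \<Rightarrow> 'k::field) \<Rightarrow> ('s \<Rightarrow> 'k) \<Rightarrow> 't \<Rightarrow> 'k" where
  "linear_extension h f = (\<lambda>r. \<Sum>s | f s \<noteq> 0. f s * h s r)"

text \<open>The product is the bilinear extension of the products \<open>m s t\<close> of basis vectors.\<close>

definition algebra_with_basis ::
  "'s set \<Rightarrow> ('s \<Rightarrow> 's \<Rightarrow> 's \<Rightarrow> 'k::field) \<Rightarrow> ('s \<Rightarrow> 'k) \<Rightarrow> ('k, 's \<Rightarrow> 'k) module" where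
  "algebra_with_basis S m u = (free_vs S)
    \<lparr>mult := (\<lambda>f g. linear_extension (\<lambda>s. linear_extension (m s) g) f),
     one := u\<rparr>"

text \<open>
  For a subalgebra with carrier \<open>B\<close> of \<open>A\<close> and a left \<open>B\<close>-module \<open>M\<close>, the left \<open>A\<close>-module
  \<open>A \<otimes>\<^sub>B M\<close> is the quotient of the vector space with basis \<open>A \<times> M\<close> by the span of the following
  relations. The operations on cosets are formed as in the library's quotient rings.
\<close>

definition tensor_relations ::
  "('k::field, 'a) module \<Rightarrow> 'a set \<Rightarrow> ('k, 'a, 'v) lmodule \<Rightarrow> ('a \<times> 'v \<Rightarrow> 'k) set" where
  "tensor_relations A B M = (let Fr = free_vs (carrier A \<times> carrier M) in
     {\<ee> (a \<oplus>\<^bsub>A\<^esub> a', v) \<ominus>\<^bsub>Fr\<^esub> (\<ee> (a, v) \<oplus>\<^bsub>Fr\<^esub> \<ee> (a', v)) | a a' v.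
        a \<in> carrier A \<and> a' \<in> carrier A \<and> v \<in> carrier M}
   \<union> {\<ee> (a, v \<oplus>\<^bsub>M\<^esub> v') \<ominus>\<^bsub>Fr\<^esub> (\<ee> (a, v) \<oplus>\<^bsub>Fr\<^esub> \<ee> (a, v')) | a v v'.
        a \<in> carrier A \<and> v \<in> carrier M \<and> v' \<in> carrier M}
   \<union> {\<ee> (c \<odot>\<^bsub>A\<^esub> a, v) \<ominus>\<^bsub>Fr\<^esub> c \<odot>\<^bsub>Fr\<^esub> \<ee> (a, v) | c a v. a \<in> carrier A \<and> v \<in> carrier M}
   \<union> {\<ee> (a, c \<odot>\<^bsub>M\<^esub> v) \<ominus>\<^bsub>Fr\<^esub> c \<odot>\<^bsub>Fr\<^esub> \<ee> (a, v) | c a v. a \<in> carrier A \<and> v \<in> carrier M}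
   \<union> {\<ee> (a \<otimes>\<^bsub>A\<^esub> b, v) \<ominus>\<^bsub>Fr\<^esub> \<ee> (a, act M b v) | a b v.
        a \<in> carrier A \<and> b \<in> B \<and> v \<in> carrier M})"

definition tensor_lmodule ::
  "('k::field, 'a) module \<Rightarrow> 'a set \<Rightarrow> ('k, 'a, 'v) lmodule \<Rightarrow>
   ('k, 'a, ('a \<times> 'v \<Rightarrow> 'k) set) lmodule" where
  "tensor_lmodule A B M =
    (let Fr = free_vs (carrier A \<times> carrier M) :: ('k, 'a \<times> 'v \<Rightarrow> 'k) module;
         N = LinearCombinations.module.span class_ring Fr (tensor_relations A B M)
     in \<lparr>carrier = a_rcosets\<^bsub>Fr\<^esub> N,
         mult = undefined, one = undefined,
         zero = N,
         add = set_add Fr,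
         smult = (\<lambda>c X. \<Union>x\<in>X. N +>\<^bsub>Fr\<^esub> (c \<odot>\<^bsub>Fr\<^esub> x)),
         act = (\<lambda>a X. \<Union>x\<in>X. N +>\<^bsub>Fr\<^esub> linear_extension (\<lambda>(b, v). \<ee> (a \<otimes>\<^bsub>A\<^esub> b, v)) x)\<rparr>)"

section \<open>The algebra of a twisted factorization\<close>

definition representatives :: "'a set set \<Rightarrow> 'a set \<Rightarrow> bool" where
  "representatives \<C> R \<longleftrightarrow> R \<subseteq> \<Union>\<C> \<and> (\<forall>C\<in>\<C>. \<exists>!r. r \<in> R \<and> r \<in> C)"

definition double_cosets :: "('g, 'm) monoid_scheme \<Rightarrow> 'g set \<Rightarrow> 'g set set" where
  "double_cosets G F = {F #>\<^bsub>G\<^esub> g <#>\<^bsub>G\<^esub> F | g. g \<in> carrier G}"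

locale twisted_factorization = group G
  for G :: "('g, 'm) monoid_scheme" (structure) +
  fixes F Q :: "'g set"
    and \<omega> \<sigma> :: "'g \<Rightarrow> 'g \<Rightarrow> 'g \<Rightarrow> 'k::{alg_closed_field, field_char_0}"
  assumes finite_G: "finite (carrier G)"
    and subgroup_F: "subgroup F G"
    and one_in_Q: "\<one> \<in> Q"
    and Q_right: "representatives (rcosets F) Q"
    and Q_left: "representatives (lcosets F) Q"
    and \<omega>_nonzero: "a \<in> carrier G \<Longrightarrow> b \<in> carrier G \<Longrightarrow> c \<in> carrier G \<Longrightarrow> \<omega> a b c \<noteq> 0"
    and \<omega>_cocycle: "a \<in> carrier G \<Longrightarrow> b \<in> carrier G \<Longrightarrow> c \<in> carrier G \<Longrightarrow> d \<in> carrier G \<Longrightarrow>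
      \<omega> (a \<otimes> b) c d * \<omega> a b (c \<otimes> d) = \<omega> a b c * \<omega> a (b \<otimes> c) d * \<omega> b c d"
    and \<omega>_normalized: "a \<in> carrier G \<Longrightarrow> b \<in> carrier G \<Longrightarrow>
      \<omega> \<one> a b = 1 \<and> \<omega> a \<one> b = 1 \<and> \<omega> a b \<one> = 1"
    and \<omega>_FGG: "x \<in> F \<Longrightarrow> a \<in> carrier G \<Longrightarrow> b \<in> carrier G \<Longrightarrow> \<omega> x a b = 1"
    and \<omega>_GFQ: "a \<in> carrier G \<Longrightarrow> x \<in> F \<Longrightarrow> q \<in> Q \<Longrightarrow> \<omega> a x q = 1"
    and \<sigma>_eq: "p \<in> Q \<Longrightarrow> x \<in> F \<Longrightarrow> y \<in> F \<Longrightarrow> \<sigma> p x y = \<omega> p x y"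

text \<open>The component \<open>q \<triangleleft> x \<in> Q\<close> of the factorization \<open>q x = (q \<triangleright> x) (q \<triangleleft> x)\<close>.\<close>

definition right_act :: "('g, 'm) monoid_scheme \<Rightarrow> 'g set \<Rightarrow> 'g set \<Rightarrow> 'g \<Rightarrow> 'g \<Rightarrow> 'g" where
  "right_act G F Q q x = (THE r. r \<in> Q \<and> (\<exists>y\<in>F. q \<otimes>\<^bsub>G\<^esub> x = y \<otimes>\<^bsub>G\<^esub> r))"

definition isotropy :: "('g, 'm) monoid_scheme \<Rightarrow> 'g set \<Rightarrow> 'g set \<Rightarrow> 'g \<Rightarrow> 'g set" where
  "isotropy G F Q p = {x \<in> F. right_act G F Q p x = p}"

text \<open>\<open>k\<^sup>Q #\<^sub>\<sigma> kF\<close>; the basis element \<open>\<delta>\<^sub>p x\<close> is \<open>\<ee> (p, x)\<close>.\<close>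

definition cocycle_smash ::
  "('g, 'm) monoid_scheme \<Rightarrow> 'g set \<Rightarrow> 'g set \<Rightarrow> ('g \<Rightarrow> 'g \<Rightarrow> 'g \<Rightarrow> 'k::field) \<Rightarrow>
   ('k, 'g \<times> 'g \<Rightarrow> 'k) module" where
  "cocycle_smash G F Q \<sigma> = algebra_with_basis (Q \<times> F)
     (\<lambda>(p, x) (q, y). if right_act G F Q p x = q
        then (\<lambda>r. \<sigma> p x y * \<ee> (p, x \<otimes>\<^bsub>G\<^esub> y) r) else (\<lambda>r. 0))
     (\<lambda>r. \<Sum>p\<in>Q. \<ee> (p, \<one>\<^bsub>G\<^esub>) r)"

definition twisted_group_algebra ::
  "('g, 'm) monoid_scheme \<Rightarrow> 'g set \<Rightarrow> ('g \<Rightarrow> 'g \<Rightarrow> 'k::field) \<Rightarrow> ('k, 'g \<Rightarrow> 'k) module" where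
  "twisted_group_algebra G H \<tau> = algebra_with_basis H
     (\<lambda>x y r. \<tau> x y * \<ee> (x \<otimes>\<^bsub>G\<^esub> y) r) (\<ee> \<one>\<^bsub>G\<^esub>)"

text \<open>
  \<open>p \<otimes> W\<close>. An element \<open>f\<close> of \<open>k\<^sup>Q #\<^sub>\<sigma> kF\<^sup>p\<close> is the combination of the \<open>\<delta>\<^sub>q x\<close> with coefficients
  \<open>f (q, x)\<close>; since \<open>\<delta>\<^sub>q x\<close> acts as \<open>\<delta>\<^sub>q\<^sub>,\<^sub>p x\<close>, \<open>f\<close> acts as the element of \<open>k F\<^sup>p\<close> with
  coefficients \<open>f (p, x)\<close>.
\<close>

definition point_lmodule ::
  "'g \<Rightarrow> ('k, 'g \<Rightarrow> 'k, 'w) lmodule \<Rightarrow> ('k, 'g \<times> 'g \<Rightarrow> 'k, 'w) lmodule" where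
  "point_lmodule p W =
    \<lparr>carrier = carrier W, mult = mult W, one = one W, zero = zero W, add = add W,
     smult = smult W, act = (\<lambda>f. act W (\<lambda>x. f (p, x)))\<rparr>"

definition induced_lmodule ::
  "('g, 'm) monoid_scheme \<Rightarrow> 'g set \<Rightarrow> 'g set \<Rightarrow> ('g \<Rightarrow> 'g \<Rightarrow> 'g \<Rightarrow> 'k::field) \<Rightarrow>
   'g \<Rightarrow> ('k, 'g \<Rightarrow> 'k, 'w) lmodule \<Rightarrow>
   ('k, 'g \<times> 'g \<Rightarrow> 'k, (('g \<times> 'g \<Rightarrow> 'k) \<times> 'w \<Rightarrow> 'k) set) lmodule" where
  "induced_lmodule G F Q \<sigma> p W =
     tensor_lmodule (cocycle_smash G F Q \<sigma>) (carrier (free_vs (Q \<times> isotropy G F Q p)))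
       (point_lmodule p W)"

section \<open>Consistency checks\<close>

lemma linear_extension_basis_vec:
  fixes h :: "'s \<Rightarrow> 't \<Rightarrow> 'k::field"
  shows "linear_extension h (\<ee> s) = h s"
proof -
  have "{t. (\<ee> s t :: 'k) \<noteq> 0} = {s}" by (auto simp: basis_vec_def)
  then show ?thesis by (simp add: linear_extension_def basis_vec_def)
qed

lemma cocycle_smash_mult:
  "\<ee> (p, x) \<otimes>\<^bsub>cocycle_smash G F Q \<sigma>\<^esub> \<ee> (q, y) =
     (if right_act G F Q p x = q then \<sigma> p x y else 0) \<odot>\<^bsub>cocycle_smash G F Q \<sigma>\<^esub> \<ee> (p, x \<otimes>\<^bsub>G\<^esub> y)"
  by (simp add: cocycle_smash_def algebra_with_basis_def linear_extension_basis_vec free_vs_def)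

lemma twisted_group_algebra_mult:
  "\<ee> x \<otimes>\<^bsub>twisted_group_algebra G H \<tau>\<^esub> \<ee> y = \<tau> x y \<odot>\<^bsub>twisted_group_algebra G H \<tau>\<^esub> \<ee> (x \<otimes>\<^bsub>G\<^esub> y)"
  by (simp add: twisted_group_algebra_def algebra_with_basis_def linear_extension_basis_vec free_vs_def)

lemma (in twisted_factorization) Q_subset: "Q \<subseteq> carrier G"
  using Q_left lcosets_part_G[OF subgroup_F] by (simp add: representatives_def)

lemma (in twisted_factorization) factorization_ex1:
  assumes g: "g \<in> carrier G"
  shows "\<exists>!r. r \<in> Q \<and> (\<exists>y\<in>F. g = y \<otimes> r)"
proof -
  interpret F: subgroup F G by (rule subgroup_F)
  have "F #> g \<in> rcosets F" using g by (auto simp: RCOSETS_def)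
  then have ex1: "\<exists>!r. r \<in> Q \<and> r \<in> F #> g" using Q_right by (simp add: representatives_def)
  have "r \<in> F #> g \<longleftrightarrow> (\<exists>y\<in>F. g = y \<otimes> r)" if r: "r \<in> Q" for r
  proof -
    have rG: "r \<in> carrier G" using r Q_subset by blast
    show ?thesis
    proof
      assume "r \<in> F #> g"
      then obtain h where h: "h \<in> F" "r = h \<otimes> g" by (auto simp: r_coset_def)
      then have "g = inv h \<otimes> r" using g by (simp add: inv_solve_left F.mem_carrier)
      then show "\<exists>y\<in>F. g = y \<otimes> r" using h by blast
    next
      assume "\<exists>y\<in>F. g = y \<otimes> r"
      then obtain y where y: "y \<in> F" "g = y \<otimes> r" by blast
      then have "r = inv y \<otimes> g" using rG g by (simp add: inv_solve_left F.mem_carrier)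
      then show "r \<in> F #> g" using y by (auto simp: r_coset_def)
    qed
  qed
  then show ?thesis using ex1 by metis
qed

lemma (in twisted_factorization) right_act_eq_iff:
  assumes "q \<in> Q" "x \<in> F" "r \<in> Q"
  shows "right_act G F Q q x = r \<longleftrightarrow> (\<exists>y\<in>F. q \<otimes> x = y \<otimes> r)"
proof -
  have "q \<otimes> x \<in> carrier G" using assms Q_subset subgroup.mem_carrier[OF subgroup_F] by blast
  from theI'[OF factorization_ex1[OF this]] factorization_ex1[OF this] show ?thesis
    unfolding right_act_def using assms(3) by blast
qed

lemma (in twisted_factorization) isotropy_eq:
  assumes p: "p \<in> Q"
  shows "isotropy G F Q p = F \<inter> (inv p <# F #> p)"
proof -
  interpret F: subgroup F G by (rule subgroup_F)
  have pG: "p \<in> carrier G" using p Q_subset by blast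
  have "x \<in> inv p <# F #> p \<longleftrightarrow> (\<exists>y\<in>F. p \<otimes> x = y \<otimes> p)" if x: "x \<in> F" for x
  proof -
    have "x = inv p \<otimes> y \<otimes> p \<longleftrightarrow> p \<otimes> x = y \<otimes> p" if "y \<in> F" for y
      using that x pG by (metis F.mem_carrier inv_closed inv_solve_left m_assoc m_closed)
    then show ?thesis by (auto simp: l_coset_def r_coset_def)
  qed
  then show ?thesis
    using right_act_eq_iff[OF p _ p] by (auto simp: isotropy_def)
qed

end

(*
  Right modules over the algebra A are controlled by the idempotents e_p = delta_p e: the corner
  e_p A e_p is the twisted group algebra of the isotropy group of p. Functionals on the induced
  module V are the balanced bilinear functions of A and W. A functional phi with phi e_p = phi is
  determined by the functional w |-> phi (e_p (x) w) on W, and every functional on W arises in this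
  way, so U e_p is the dual of W. Moving vectors into U e_p and back by the elements delta_q y shows
  that U is irreducible and determines the orbit of p and W. Conversely, for an irreducible right
  module N with N e_p nonzero, the corner N e_p is irreducible; its dual is one of the W, and pairing
  n a e_p with W embeds N into U. The character is read off from the dual bases given by the vectors
  delta_q y (x) w with y in a transversal of the isotropy group and w in a basis of W.
*)

theory Submission
  imports Defs "HOL-Library.Function_Algebras"
begin

section \<open>Linear functionals and traces\<close>

text \<open>The irreducible modules wanted are duals, and this dictates the route: the tensor
  product enters mainly through its functionals, by the universal property, and identities of right
  modules are tested on pure tensors. As the dual of W is a right module over the twisted group
  algebra and W a left one, each passage between W and a corner costs a finite-dimensional duality:
  irreducibility dualizes by separating a functional from a subspace of the dual by a vector, and a
  morphism of duals transposes to one in the reverse direction. Finite dimension comes from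
  cyclicity over an algebra with a finite basis. The F-orbits on Q correspond to the double cosets
  of F in G, which is why one p per double coset suffices. The given list of the W is complete for
  modules on \<open>nat \<Rightarrow> 'k\<close>, so the dual of a corner is first copied there. Two
  values of sigma recur: sigma_q(y, y^{-1}) is the price of returning from the corner at p to the
  component at q, and sigma_p(y^{-1}, y) normalizes the dual bases of U. A single cocycle identity,
  at (p, y^{-1}, y, y^{-1}zy), turns the latter into the factor sigma_q(y, y^{-1}zy)^{-1} of the
  character.\<close>

definition linear_functional :: "('k::field, 'v, 'm) module_scheme \<Rightarrow> ('v \<Rightarrow> 'k) \<Rightarrow> bool" where
  "linear_functional V \<phi> \<longleftrightarrow>
     (\<forall>v\<in>carrier V. \<forall>w\<in>carrier V. \<phi> (v \<oplus>\<^bsub>V\<^esub> w) = \<phi> v + \<phi> w) \<and>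
     (\<forall>c. \<forall>v\<in>carrier V. \<phi> (c \<odot>\<^bsub>V\<^esub> v) = c * \<phi> v)"

text \<open>A basis is encoded as a family of vectors together with its coordinate functionals.
  Separation of points by the \<open>c i\<close> replaces spanning, and independence is built into
  the Kronecker condition. The \<open>c i\<close> are constrained on the carrier alone, so that
  compositions and evaluations can serve as coordinates without being restricted.\<close>

definition dual_bases ::
  "('k::field, 'v, 'm) module_scheme \<Rightarrow> 'i set \<Rightarrow> ('i \<Rightarrow> 'v) \<Rightarrow> ('i \<Rightarrow> 'v \<Rightarrow> 'k) \<Rightarrow> bool" where
  "dual_bases V I b c \<longleftrightarrow> finite I \<and> b \<in> I \<rightarrow> carrier V \<and> (\<forall>i\<in>I. linear_functional V (c i)) \<and>
     (\<forall>i\<in>I. \<forall>j\<in>I. c i (b j) = (if i = j then 1 else 0)) \<and>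
     (\<forall>v\<in>carrier V. (\<forall>i\<in>I. c i v = 0) \<longrightarrow> v = \<zero>\<^bsub>V\<^esub>)"

lemma linear_functional_add:
  "linear_functional V \<phi> \<Longrightarrow> v \<in> carrier V \<Longrightarrow> w \<in> carrier V \<Longrightarrow> \<phi> (v \<oplus>\<^bsub>V\<^esub> w) = \<phi> v + \<phi> w"
  by (simp add: linear_functional_def)

lemma linear_functional_smult:
  "linear_functional V \<phi> \<Longrightarrow> v \<in> carrier V \<Longrightarrow> \<phi> (c \<odot>\<^bsub>V\<^esub> v) = c * \<phi> v"
  by (simp add: linear_functional_def)

lemma module_hom_comp_functional:
  assumes "f \<in> LinearCombinations.module_hom class_ring V W" and "linear_functional W \<phi>"
  shows "linear_functional V (\<lambda>v. \<phi> (f v))"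
  using assms by (auto simp: LinearCombinations.module_hom_def linear_functional_def Pi_def)

section \<open>Dual bases and the trace\<close>

context
  fixes V :: "('k::field, 'v, 'm) module_scheme"
  assumes V: "vectorspace class_ring V"
begin

interpretation vectorspace class_ring V by (rule V)

lemma smult_class_ring:
  assumes "v \<in> carrier V"
  shows "1 \<odot>\<^bsub>V\<^esub> v = v" "0 \<odot>\<^bsub>V\<^esub> v = \<zero>\<^bsub>V\<^esub>"
  using smult_one[OF assms] lmult_0[OF assms] by simp_all

lemma smult_minus_one: "v \<in> carrier V \<Longrightarrow> (-1) \<odot>\<^bsub>V\<^esub> v = \<ominus>\<^bsub>V\<^esub> v"
  using smult_minus_1[of v] by (simp add: class_ring_simps)

lemma linear_functional_zero: "linear_functional V \<phi> \<Longrightarrow> \<phi> \<zero>\<^bsub>V\<^esub> = 0"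
  using linear_functional_smult[of V \<phi> "\<zero>\<^bsub>V\<^esub>" 0] by (simp add: smult_class_ring)

lemma linear_functional_minus:
  assumes "linear_functional V \<phi>" "v \<in> carrier V" "w \<in> carrier V"
  shows "\<phi> (v \<ominus>\<^bsub>V\<^esub> w) = \<phi> v - \<phi> w"
proof -
  have "\<phi> ((v \<ominus>\<^bsub>V\<^esub> w) \<oplus>\<^bsub>V\<^esub> w) = \<phi> (v \<ominus>\<^bsub>V\<^esub> w) + \<phi> w"
    by (rule linear_functional_add) (use assms in auto)
  moreover have "(v \<ominus>\<^bsub>V\<^esub> w) \<oplus>\<^bsub>V\<^esub> w = v"
    using assms by (simp add: M.minus_eq M.a_assoc M.l_neg)
  ultimately show ?thesis by simp
qed

lemma linear_functional_finsum:
  assumes \<phi>: "linear_functional V \<phi>" and fin: "finite I" and f: "f \<in> I \<rightarrow> carrier V"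
  shows "\<phi> (\<Oplus>\<^bsub>V\<^esub>i\<in>I. f i) = (\<Sum>i\<in>I. \<phi> (f i))"
  using fin f
proof (induction I)
  case empty
  then show ?case by (simp add: linear_functional_zero[OF \<phi>])
next
  case (insert i I)
  then have "\<phi> (f i \<oplus>\<^bsub>V\<^esub> (\<Oplus>\<^bsub>V\<^esub>i\<in>I. f i)) = \<phi> (f i) + \<phi> (\<Oplus>\<^bsub>V\<^esub>i\<in>I. f i)"
    by (intro linear_functional_add[OF \<phi>] M.finsum_closed) auto
  with insert show ?case by (simp add: M.finsum_insert Pi_def)
qed

context
  fixes I :: "'i set" and b :: "'i \<Rightarrow> 'v" and c
  assumes bc: "dual_bases V I b c"
begin

text \<open>All coordinates of the difference between \<open>v\<close> and its expansion vanish, and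
  the coordinates separate points.\<close>

lemma dual_bases_expansion:
  assumes v: "v \<in> carrier V"
  shows "v = (\<Oplus>\<^bsub>V\<^esub>i\<in>I. c i v \<odot>\<^bsub>V\<^esub> b i)"
proof -
  let ?w = "\<Oplus>\<^bsub>V\<^esub>i\<in>I. c i v \<odot>\<^bsub>V\<^esub> b i"
  have b: "(\<lambda>i. c i v \<odot>\<^bsub>V\<^esub> b i) \<in> I \<rightarrow> carrier V" and fin: "finite I"
    using bc by (auto simp: dual_bases_def Pi_def)
  have w: "?w \<in> carrier V" using b by (rule M.finsum_closed)
  have "c i (v \<ominus>\<^bsub>V\<^esub> ?w) = 0" if i: "i \<in> I" for i
  proof -
    have ci: "linear_functional V (c i)" using bc i by (simp add: dual_bases_def)
    have "c i ?w = (\<Sum>j\<in>I. c j v * c i (b j))"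
      using bc unfolding linear_functional_finsum[OF ci fin b]
      by (intro sum.cong) (auto simp: dual_bases_def intro!: linear_functional_smult[OF ci])
    also have "\<dots> = (\<Sum>j\<in>I. if i = j then c j v else 0)"
      by (rule sum.cong) (use bc i in \<open>auto simp: dual_bases_def\<close>)
    also have "\<dots> = c i v" using fin i by simp
    finally show ?thesis using linear_functional_minus[OF ci v w] by simp
  qed
  then have "v \<ominus>\<^bsub>V\<^esub> ?w = \<zero>\<^bsub>V\<^esub>" using bc v w by (auto simp: dual_bases_def)
  then show ?thesis using v w by simp
qed

lemma dual_bases_eqI:
  assumes "v \<in> carrier V" "w \<in> carrier V" "\<And>i. i \<in> I \<Longrightarrow> c i v = c i w"
  shows "v = w"
proof -
  have "v = (\<Oplus>\<^bsub>V\<^esub>i\<in>I. c i v \<odot>\<^bsub>V\<^esub> b i)" using assms(1) by (rule dual_bases_expansion)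
  also have "\<dots> = (\<Oplus>\<^bsub>V\<^esub>i\<in>I. c i w \<odot>\<^bsub>V\<^esub> b i)"
    using bc assms(3) by (intro M.finsum_cong') (auto simp: dual_bases_def)
  also have "\<dots> = w" using assms(2) by (rule dual_bases_expansion[symmetric])
  finally show ?thesis .
qed

lemma functional_expansion:
  assumes \<phi>: "linear_functional V \<phi>" and v: "v \<in> carrier V"
  shows "\<phi> v = (\<Sum>i\<in>I. c i v * \<phi> (b i))"
proof -
  have "\<phi> v = \<phi> (\<Oplus>\<^bsub>V\<^esub>i\<in>I. c i v \<odot>\<^bsub>V\<^esub> b i)" using dual_bases_expansion[OF v] by simp
  also have "\<dots> = (\<Sum>i\<in>I. \<phi> (c i v \<odot>\<^bsub>V\<^esub> b i))"
    using bc by (intro linear_functional_finsum[OF \<phi>]) (auto simp: dual_bases_def Pi_def)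
  also have "\<dots> = (\<Sum>i\<in>I. c i v * \<phi> (b i))"
    using bc by (intro sum.cong) (auto simp: dual_bases_def intro!: linear_functional_smult[OF \<phi>])
  finally show ?thesis .
qed

end

text \<open>The functional \<open>c i\<close> after \<open>f\<close> is expanded in the second pair
  of dual bases; after exchanging the sums, the inner sum is the expansion of \<open>d j\<close> in
  the first pair.\<close>

lemma trace_independent:
  assumes f: "f \<in> LinearCombinations.module_hom class_ring V V"
    and bc: "dual_bases V I b c" and ed: "dual_bases V J e d"
  shows "(\<Sum>i\<in>I. c i (f (b i))) = (\<Sum>j\<in>J. d j (f (e j)))"
proof -
  have "(\<Sum>i\<in>I. c i (f (b i))) = (\<Sum>i\<in>I. \<Sum>j\<in>J. d j (b i) * c i (f (e j)))"
    using bc by (intro sum.cong functional_expansion[OF ed] module_hom_comp_functional[OF f])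
      (auto simp: dual_bases_def)
  also have "\<dots> = (\<Sum>j\<in>J. \<Sum>i\<in>I. c i (f (e j)) * d j (b i))"
    by (subst sum.swap) (simp add: mult.commute)
  also have "\<dots> = (\<Sum>j\<in>J. d j (f (e j)))"
    using ed f by (intro sum.cong functional_expansion[OF bc, symmetric])
      (auto simp: dual_bases_def LinearCombinations.module_hom_def Pi_def)
  finally show ?thesis .
qed

lemma coordinates_eqI:
  assumes B: "finite B" "basis B" and v: "v \<in> carrier V"
    and a: "a \<in> B \<rightarrow>\<^sub>E UNIV" "lincomb a B = v"
  shows "coordinates V B v = a"
proof -
  have "\<exists>!a. a \<in> B \<rightarrow>\<^sub>E UNIV \<and> lincomb a B = v"
    using basis_criterion[OF B(1)] B(2) v by (auto simp: basis_def)
  with a show ?thesis unfolding coordinates_def by (intro the1_equality) auto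
qed

text \<open>Linearity comes from uniqueness: the sum of two coordinate families is a coordinate
  family of the sum, hence the one chosen by the definite description.\<close>

lemma coordinates_dual_bases:
  assumes B: "finite B" "basis B"
  shows "dual_bases V B (\<lambda>x. x) (\<lambda>x v. coordinates V B v x)"
proof -
  have BV: "B \<subseteq> carrier V" using B by (simp add: basis_def)
  have co: "coordinates V B v \<in> B \<rightarrow>\<^sub>E UNIV" "lincomb (coordinates V B v) B = v"
    if v: "v \<in> carrier V" for v
  proof -
    obtain a where a: "a \<in> B \<rightarrow>\<^sub>E UNIV" "lincomb a B = v"
      using basis_criterion[OF B(1) BV] B(2) v by auto
    with coordinates_eqI[OF B v]
    show "coordinates V B v \<in> B \<rightarrow>\<^sub>E UNIV" "lincomb (coordinates V B v) B = v" by auto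
  qed
  \<comment> \<open>Coordinates are unique only among functions that are undefined off
    \<open>B\<close>, so every candidate has to be restricted to \<open>B\<close> before
    \<open>coordinates_eqI\<close> applies.\<close>
  have restr: "lincomb (restrict a B) B = lincomb a B" for a
    by (rule lincomb_cong) (use BV in auto)
  have add: "coordinates V B (v \<oplus>\<^bsub>V\<^esub> w) = (\<lambda>x\<in>B. coordinates V B v x + coordinates V B w x)"
    if "v \<in> carrier V" "w \<in> carrier V" for v w
    using that lincomb_sum[OF B(1) BV, of "coordinates V B v" "coordinates V B w"]
    by (intro coordinates_eqI[OF B]) (auto simp: co restr)
  have smult: "coordinates V B (k \<odot>\<^bsub>V\<^esub> v) = (\<lambda>x\<in>B. k * coordinates V B v x)"
    if "v \<in> carrier V" for k v
    using that lincomb_smult[OF BV, of "coordinates V B v" k]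
    by (intro coordinates_eqI[OF B]) (auto simp: co restr)
  have self: "coordinates V B y = (\<lambda>x\<in>B. if x = y then 1 else 0)" if y: "y \<in> B" for y
  proof (rule coordinates_eqI[OF B])
    have "lincomb (\<lambda>x\<in>B. if x = y then 1 else 0) B = (\<Oplus>\<^bsub>V\<^esub>x\<in>B. if y = x then x else \<zero>\<^bsub>V\<^esub>)"
      unfolding lincomb_def using BV y by (intro M.finsum_cong') (auto simp: smult_class_ring subset_iff)
    also have "\<dots> = y" using M.finsum_singleton[OF y B(1), of "\<lambda>x. x"] BV by auto
    finally show "lincomb (\<lambda>x\<in>B. if x = y then 1 else 0) B = y" .
  qed (use BV y in auto)
  have "v = \<zero>\<^bsub>V\<^esub>" if v: "v \<in> carrier V" and 0: "\<forall>x\<in>B. coordinates V B v x = 0" for v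
  proof -
    have "v = lincomb (\<lambda>_. 0) B"
      using co[OF v] 0 lincomb_cong[OF refl BV, of "coordinates V B v" "\<lambda>_. 0"] by auto
    also have "\<dots> = \<zero>\<^bsub>V\<^esub>"
      unfolding lincomb_def using BV by (intro M.finsum_all0) (auto simp: smult_class_ring subset_iff)
    finally show ?thesis .
  qed
  with B BV show ?thesis
    by (auto simp: dual_bases_def linear_functional_def add smult self)
qed

text \<open>The trace picks a finite basis by a choice operator; this lemma guarantees that there is
  one to pick. Applying \<open>c i\<close> to a linear combination returns its coefficient, which
  gives uniqueness.\<close>

lemma dual_bases_basis:
  assumes bc: "dual_bases V I b c"
  shows "finite (b ` I)" and "basis (b ` I)"
proof -
  show fin: "finite (b ` I)" using bc by (simp add: dual_bases_def)
  have bV: "b ` I \<subseteq> carrier V" using bc by (auto simp: dual_bases_def)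
  have inj: "inj_on b I"
    using bc by (intro inj_onI) (metis dual_bases_def zero_neq_one)
  have lc: "lincomb a (b ` I) = (\<Oplus>\<^bsub>V\<^esub>i\<in>I. a (b i) \<odot>\<^bsub>V\<^esub> b i)" for a
    unfolding lincomb_def using bV inj by (subst M.add.finprod_reindex) auto
  have coeff: "c i (lincomb a (b ` I)) = a (b i)" if i: "i \<in> I" for a i
  proof -
    have "c i (lincomb a (b ` I)) = (\<Sum>j\<in>I. c i (a (b j) \<odot>\<^bsub>V\<^esub> b j))"
      unfolding lc using bc i by (intro linear_functional_finsum) (auto simp: dual_bases_def Pi_def)
    also have "\<dots> = (\<Sum>j\<in>I. if i = j then a (b j) else 0)"
      using bc i by (intro sum.cong) (auto simp: dual_bases_def Pi_def linear_functional_smult)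
    also have "\<dots> = a (b i)" using bc i by (simp add: dual_bases_def)
    finally show ?thesis .
  qed
  show "basis (b ` I)"
    unfolding basis_criterion[OF fin bV]
  proof (intro allI impI)
    fix v assume v: "v \<in> carrier V"
    let ?a = "\<lambda>x\<in>b ` I. c (inv_into I b x) v"
    have "lincomb ?a (b ` I) = v"
      unfolding lc by (subst (2) dual_bases_expansion[OF bc v], rule M.finsum_cong')
        (use bc inj in \<open>auto simp: dual_bases_def Pi_def\<close>)
    moreover have "a = ?a" if "a \<in> b ` I \<rightarrow>\<^sub>E UNIV" "lincomb a (b ` I) = v" for a
      using that coeff[of _ a] inj by (intro extensionalityI[of a "b ` I"]) (auto simp: PiE_def)
    ultimately show "\<exists>!a. a \<in> b ` I \<rightarrow>\<^sub>E carrier class_ring \<and> lincomb a (b ` I) = v"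
      by (intro ex1I[of _ ?a]) auto
  qed
qed

lemma trace_eq_sum:
  assumes f: "f \<in> LinearCombinations.module_hom class_ring V V" and bc: "dual_bases V I b c"
  shows "trace V f = (\<Sum>i\<in>I. c i (f (b i)))"
proof -
  let ?B = "SOME B. finite B \<and> basis B"
  have "finite ?B \<and> basis ?B" using dual_bases_basis[OF bc] by (rule_tac someI[of _ "b ` I"]) auto
  then have "dual_bases V ?B (\<lambda>x. x) (\<lambda>x v. coordinates V ?B v x)" by (intro coordinates_dual_bases) auto
  from trace_independent[OF f this bc] show ?thesis by (simp add: trace_def Let_def)
qed

end

text \<open>
  A functional outside a subspace of the dual space is separated from it by a vector. The subspace is
  carried by coordinates to the type-based vector space \<open>'i \<Rightarrow> 'k\<close>, where linear forms extend.
\<close>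

lemma dual_separation:
  fixes V :: "('k::field, 'v, 'm) module_scheme" and I :: "'i set"
  assumes V: "vectorspace class_ring V" and bc: "dual_bases V I b c"
    and N: "\<And>\<phi>. \<phi> \<in> N \<Longrightarrow> linear_functional V \<phi>"
    and add: "\<And>\<phi> \<psi>. \<phi> \<in> N \<Longrightarrow> \<psi> \<in> N \<Longrightarrow> \<exists>\<chi>\<in>N. \<forall>v\<in>carrier V. \<chi> v = \<phi> v + \<psi> v"
    and smult: "\<And>k \<phi>. \<phi> \<in> N \<Longrightarrow> \<exists>\<chi>\<in>N. \<forall>v\<in>carrier V. \<chi> v = k * \<phi> v"
    and zero: "\<exists>\<phi>\<in>N. \<forall>v\<in>carrier V. \<phi> v = 0"
    and \<psi>: "linear_functional V \<psi>" "\<And>\<phi>. \<phi> \<in> N \<Longrightarrow> \<exists>v\<in>carrier V. \<phi> v \<noteq> \<psi> v"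
  shows "\<exists>v\<in>carrier V. (\<forall>\<phi>\<in>N. \<phi> v = 0) \<and> \<psi> v \<noteq> 0"
proof -
  interpret V: vectorspace class_ring V by (rule V)
  let ?s = "\<lambda>(k::'k) (f::'i \<Rightarrow> 'k) i. k * f i"
  interpret vp: vector_space_pair ?s "(*)"
    by unfold_locales (auto simp: fun_eq_iff algebra_simps)
  have fin: "finite I" and bV: "b i \<in> carrier V" if "i \<in> I" for i
    using bc that by (auto simp: dual_bases_def)
  have finI: "finite I" using bc by (simp add: dual_bases_def)
  \<comment> \<open>The coordinates of a functional are its values on the \<open>b i\<close>, padded
    by zero off \<open>I\<close> so that they form a vector of the whole function space.\<close>
  define r where "r \<phi> = (\<lambda>i. if i \<in> I then \<phi> (b i) else (0::'k))" for \<phi>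
  have r_eq: "(\<forall>v\<in>carrier V. \<phi> v = \<chi> v)"
    if "linear_functional V \<phi>" "linear_functional V \<chi>" "r \<phi> = r \<chi>" for \<phi> \<chi>
  proof
    fix v assume v: "v \<in> carrier V"
    have "\<phi> (b i) = \<chi> (b i)" if "i \<in> I" for i using fun_cong[OF \<open>r \<phi> = r \<chi>\<close>, of i] that by (simp add: r_def)
    then show "\<phi> v = \<chi> v"
      using functional_expansion[OF V bc that(1) v] functional_expansion[OF V bc that(2) v] by simp
  qed
  have sub: "vp.vs1.subspace (r ` N)"
  proof (rule vp.vs1.subspaceI)
    from zero obtain \<phi> where "\<phi> \<in> N" "\<forall>v\<in>carrier V. \<phi> v = 0" by blast
    then show "0 \<in> r ` N" by (intro image_eqI[of _ _ \<phi>]) (auto simp: r_def fun_eq_iff bV)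
  next
    fix x y assume "x \<in> r ` N" "y \<in> r ` N"
    then obtain \<phi> \<chi> where *: "\<phi> \<in> N" "\<chi> \<in> N" "x = r \<phi>" "y = r \<chi>" by blast
    with add obtain \<xi> where "\<xi> \<in> N" "\<forall>v\<in>carrier V. \<xi> v = \<phi> v + \<chi> v" by metis
    with * show "x + y \<in> r ` N" by (intro image_eqI[of _ _ \<xi>]) (auto simp: r_def fun_eq_iff bV)
  next
    fix k x assume "x \<in> r ` N"
    then obtain \<phi> where *: "\<phi> \<in> N" "x = r \<phi>" by blast
    with smult obtain \<xi> where "\<xi> \<in> N" "\<forall>v\<in>carrier V. \<xi> v = k * \<phi> v" by metis
    with * show "?s k x \<in> r ` N" by (intro image_eqI[of _ _ \<xi>]) (auto simp: r_def fun_eq_iff bV)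
  qed
  have notin: "r \<psi> \<notin> r ` N" using \<psi> r_eq N by (metis imageE)
  obtain B where B: "B \<subseteq> r ` N" "\<not> vp.vs1.dependent B" "r ` N \<subseteq> vp.vs1.span B"
    using vp.vs1.maximal_independent_subset by metis
  have "vp.vs1.span B = r ` N" using B sub by (simp add: subset_antisym vp.vs1.span_minimal)
  with notin B have ind: "\<not> vp.vs1.dependent (insert (r \<psi>) B)" by (simp add: vp.vs1.independent_insert)
  \<comment> \<open>A linear form on coordinate space that is 1 at the vector of
    \<open>\<psi>\<close> and 0 on a basis of the image of \<open>N\<close>; it exists because this
    basis stays independent after adding \<open>r \<psi>\<close>.\<close>
  obtain g where g: "Vector_Spaces.linear ?s (*) g" "\<forall>x\<in>insert (r \<psi>) B. g x = (if x = r \<psi> then 1 else 0)"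
    using vp.linear_independent_extend[OF ind, of "\<lambda>x. if x = r \<psi> then 1 else 0"] by blast
  interpret g: Vector_Spaces.linear ?s "(*)" g by (rule g(1))
  have gN: "g x = 0" if "x \<in> r ` N" for x
  proof (rule vp.linear_eq_0_on_span[OF g(1)])
    show "x \<in> vp.vs1.span B" using B that by blast
    show "g y = 0" if "y \<in> B" for y using g(2) that B(1) notin by auto
  qed
  define u where "u i = (\<lambda>j. if j = i then 1 else (0::'k))" for i :: 'i
  \<comment> \<open>Since \<open>I\<close> is finite, \<open>g\<close> is evaluation at a vector:
    its values on the unit vectors are the coordinates of that vector.\<close>
  define v where "v = (\<Oplus>\<^bsub>V\<^esub>i\<in>I. g (u i) \<odot>\<^bsub>V\<^esub> b i)"
  have v: "v \<in> carrier V" unfolding v_def using bV by (intro V.M.finsum_closed) auto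
  have ev: "\<phi> v = g (r \<phi>)" if \<phi>: "linear_functional V \<phi>" for \<phi>
  proof -
    have "\<phi> v = (\<Sum>i\<in>I. \<phi> (b i) * g (u i))"
      unfolding v_def using bV by (subst linear_functional_finsum[OF V \<phi> finI])
        (auto intro!: sum.cong simp: linear_functional_smult[OF \<phi>])
    also have "\<dots> = g (\<Sum>i\<in>I. ?s (\<phi> (b i)) (u i))" by (simp add: g.sum g.scale)
    also have "(\<Sum>i\<in>I. ?s (\<phi> (b i)) (u i)) = r \<phi>"
    proof
      fix j
      have "(\<Sum>i\<in>I. ?s (\<phi> (b i)) (u i)) j = (\<Sum>i\<in>I. \<phi> (b i) * u i j)"
        using finI by (induction I) auto
      also have "\<dots> = (\<Sum>i\<in>I. if j = i then \<phi> (b i) else 0)" by (rule sum.cong) (auto simp: u_def)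
      also have "\<dots> = r \<phi> j" using finI by (simp add: r_def)
      finally show "(\<Sum>i\<in>I. ?s (\<phi> (b i)) (u i)) j = r \<phi> j" .
    qed
    finally show ?thesis .
  qed
  show ?thesis
    using v ev[OF \<psi>(1)] ev[OF N] gN g(2) by (intro bexI[of _ v]) auto
qed

section \<open>Modules over algebras\<close>

text \<open>The two records may have different shapes as long as the operations agree; this covers
  algebras on a free space, \<open>point_lmodule\<close> and \<open>corner_lmodule\<close>.
  Negatives are obtained as multiples by -1, so closure under scaling provides them.\<close>

lemma vectorspace_restrict:
  fixes V :: "('k::field, 'v, 'm) module_scheme" and V' :: "('k, 'v, 'n) module_scheme"
  assumes V: "vectorspace class_ring V" and sub: "carrier V' \<subseteq> carrier V"
    and eq: "zero V' = zero V" "add V' = add V" "module.smult V' = module.smult V"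
    and closed: "\<zero>\<^bsub>V\<^esub> \<in> carrier V'"
      "\<And>v w. v \<in> carrier V' \<Longrightarrow> w \<in> carrier V' \<Longrightarrow> v \<oplus>\<^bsub>V\<^esub> w \<in> carrier V'"
      "\<And>c v. v \<in> carrier V' \<Longrightarrow> c \<odot>\<^bsub>V\<^esub> v \<in> carrier V'"
  shows "vectorspace class_ring V'"
proof -
  interpret V: vectorspace class_ring V by (rule V)
  have mem: "v \<in> carrier V" if "v \<in> carrier V'" for v using that sub by blast
  show ?thesis
  proof (rule vs_criteria)
    show "field (class_ring :: 'k ring)" by (rule class_field)
    show "\<forall>v\<in>carrier V'. \<exists>neg_v\<in>carrier V'. v \<oplus>\<^bsub>V'\<^esub> neg_v = \<zero>\<^bsub>V'\<^esub>"
    proof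
      fix v assume v: "v \<in> carrier V'"
      with closed(3)[of v "-1"] show "\<exists>neg_v\<in>carrier V'. v \<oplus>\<^bsub>V'\<^esub> neg_v = \<zero>\<^bsub>V'\<^esub>"
        by (intro bexI[of _ "(-1) \<odot>\<^bsub>V\<^esub> v"]) (simp_all add: eq smult_minus_one[OF V] mem V.M.r_neg)
    qed
  qed (auto simp: eq closed mem V.M.a_ac V.smult_l_distr[simplified] V.smult_r_distr[simplified]
      V.smult_assoc1[simplified] smult_class_ring[OF V])
qed

section \<open>The vector space with a given basis\<close>

lemma free_vs_simps [simp]:
  "zero (free_vs S) = (\<lambda>s. 0)"
  "add (free_vs S) = (\<lambda>f g s. f s + g s)"
  "module.smult (free_vs S) = (\<lambda>c f s. c * f s)"
  by (simp_all add: free_vs_def)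

lemma free_vs_carrier: "f \<in> carrier (free_vs S) \<longleftrightarrow> finite {s. f s \<noteq> 0} \<and> (\<forall>s. s \<notin> S \<longrightarrow> f s = 0)"
  by (auto simp: free_vs_def)

lemma free_vs_finite: "finite S \<Longrightarrow> f \<in> carrier (free_vs S) \<longleftrightarrow> (\<forall>s. s \<notin> S \<longrightarrow> f s = 0)"
  by (auto simp: free_vs_carrier intro: finite_subset[of _ S])

lemma basis_vec_carrier [simp]: "\<ee> s \<in> carrier (free_vs S) \<longleftrightarrow> s \<in> S"
proof -
  have "{t. \<ee> s t \<noteq> (0::'b)} = {s}" by (auto simp: basis_vec_def)
  then show ?thesis by (auto simp: free_vs_carrier basis_vec_def)
qed

lemma free_vs_closed:
  "f \<in> carrier (free_vs S) \<Longrightarrow> g \<in> carrier (free_vs S) \<Longrightarrow> (\<lambda>s. f s + g s) \<in> carrier (free_vs S)"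
  "f \<in> carrier (free_vs S) \<Longrightarrow> (\<lambda>s. c * f s) \<in> carrier (free_vs S)"
  "f \<in> carrier (free_vs S) \<Longrightarrow> g \<in> carrier (free_vs S) \<Longrightarrow> (\<lambda>s. f s - g s) \<in> carrier (free_vs S)"
proof -
  have fin: "finite {s. f s + g s \<noteq> 0}" "finite {s. f s - g s \<noteq> 0}"
    if "finite {s. f s \<noteq> 0}" "finite {s. g s \<noteq> 0}"
  proof -
    have "finite ({s. f s \<noteq> 0} \<union> {s. g s \<noteq> 0})" using that by simp
    then show "finite {s. f s + g s \<noteq> 0}" "finite {s. f s - g s \<noteq> 0}"
      by (auto elim!: rev_finite_subset simp del: finite_Un)
  qed
  have "finite {s. c * f s \<noteq> 0}" if "finite {s. f s \<noteq> 0}" using that by (auto elim!: rev_finite_subset)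
  with fin show "f \<in> carrier (free_vs S) \<Longrightarrow> g \<in> carrier (free_vs S) \<Longrightarrow> (\<lambda>s. f s + g s) \<in> carrier (free_vs S)"
    "f \<in> carrier (free_vs S) \<Longrightarrow> (\<lambda>s. c * f s) \<in> carrier (free_vs S)"
    "f \<in> carrier (free_vs S) \<Longrightarrow> g \<in> carrier (free_vs S) \<Longrightarrow> (\<lambda>s. f s - g s) \<in> carrier (free_vs S)"
    by (auto simp: free_vs_carrier)
qed

lemma free_vs_zero: "(\<lambda>s. 0) \<in> carrier (free_vs S)"
  by (simp add: free_vs_carrier)

lemma free_vs_vectorspace: "vectorspace class_ring (free_vs S :: ('k::field, 's \<Rightarrow> 'k) module)"
proof (rule vs_criteria)
  show "field (class_ring :: 'k ring)" by (rule class_field)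
  show "\<forall>v\<in>carrier (free_vs S). \<exists>neg_v\<in>carrier (free_vs S). v \<oplus>\<^bsub>free_vs S\<^esub> neg_v =
      \<zero>\<^bsub>free_vs S :: ('k, 's \<Rightarrow> 'k) module\<^esub>"
  proof
    fix v :: "'s \<Rightarrow> 'k" assume "v \<in> carrier (free_vs S)"
    with free_vs_closed(2)[of v S "-1"]
    show "\<exists>neg_v\<in>carrier (free_vs S). v \<oplus>\<^bsub>free_vs S\<^esub> neg_v = \<zero>\<^bsub>free_vs S\<^esub>"
      by (intro bexI[of _ "\<lambda>s. - v s"]) auto
  qed
qed (auto simp: free_vs_closed free_vs_zero algebra_simps)

text \<open>The induction runs over a finite set containing the support, splitting off one
  coefficient at a time. Linear and bilinear identities below are reduced to basis vectors by this
  rule.\<close>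

lemma free_vs_induct [consumes 1, case_names zero basis add]:
  assumes f: "f \<in> carrier (free_vs S)"
    and zero: "P (\<lambda>s. 0)"
    and basis: "\<And>s c. s \<in> S \<Longrightarrow> P (\<lambda>t. c * \<ee> s t)"
    and add: "\<And>f g. f \<in> carrier (free_vs S) \<Longrightarrow> g \<in> carrier (free_vs S) \<Longrightarrow> P f \<Longrightarrow> P g \<Longrightarrow> P (\<lambda>s. f s + g s)"
  shows "P f"
proof -
  have "P f" if "finite A" "A \<subseteq> S" "{s. f s \<noteq> 0} \<subseteq> A" for A f
    using that
  proof (induction A arbitrary: f)
    case empty
    then have "f = (\<lambda>s. 0)" by auto
    with zero show ?case by simp
  next
    case (insert a A)
    let ?f = "f(a := 0)" and ?g = "\<lambda>t. f a * \<ee> a t"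
    have c: "h \<in> carrier (free_vs S)" if "\<forall>s. s \<notin> insert a A \<longrightarrow> h s = 0" for h
      using that insert.hyps insert.prems
      by (auto simp: free_vs_carrier intro: finite_subset[of _ "insert a A"])
    have Pf: "P ?f" using insert by (intro insert.IH) auto
    have Pg: "P ?g" using insert.prems by (intro basis) auto
    have "P (\<lambda>s. ?f s + ?g s)"
      by (rule add[OF c c Pf Pg]) (use insert.prems in \<open>auto simp: basis_vec_def\<close>)
    moreover have "(\<lambda>s. ?f s + ?g s) = f" by (auto simp: basis_vec_def fun_eq_iff)
    ultimately show ?case by (simp only:)
  qed
  then show ?thesis using f by (auto simp: free_vs_carrier)
qed

section \<open>Opposite algebras and dual modules\<close>

lemma opposite_algebra_simps [simp]:
  "carrier (opposite_algebra A) = carrier A" "add (opposite_algebra A) = add A"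
  "module.smult (opposite_algebra A) = module.smult A" "one (opposite_algebra A) = one A"
  "zero (opposite_algebra A) = zero A" "mult (opposite_algebra A) = (\<lambda>a b. b \<otimes>\<^bsub>A\<^esub> a)"
  "opposite_algebra (opposite_algebra A) = A"
  by (simp_all add: opposite_algebra_def)

lemma dual_lmodule_simps [simp]:
  "\<phi> \<in> carrier (dual_lmodule M) \<longleftrightarrow> \<phi> \<in> extensional (carrier M) \<and> linear_functional M \<phi>"
  "zero (dual_lmodule M) = (\<lambda>v\<in>carrier M. 0)"
  "add (dual_lmodule M) = (\<lambda>\<phi> \<psi>. \<lambda>v\<in>carrier M. \<phi> v + \<psi> v)"
  "module.smult (dual_lmodule M) = (\<lambda>c \<phi>. \<lambda>v\<in>carrier M. c * \<phi> v)"
  "act (dual_lmodule M) = (\<lambda>a \<phi>. \<lambda>v\<in>carrier M. \<phi> (act M a v))"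
  by (auto simp: dual_lmodule_def linear_functional_def)

lemma dual_vectorspace:
  fixes M :: "('k::field, 'a, 'v) lmodule"
  assumes add: "\<And>v w. v \<in> carrier M \<Longrightarrow> w \<in> carrier M \<Longrightarrow> v \<oplus>\<^bsub>M\<^esub> w \<in> carrier M"
    and smult: "\<And>c v. v \<in> carrier M \<Longrightarrow> c \<odot>\<^bsub>M\<^esub> v \<in> carrier M"
  shows "vectorspace class_ring (dual_lmodule M)"
proof (rule vs_criteria)
  show "field (class_ring :: 'k ring)" by (rule class_field)
  show "\<forall>v\<in>carrier (dual_lmodule M). \<exists>neg_v\<in>carrier (dual_lmodule M). v \<oplus>\<^bsub>dual_lmodule M\<^esub> neg_v = \<zero>\<^bsub>dual_lmodule M\<^esub>"
  proof
    fix \<phi> assume "\<phi> \<in> carrier (dual_lmodule M)"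
    then show "\<exists>neg_v\<in>carrier (dual_lmodule M). \<phi> \<oplus>\<^bsub>dual_lmodule M\<^esub> neg_v = \<zero>\<^bsub>dual_lmodule M\<^esub>"
      by (intro bexI[of _ "\<lambda>v\<in>carrier M. - \<phi> v"])
        (auto simp: linear_functional_def add smult fun_eq_iff)
  qed
  show "\<forall>v\<in>carrier (dual_lmodule M). v \<oplus>\<^bsub>dual_lmodule M\<^esub> \<zero>\<^bsub>dual_lmodule M\<^esub> = v"
    "\<forall>v\<in>carrier (dual_lmodule M). \<one>\<^bsub>class_ring\<^esub> \<odot>\<^bsub>dual_lmodule M\<^esub> v = v"
    by (auto simp: fun_eq_iff restrict_def extensional_def)
qed (auto simp: linear_functional_def add smult algebra_simps fun_eq_iff)

text \<open>
  The laws of \<open>M\<close> are only assumed as far as functionals see them, so that the lemma applies to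
  tensor products before these are known to be modules.
\<close>

lemma dual_left_moduleI:
  fixes M :: "('k::field, 'a, 'v) lmodule" and A :: "('k, 'a) module"
  assumes add: "\<And>v w. v \<in> carrier M \<Longrightarrow> w \<in> carrier M \<Longrightarrow> v \<oplus>\<^bsub>M\<^esub> w \<in> carrier M"
    and smult: "\<And>c v. v \<in> carrier M \<Longrightarrow> c \<odot>\<^bsub>M\<^esub> v \<in> carrier M"
    and closed: "\<And>a v. a \<in> carrier A \<Longrightarrow> v \<in> carrier M \<Longrightarrow> act M a v \<in> carrier M"
    and add_right: "\<And>a v w. a \<in> carrier A \<Longrightarrow> v \<in> carrier M \<Longrightarrow> w \<in> carrier M \<Longrightarrow>
      act M a (v \<oplus>\<^bsub>M\<^esub> w) = act M a v \<oplus>\<^bsub>M\<^esub> act M a w"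
    and smult_right: "\<And>a c v. a \<in> carrier A \<Longrightarrow> v \<in> carrier M \<Longrightarrow>
      act M a (c \<odot>\<^bsub>M\<^esub> v) = c \<odot>\<^bsub>M\<^esub> act M a v"
    and add_left: "\<And>\<phi> a b v. linear_functional M \<phi> \<Longrightarrow> a \<in> carrier A \<Longrightarrow> b \<in> carrier A \<Longrightarrow>
      v \<in> carrier M \<Longrightarrow> \<phi> (act M (a \<oplus>\<^bsub>A\<^esub> b) v) = \<phi> (act M a v) + \<phi> (act M b v)"
    and smult_left: "\<And>\<phi> c a v. linear_functional M \<phi> \<Longrightarrow> a \<in> carrier A \<Longrightarrow> v \<in> carrier M \<Longrightarrow>
      \<phi> (act M (c \<odot>\<^bsub>A\<^esub> a) v) = c * \<phi> (act M a v)"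
    and one: "\<And>\<phi> v. linear_functional M \<phi> \<Longrightarrow> v \<in> carrier M \<Longrightarrow> \<phi> (act M \<one>\<^bsub>A\<^esub> v) = \<phi> v"
    and mult: "\<And>\<phi> a b v. linear_functional M \<phi> \<Longrightarrow> a \<in> carrier A \<Longrightarrow> b \<in> carrier A \<Longrightarrow>
      v \<in> carrier M \<Longrightarrow> \<phi> (act M (a \<otimes>\<^bsub>A\<^esub> b) v) = \<phi> (act M a (act M b v))"
  shows "left_module (opposite_algebra A) (dual_lmodule M)"
proof -
  interpret vectorspace class_ring "dual_lmodule M" by (rule dual_vectorspace) (fact add smult)+
  show ?thesis
  proof (unfold_locales, goal_cases)
    case (1 a \<phi>)
    then show ?case
      by (auto simp: linear_functional_def add smult closed add_right smult_right)
  next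
    case (2 a \<phi> \<psi>)
    then show ?case by (auto simp: closed fun_eq_iff)
  next
    case (3 a \<phi> c)
    then show ?case by (auto simp: closed fun_eq_iff)
  next
    case (4 a b \<phi>)
    then show ?case by (auto simp: add_left fun_eq_iff)
  next
    case (5 a \<phi> c)
    then show ?case by (auto simp: smult_left fun_eq_iff)
  next
    case (6 \<phi>)
    then show ?case by (auto simp: one fun_eq_iff extensional_def)
  next
    case (7 a b \<phi>)
    then show ?case by (auto simp: mult closed fun_eq_iff)
  qed
qed

lemma left_module_vectorspace: "left_module A M \<Longrightarrow> vectorspace class_ring M"
  by (simp add: left_module_def)

lemma left_module_closed:
  assumes "left_module A M"
  shows "v \<in> carrier M \<Longrightarrow> w \<in> carrier M \<Longrightarrow> v \<oplus>\<^bsub>M\<^esub> w \<in> carrier M"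
    and "v \<in> carrier M \<Longrightarrow> c \<odot>\<^bsub>M\<^esub> v \<in> carrier M"
    and "\<zero>\<^bsub>M\<^esub> \<in> carrier M"
    and "a \<in> carrier A \<Longrightarrow> v \<in> carrier M \<Longrightarrow> act M a v \<in> carrier M"
proof -
  interpret left_module A M by fact
  show "v \<in> carrier M \<Longrightarrow> w \<in> carrier M \<Longrightarrow> v \<oplus>\<^bsub>M\<^esub> w \<in> carrier M"
    "v \<in> carrier M \<Longrightarrow> c \<odot>\<^bsub>M\<^esub> v \<in> carrier M" "\<zero>\<^bsub>M\<^esub> \<in> carrier M"
    "a \<in> carrier A \<Longrightarrow> v \<in> carrier M \<Longrightarrow> act M a v \<in> carrier M"
    by (auto simp: act_closed)
qed

lemma act_zero:
  assumes M: "left_module A M" and a: "a \<in> carrier A"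
  shows "act M a \<zero>\<^bsub>M\<^esub> = \<zero>\<^bsub>M\<^esub>"
proof -
  interpret left_module A M by (rule M)
  have "act M a (0 \<odot>\<^bsub>M\<^esub> \<zero>\<^bsub>M\<^esub>) = 0 \<odot>\<^bsub>M\<^esub> act M a \<zero>\<^bsub>M\<^esub>" using a by (rule act_smult_right) simp
  then show ?thesis by (simp add: smult_class_ring(2)[OF vectorspace_axioms] act_closed[OF a])
qed

lemma dual_left_module:
  assumes M: "left_module A M"
  shows "left_module (opposite_algebra A) (dual_lmodule M)"
proof -
  interpret left_module A M by fact
  show ?thesis
    by (rule dual_left_moduleI)
      (auto simp: act_closed act_add_right act_smult_right act_add_left act_smult_left act_one
        act_mult linear_functional_def)
qed

section \<open>Module morphisms, irreducibility and Schur's lemma\<close>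

definition lmodule_hom ::
  "('k::field, 'a, 'm) module_scheme \<Rightarrow> ('k, 'a, 'v, 'n) lmodule_scheme \<Rightarrow>
   ('k, 'a, 'w, 'l) lmodule_scheme \<Rightarrow> ('v \<Rightarrow> 'w) set" where
  "lmodule_hom A M N = {\<phi> \<in> LinearCombinations.module_hom class_ring M N.
     \<forall>a\<in>carrier A. \<forall>v\<in>carrier M. \<phi> (act M a v) = act N a (\<phi> v)}"

lemma lmodule_homI:
  assumes "\<And>v. v \<in> carrier M \<Longrightarrow> \<phi> v \<in> carrier N"
    and "\<And>v w. v \<in> carrier M \<Longrightarrow> w \<in> carrier M \<Longrightarrow> \<phi> (v \<oplus>\<^bsub>M\<^esub> w) = \<phi> v \<oplus>\<^bsub>N\<^esub> \<phi> w"
    and "\<And>c v. v \<in> carrier M \<Longrightarrow> \<phi> (c \<odot>\<^bsub>M\<^esub> v) = c \<odot>\<^bsub>N\<^esub> \<phi> v"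
    and "\<And>a v. a \<in> carrier A \<Longrightarrow> v \<in> carrier M \<Longrightarrow> \<phi> (act M a v) = act N a (\<phi> v)"
  shows "\<phi> \<in> lmodule_hom A M N"
  using assms by (simp add: lmodule_hom_def LinearCombinations.module_hom_def)

lemma lmodule_homD:
  assumes "\<phi> \<in> lmodule_hom A M N"
  shows "v \<in> carrier M \<Longrightarrow> \<phi> v \<in> carrier N"
    and "v \<in> carrier M \<Longrightarrow> w \<in> carrier M \<Longrightarrow> \<phi> (v \<oplus>\<^bsub>M\<^esub> w) = \<phi> v \<oplus>\<^bsub>N\<^esub> \<phi> w"
    and "v \<in> carrier M \<Longrightarrow> \<phi> (c \<odot>\<^bsub>M\<^esub> v) = c \<odot>\<^bsub>N\<^esub> \<phi> v"
    and "a \<in> carrier A \<Longrightarrow> v \<in> carrier M \<Longrightarrow> \<phi> (act M a v) = act N a (\<phi> v)"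
  using assms by (auto simp: lmodule_hom_def LinearCombinations.module_hom_def)

lemma lmodule_hom_zero:
  assumes "\<phi> \<in> lmodule_hom A M N" "left_module A M" "left_module A N"
  shows "\<phi> \<zero>\<^bsub>M\<^esub> = \<zero>\<^bsub>N\<^esub>"
proof -
  note M = left_module_closed(3)[OF assms(2)]
  have "\<phi> \<zero>\<^bsub>M\<^esub> = \<phi> (0 \<odot>\<^bsub>M\<^esub> \<zero>\<^bsub>M\<^esub>)"
    using smult_class_ring(2)[OF left_module_vectorspace[OF assms(2)] M] by simp
  also have "\<dots> = 0 \<odot>\<^bsub>N\<^esub> \<phi> \<zero>\<^bsub>M\<^esub>" by (rule lmodule_homD(3)[OF assms(1) M])
  also have "\<dots> = \<zero>\<^bsub>N\<^esub>"
    by (rule smult_class_ring(2)[OF left_module_vectorspace[OF assms(3)] lmodule_homD(1)[OF assms(1) M]])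
  finally show ?thesis .
qed

lemma iso_lmodule_alt: "iso_lmodule A M N \<longleftrightarrow> (\<exists>\<phi>\<in>lmodule_hom A M N. bij_betw \<phi> (carrier M) (carrier N))"
  by (auto simp: iso_lmodule_def lmodule_hom_def)

lemma iso_lmodule_trans:
  assumes "iso_lmodule A L M" "iso_lmodule A M N"
  shows "iso_lmodule A L N"
proof -
  from assms obtain \<phi> \<psi> where *: "\<phi> \<in> lmodule_hom A L M" "bij_betw \<phi> (carrier L) (carrier M)"
    "\<psi> \<in> lmodule_hom A M N" "bij_betw \<psi> (carrier M) (carrier N)" by (auto simp: iso_lmodule_alt)
  then have "\<psi> \<circ> \<phi> \<in> lmodule_hom A L N"
    by (intro lmodule_homI) (simp_all add: lmodule_homD)
  with bij_betw_trans[OF *(2,4)] show ?thesis by (auto simp: iso_lmodule_alt)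
qed

lemma irreducible_lmodule_left_module: "irreducible_lmodule A M \<Longrightarrow> left_module A M"
  by (simp add: irreducible_lmodule_def)

lemma irreducible_lmodule_nonzero:
  assumes "irreducible_lmodule A M"
  obtains v where "v \<in> carrier M" "v \<noteq> \<zero>\<^bsub>M\<^esub>"
  using assms left_module_closed(3)[of A M] unfolding irreducible_lmodule_def by blast

lemma irreducible_lmoduleD:
  assumes "irreducible_lmodule A M" and "N \<subseteq> carrier M" and "\<zero>\<^bsub>M\<^esub> \<in> N"
    and "\<And>v w. v \<in> N \<Longrightarrow> w \<in> N \<Longrightarrow> v \<oplus>\<^bsub>M\<^esub> w \<in> N" and "\<And>c v. v \<in> N \<Longrightarrow> c \<odot>\<^bsub>M\<^esub> v \<in> N"
    and "\<And>a v. a \<in> carrier A \<Longrightarrow> v \<in> N \<Longrightarrow> act M a v \<in> N"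
    and "v \<in> N" "v \<noteq> \<zero>\<^bsub>M\<^esub>"
  shows "N = carrier M"
proof -
  interpret left_module A M using assms(1) by (rule irreducible_lmodule_left_module)
  have "LinearCombinations.submodule class_ring N M"
    using assms by unfold_locales auto
  then show ?thesis using assms unfolding irreducible_lmodule_def by blast
qed

lemma irreducible_lmoduleI:
  assumes M: "left_module A M" and v: "v \<in> carrier M" "v \<noteq> \<zero>\<^bsub>M\<^esub>"
    and N: "\<And>N w. N \<subseteq> carrier M \<Longrightarrow> \<zero>\<^bsub>M\<^esub> \<in> N \<Longrightarrow> (\<And>v w. v \<in> N \<Longrightarrow> w \<in> N \<Longrightarrow> v \<oplus>\<^bsub>M\<^esub> w \<in> N) \<Longrightarrow>
      (\<And>c v. v \<in> N \<Longrightarrow> c \<odot>\<^bsub>M\<^esub> v \<in> N) \<Longrightarrow> (\<And>a v. a \<in> carrier A \<Longrightarrow> v \<in> N \<Longrightarrow> act M a v \<in> N) \<Longrightarrow>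
      w \<in> N \<Longrightarrow> w \<noteq> \<zero>\<^bsub>M\<^esub> \<Longrightarrow> carrier M \<subseteq> N"
  shows "irreducible_lmodule A M"
proof -
  have "N = {\<zero>\<^bsub>M\<^esub>} \<or> N = carrier M"
    if "LinearCombinations.submodule class_ring N M" "\<forall>a\<in>carrier A. \<forall>v\<in>N. act M a v \<in> N" for N
  proof -
    interpret N: LinearCombinations.submodule class_ring N M by fact
    have "carrier M \<subseteq> N" if "w \<in> N" "w \<noteq> \<zero>\<^bsub>M\<^esub>" for w
      using N.subset N.m_closed N.smult_closed \<open>\<forall>a\<in>carrier A. \<forall>v\<in>N. act M a v \<in> N\<close> that
      by (intro N) auto
    with N.subset N.zero_closed show ?thesis by blast
  qed
  with M v show ?thesis unfolding irreducible_lmodule_def by auto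
qed

text \<open>The image is a submodule containing the nonzero vector \<open>\<phi> v\<close>, hence
  everything; a nonzero kernel would be everything too and would contain \<open>v\<close>. The
  carrier types of the two modules may differ.\<close>

lemma schur:
  assumes M: "irreducible_lmodule A M" and N: "irreducible_lmodule A N"
    and \<phi>: "\<phi> \<in> lmodule_hom A M N" and v: "v \<in> carrier M" "\<phi> v \<noteq> \<zero>\<^bsub>N\<^esub>"
  shows "iso_lmodule A M N"
proof -
  interpret M: left_module A M using M by (rule irreducible_lmodule_left_module)
  interpret N: left_module A N using N by (rule irreducible_lmodule_left_module)
  note hom = lmodule_homD[OF \<phi>]
  have \<phi>0: "\<phi> \<zero>\<^bsub>M\<^esub> = \<zero>\<^bsub>N\<^esub>" by (rule lmodule_hom_zero[OF \<phi>]) unfold_locales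
  have N0: "act N a \<zero>\<^bsub>N\<^esub> = \<zero>\<^bsub>N\<^esub>" if "a \<in> carrier A" for a
    by (rule act_zero[OF _ that]) unfold_locales
  have "\<phi> ` carrier M = carrier N"
  proof (rule irreducible_lmoduleD[OF N, of _ "\<phi> v"])
    show "\<zero>\<^bsub>N\<^esub> \<in> \<phi> ` carrier M" using \<phi>0 by (metis M.M.zero_closed imageI)
    show "x \<oplus>\<^bsub>N\<^esub> y \<in> \<phi> ` carrier M" if xy: "x \<in> \<phi> ` carrier M" "y \<in> \<phi> ` carrier M" for x y
    proof -
      from xy obtain a b where "a \<in> carrier M" "b \<in> carrier M" "x = \<phi> a" "y = \<phi> b" by blast
      then show ?thesis by (intro image_eqI[of _ _ "a \<oplus>\<^bsub>M\<^esub> b"]) (auto simp: hom)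
    qed
    show "c \<odot>\<^bsub>N\<^esub> x \<in> \<phi> ` carrier M" if x: "x \<in> \<phi> ` carrier M" for c x
    proof -
      from x obtain a where "a \<in> carrier M" "x = \<phi> a" by blast
      then show ?thesis by (intro image_eqI[of _ _ "c \<odot>\<^bsub>M\<^esub> a"]) (auto simp: hom)
    qed
    show "act N b x \<in> \<phi> ` carrier M" if b: "b \<in> carrier A" and x: "x \<in> \<phi> ` carrier M" for b x
    proof -
      from x obtain a where "a \<in> carrier M" "x = \<phi> a" by blast
      with b show ?thesis by (intro image_eqI[of _ _ "act M b a"]) (auto simp: hom M.act_closed)
    qed
  qed (use hom v in auto)
  moreover have "inj_on \<phi> (carrier M)"
  proof (rule inj_onI, rule ccontr)
    fix x y assume xy: "x \<in> carrier M" "y \<in> carrier M" "\<phi> x = \<phi> y" "x \<noteq> y"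
    \<comment> \<open>Two distinct vectors with equal image differ by a nonzero element of the
      kernel.\<close>
    let ?d = "x \<oplus>\<^bsub>M\<^esub> ((-1) \<odot>\<^bsub>M\<^esub> y)"
    have d: "?d \<in> carrier M" using xy by simp
    have "\<phi> ?d = \<phi> x \<oplus>\<^bsub>N\<^esub> ((-1) \<odot>\<^bsub>N\<^esub> \<phi> y)" using xy by (simp add: hom)
    then have \<phi>d: "\<phi> ?d = \<zero>\<^bsub>N\<^esub>" using xy by (simp add: smult_minus_one[OF N.vectorspace_axioms] hom N.M.r_neg)
    have "?d \<noteq> \<zero>\<^bsub>M\<^esub>"
    proof
      assume "?d = \<zero>\<^bsub>M\<^esub>"
      then have "x \<ominus>\<^bsub>M\<^esub> y = \<zero>\<^bsub>M\<^esub>" using xy by (simp add: smult_minus_one[OF M.vectorspace_axioms] M.M.minus_eq)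
      with xy show False by simp
    qed
    then have "{z \<in> carrier M. \<phi> z = \<zero>\<^bsub>N\<^esub>} = carrier M"
      using d \<phi>d \<phi>0 by (intro irreducible_lmoduleD[OF M, of _ ?d])
        (auto simp: hom M.act_closed N0 smult_class_ring[OF left_module_vectorspace])
    with v show False by blast
  qed
  ultimately show ?thesis using \<phi> by (auto simp: iso_lmodule_alt bij_betw_def)
qed

text \<open>An irreducible module is generated by any nonzero \<open>v\<close>, so it is spanned by
  the finitely many vectors \<open>act M (\<ee> s) v\<close>. The algebra is tied to
  \<open>free_vs S\<close> only in its linear structure, so that opposite algebras are covered as
  well.\<close>

lemma irreducible_finite_dual_bases:
  fixes M :: "('k::field, 's \<Rightarrow> 'k, 'v) lmodule"
  assumes M: "irreducible_lmodule A M" and S: "finite S" and A: "carrier A = carrier (free_vs S)"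
    "add A = add (free_vs S)" "module.smult A = module.smult (free_vs S)"
    and one: "\<one>\<^bsub>A\<^esub> \<in> carrier A"
    and mult: "\<And>a b. a \<in> carrier A \<Longrightarrow> b \<in> carrier A \<Longrightarrow> a \<otimes>\<^bsub>A\<^esub> b \<in> carrier A"
  obtains B c where "dual_bases M B (\<lambda>x. x) c"
proof -
  interpret left_module A M using M by (rule irreducible_lmodule_left_module)
  obtain v where v: "v \<in> carrier M" "v \<noteq> \<zero>\<^bsub>M\<^esub>" using M by (rule irreducible_lmodule_nonzero)
  let ?G = "(\<lambda>s. act M (\<ee> s) v) ` S"
  have G: "?G \<subseteq> carrier M" using v by (auto intro!: act_closed simp: A)
  interpret sp: LinearCombinations.submodule class_ring "span ?G" M by (rule span_is_submodule[OF G])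
  have smul: "c \<odot>\<^bsub>M\<^esub> x \<in> span ?G" if "x \<in> span ?G" for c x using that by simp
  have inc: "act M a v \<in> span ?G" if "a \<in> carrier (free_vs S)" for a
    using that
  proof (induction rule: free_vs_induct)
    case zero
    have "act M (\<lambda>s. 0) v = 0 \<odot>\<^bsub>M\<^esub> act M (\<lambda>s. 0) v"
      using act_smult_left[of "\<lambda>s. 0" v 0] v by (simp add: A free_vs_zero)
    also have "\<dots> = \<zero>\<^bsub>M\<^esub>"
      using v by (intro smult_class_ring(2)[OF vectorspace_axioms] act_closed) (auto simp: A free_vs_zero)
    finally show ?case by simp
  next
    case (basis s c)
    have "act M (\<lambda>t. c * \<ee> s t) v = c \<odot>\<^bsub>M\<^esub> act M (\<ee> s) v"
      using act_smult_left[of "\<ee> s" v c] basis v by (simp add: A)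
    with basis in_own_span[OF G] show ?case by (auto intro!: smul)
  next
    case (add f g)
    then show ?case using act_add_left[of f g v] v by (simp add: A)
  qed
  have "(\<lambda>b. act M b v) ` carrier A = carrier M"
  proof (rule irreducible_lmoduleD[OF M])
    show "v \<in> (\<lambda>b. act M b v) ` carrier A" using act_one[OF v(1)] one by (metis imageI)
    show "\<zero>\<^bsub>M\<^esub> \<in> (\<lambda>b. act M b v) ` carrier A"
      using act_smult_left[OF one v(1), of 0] v one
      by (intro image_eqI[of _ _ "0 \<odot>\<^bsub>A\<^esub> \<one>\<^bsub>A\<^esub>"])
        (auto simp: A free_vs_zero act_one smult_class_ring[OF vectorspace_axioms])
  next
    fix x y assume "x \<in> (\<lambda>b. act M b v) ` carrier A" "y \<in> (\<lambda>b. act M b v) ` carrier A"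
    then obtain a b where "a \<in> carrier A" "b \<in> carrier A" "x = act M a v" "y = act M b v" by blast
    with v show "x \<oplus>\<^bsub>M\<^esub> y \<in> (\<lambda>b. act M b v) ` carrier A"
      using free_vs_closed(1)[of a S b]
      by (intro image_eqI[of _ _ "a \<oplus>\<^bsub>A\<^esub> b"]) (simp add: act_add_left, simp add: A)
  next
    fix c x assume "x \<in> (\<lambda>b. act M b v) ` carrier A"
    then obtain a where "a \<in> carrier A" "x = act M a v" by blast
    with v show "c \<odot>\<^bsub>M\<^esub> x \<in> (\<lambda>b. act M b v) ` carrier A"
      using free_vs_closed(2)[of a S c]
      by (intro image_eqI[of _ _ "c \<odot>\<^bsub>A\<^esub> a"]) (simp add: act_smult_left, simp add: A)
  next
    fix b x assume b: "b \<in> carrier A" and "x \<in> (\<lambda>b. act M b v) ` carrier A"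
    then obtain a where "a \<in> carrier A" "x = act M a v" by blast
    with v b show "act M b x \<in> (\<lambda>b. act M b v) ` carrier A"
      by (intro image_eqI[of _ _ "b \<otimes>\<^bsub>A\<^esub> a"]) (simp_all add: act_mult mult)
  qed (use v act_closed in auto)
  then have "carrier M \<subseteq> span ?G" using inc by (metis A(1) image_subsetI)
  with sp.subset have "span ?G = carrier M" by blast
  then have fin_dim unfolding fin_dim_def using G S by blast
  then obtain B where "finite B" "basis B" using finite_basis_exists by blast
  with coordinates_dual_bases[OF vectorspace_axioms] that show ?thesis by blast
qed

section \<open>Duality for finite-dimensional modules\<close>

lemma dual_dual_bases:
  fixes M :: "('k::field, 'a, 'v) lmodule"
  assumes M: "vectorspace class_ring M" and bc: "dual_bases M I b c"
  shows "dual_bases (dual_lmodule M) I (\<lambda>i. restrict (c i) (carrier M)) (\<lambda>i \<phi>. \<phi> (b i))"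
proof -
  interpret vectorspace class_ring M by fact
  have b: "b i \<in> carrier M" and c: "linear_functional M (c i)" if "i \<in> I" for i
    using bc that by (auto simp: dual_bases_def)
  have "\<phi> = (\<lambda>v\<in>carrier M. 0)" if \<phi>: "\<phi> \<in> carrier (dual_lmodule M)" "\<forall>i\<in>I. \<phi> (b i) = 0" for \<phi>
    using \<phi> functional_expansion[OF M bc, of \<phi>] by (auto simp: fun_eq_iff extensional_def)
  moreover have "linear_functional M (restrict (c i) (carrier M))" if "i \<in> I" for i
    using c[OF that] by (auto simp: linear_functional_def)
  ultimately show ?thesis
    using bc b by (auto simp: dual_bases_def linear_functional_def[of "dual_lmodule M"])
qed

text \<open>A proper submodule of the dual misses some functional, and separation gives a nonzero
  vector killed by the submodule. The vectors killed by it form a submodule of \<open>M\<close>,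
  because the dual action is the transpose; so all of \<open>M\<close> is killed and the submodule
  is zero. Here \<open>\<omega>\<close> is a nonzero functional, not the 3-cocycle.\<close>

lemma dual_irreducible:
  fixes M :: "('k::field, 'a, 'v) lmodule"
  assumes M: "irreducible_lmodule A M" and bc: "dual_bases M I b c"
  shows "irreducible_lmodule (opposite_algebra A) (dual_lmodule M)"
proof -
  interpret left_module A M using M by (rule irreducible_lmodule_left_module)
  interpret D: left_module "opposite_algebra A" "dual_lmodule M"
    by (rule dual_left_module) unfold_locales
  obtain v where v: "v \<in> carrier M" "v \<noteq> \<zero>\<^bsub>M\<^esub>" using M by (rule irreducible_lmodule_nonzero)
  then obtain i where i: "i \<in> I" "c i v \<noteq> 0" using bc unfolding dual_bases_def by blast
  show ?thesis
  proof (rule irreducible_lmoduleI)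
    show "left_module (opposite_algebra A) (dual_lmodule M)" by unfold_locales
    show "restrict (c i) (carrier M) \<in> carrier (dual_lmodule M)"
      using bc i by (auto simp: dual_bases_def linear_functional_def)
    show "restrict (c i) (carrier M) \<noteq> \<zero>\<^bsub>dual_lmodule M\<^esub>"
      using i v by (auto simp: fun_eq_iff)
  next
    fix N \<omega>
    assume N: "N \<subseteq> carrier (dual_lmodule M)" and zero: "\<zero>\<^bsub>dual_lmodule M\<^esub> \<in> N"
      and add: "\<And>\<phi> \<psi>. \<phi> \<in> N \<Longrightarrow> \<psi> \<in> N \<Longrightarrow> \<phi> \<oplus>\<^bsub>dual_lmodule M\<^esub> \<psi> \<in> N"
      and smult: "\<And>c \<phi>. \<phi> \<in> N \<Longrightarrow> c \<odot>\<^bsub>dual_lmodule M\<^esub> \<phi> \<in> N"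
      and act: "\<And>a \<phi>. a \<in> carrier (opposite_algebra A) \<Longrightarrow> \<phi> \<in> N \<Longrightarrow> act (dual_lmodule M) a \<phi> \<in> N"
      and \<omega>: "\<omega> \<in> N" "\<omega> \<noteq> \<zero>\<^bsub>dual_lmodule M\<^esub>"
    show "carrier (dual_lmodule M) \<subseteq> N"
    proof (rule ccontr)
      assume "\<not> carrier (dual_lmodule M) \<subseteq> N"
      then obtain \<psi> where \<psi>: "\<psi> \<in> carrier (dual_lmodule M)" "\<psi> \<notin> N" by blast
      have lin: "linear_functional M \<phi>" if "\<phi> \<in> N" for \<phi> using that N by auto
      have "\<exists>v\<in>carrier M. (\<forall>\<phi>\<in>N. \<phi> v = 0) \<and> \<psi> v \<noteq> 0"
      proof (rule dual_separation[OF vectorspace_axioms bc lin])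
        show "\<exists>\<chi>\<in>N. \<forall>v\<in>carrier M. \<chi> v = \<phi> v + \<xi> v" if "\<phi> \<in> N" "\<xi> \<in> N" for \<phi> \<xi>
          using add[OF that] by (intro bexI[of _ "\<phi> \<oplus>\<^bsub>dual_lmodule M\<^esub> \<xi>"]) auto
        show "\<exists>\<chi>\<in>N. \<forall>v\<in>carrier M. \<chi> v = k * \<phi> v" if "\<phi> \<in> N" for k \<phi>
          using smult[OF that] by (intro bexI[of _ "k \<odot>\<^bsub>dual_lmodule M\<^esub> \<phi>"]) auto
        show "\<exists>\<phi>\<in>N. \<forall>v\<in>carrier M. \<phi> v = 0"
          using zero by (intro bexI[of _ "\<zero>\<^bsub>dual_lmodule M\<^esub>"]) auto
        show "linear_functional M \<psi>" using \<psi> by simp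
        show "\<exists>v\<in>carrier M. \<phi> v \<noteq> \<psi> v" if "\<phi> \<in> N" for \<phi>
        proof (rule ccontr)
          assume "\<not> (\<exists>v\<in>carrier M. \<phi> v \<noteq> \<psi> v)"
          then have "\<phi> = \<psi>" using that N \<psi> by (intro extensionalityI[of \<phi> "carrier M" \<psi>]) auto
          with that \<psi> show False by simp
        qed
      qed
      then obtain u where u: "u \<in> carrier M" "\<forall>\<phi>\<in>N. \<phi> u = 0" "\<psi> u \<noteq> 0" by blast
      have "{v \<in> carrier M. \<forall>\<phi>\<in>N. \<phi> v = 0} = carrier M"
      proof (rule irreducible_lmoduleD[OF M])
        show "u \<in> {v \<in> carrier M. \<forall>\<phi>\<in>N. \<phi> v = 0}" using u by simp
        show "u \<noteq> \<zero>\<^bsub>M\<^esub>" using u \<psi> linear_functional_zero[OF vectorspace_axioms] by force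
        show "\<zero>\<^bsub>M\<^esub> \<in> {v \<in> carrier M. \<forall>\<phi>\<in>N. \<phi> v = 0}"
          using linear_functional_zero[OF vectorspace_axioms lin] by simp
        show "act M a v \<in> {v \<in> carrier M. \<forall>\<phi>\<in>N. \<phi> v = 0}"
          if "a \<in> carrier A" "v \<in> {v \<in> carrier M. \<forall>\<phi>\<in>N. \<phi> v = 0}" for a v
          using that act by (force simp: act_closed)
      qed (auto simp: linear_functional_add[OF lin] linear_functional_smult[OF lin])
      then have "\<omega> v = 0" if "v \<in> carrier M" for v using that \<omega>(1) by blast
      then have "\<omega> = \<zero>\<^bsub>dual_lmodule M\<^esub>" using \<omega>(1) N by (auto simp: fun_eq_iff extensional_def)
      with \<omega>(2) show False by simp
    qed
  qed
qed

text \<open>A morphism of dual modules is the transpose of a morphism in the other direction.\<close>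

lemma dual_hom_imp_iso:
  fixes M N :: "('k::field, 'a, 'v) lmodule"
  assumes M: "irreducible_lmodule A M" and N: "irreducible_lmodule A N" and bc: "dual_bases M I b c"
    and f: "f \<in> lmodule_hom (opposite_algebra A) (dual_lmodule M) (dual_lmodule N)"
    and \<mu>: "\<mu> \<in> carrier (dual_lmodule M)" "f \<mu> \<noteq> \<zero>\<^bsub>dual_lmodule N\<^esub>"
  shows "iso_lmodule A N M"
proof -
  interpret M: left_module A M using M by (rule irreducible_lmodule_left_module)
  interpret N: left_module A N using N by (rule irreducible_lmodule_left_module)
  interpret DM: left_module "opposite_algebra A" "dual_lmodule M"
    by (rule dual_left_module) unfold_locales
  note hom = lmodule_homD[OF f]
  let ?c = "\<lambda>i. restrict (c i) (carrier M)"
  have b: "b i \<in> carrier M" and fin: "finite I" and c: "?c i \<in> carrier (dual_lmodule M)" if "i \<in> I" for i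
    using bc that by (auto simp: dual_bases_def linear_functional_def)
  have finI: "finite I" using bc by (simp add: dual_bases_def)
  have fN: "linear_functional N (f \<phi>)" if "\<phi> \<in> carrier (dual_lmodule M)" for \<phi>
    using hom(1)[OF that] by simp
  \<comment> \<open>The transpose of \<open>f\<close>: in finite dimension the map sending
    \<open>\<phi>\<close> to \<open>f \<phi> n\<close> is evaluation at a unique vector
    \<open>g n\<close>, written down in dual bases.\<close>
  define g where "g n = (\<Oplus>\<^bsub>M\<^esub>i\<in>I. f (?c i) n \<odot>\<^bsub>M\<^esub> b i)" for n
  have g: "g n \<in> carrier M" for n unfolding g_def using b by (intro M.M.finsum_closed) auto
  have gf: "\<phi> (g n) = f \<phi> n" if \<phi>: "\<phi> \<in> carrier (dual_lmodule M)" and n: "n \<in> carrier N" for \<phi> n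
  proof -
    have l: "linear_functional M \<phi>" using \<phi> by simp
    have "\<phi> (g n) = (\<Sum>i\<in>I. \<phi> (b i) * f (?c i) n)"
      unfolding g_def using b by (subst linear_functional_finsum[OF M.vectorspace_axioms l finI])
        (auto intro!: sum.cong simp: linear_functional_smult[OF l])
    also have "\<dots> = f \<phi> n"
    proof (rule functional_expansion[OF DM.vectorspace_axioms dual_dual_bases[OF M.vectorspace_axioms bc] _
        \<phi>, symmetric])
      show "linear_functional (dual_lmodule M) (\<lambda>\<phi>. f \<phi> n)"
        unfolding linear_functional_def
      proof (intro conjI ballI allI)
        fix \<phi> \<psi> k assume *: "\<phi> \<in> carrier (dual_lmodule M)" "\<psi> \<in> carrier (dual_lmodule M)"
        show "f (\<phi> \<oplus>\<^bsub>dual_lmodule M\<^esub> \<psi>) n = f \<phi> n + f \<psi> n"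
          unfolding hom(2)[OF *] using n by simp
        show "f (k \<odot>\<^bsub>dual_lmodule M\<^esub> \<phi>) n = k * f \<phi> n"
          unfolding hom(3)[OF *(1)] using n by simp
      qed
    qed
    finally show ?thesis .
  qed
  \<comment> \<open>Elements of the dual separate the points of \<open>M\<close>, so every law for
    \<open>g\<close> reduces to the corresponding law for \<open>f\<close>.\<close>
  have eqI: "x = y" if xy: "x \<in> carrier M" "y \<in> carrier M"
    "\<And>\<phi>. \<phi> \<in> carrier (dual_lmodule M) \<Longrightarrow> \<phi> x = \<phi> y" for x y
  proof -
    have "c i x = c i y" if i: "i \<in> I" for i using xy(3)[OF c[OF i]] xy(1,2) by simp
    then show ?thesis by (rule dual_bases_eqI[OF M.vectorspace_axioms bc xy(1,2)])
  qed
  have "g \<in> lmodule_hom A N M"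
  proof (rule lmodule_homI)
    show "g (v \<oplus>\<^bsub>N\<^esub> w) = g v \<oplus>\<^bsub>M\<^esub> g w" if "v \<in> carrier N" "w \<in> carrier N" for v w
      using that g by (intro eqI) (auto simp: gf linear_functional_add[of M] linear_functional_add[OF fN])
    show "g (k \<odot>\<^bsub>N\<^esub> v) = k \<odot>\<^bsub>M\<^esub> g v" if "v \<in> carrier N" for k v
      using that g by (intro eqI) (auto simp: gf linear_functional_smult[of M] linear_functional_smult[OF fN])
    show "g (act N a v) = act M a (g v)" if a: "a \<in> carrier A" and v: "v \<in> carrier N" for a v
    proof (rule eqI)
      fix \<phi> assume \<phi>: "\<phi> \<in> carrier (dual_lmodule M)"
      have "\<phi> (act M a (g v)) = act (dual_lmodule M) a \<phi> (g v)" using g by simp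
      also have "\<dots> = f (act (dual_lmodule M) a \<phi>) v"
        using a \<phi> v by (intro gf DM.act_closed) auto
      also have "\<dots> = f \<phi> (act N a v)" using a v \<phi> by (subst hom(4)) auto
      also have "\<dots> = \<phi> (g (act N a v))" using gf[OF \<phi> N.act_closed[OF a v]] by simp
      finally show "\<phi> (g (act N a v)) = \<phi> (act M a (g v))" by simp
    qed (use a v g M.act_closed in auto)
  qed (rule g)
  moreover obtain n where "n \<in> carrier N" "f \<mu> n \<noteq> 0"
    using \<mu> hom(1)[OF \<mu>(1)] by (auto simp: fun_eq_iff extensional_def split: if_splits)
  moreover have "g n \<noteq> \<zero>\<^bsub>M\<^esub>" if "n \<in> carrier N" "f \<mu> n \<noteq> 0" for n
    using gf[OF \<mu>(1) that(1)] that linear_functional_zero[OF M.vectorspace_axioms, of \<mu>] \<mu>(1) by auto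
  ultimately show ?thesis using schur[OF N M] by blast
qed

section \<open>Transport of a module to another carrier type\<close>

definition image_lmodule :: "('v \<Rightarrow> 'u) \<Rightarrow> ('k, 'a, 'v) lmodule \<Rightarrow> ('k, 'a, 'u) lmodule" where
  "image_lmodule j M =
    \<lparr>carrier = j ` carrier M, mult = undefined, one = undefined, zero = j \<zero>\<^bsub>M\<^esub>,
     add = (\<lambda>x y. j (inv_into (carrier M) j x \<oplus>\<^bsub>M\<^esub> inv_into (carrier M) j y)),
     smult = (\<lambda>c x. j (c \<odot>\<^bsub>M\<^esub> inv_into (carrier M) j x)),
     act = (\<lambda>a x. j (act M a (inv_into (carrier M) j x)))\<rparr>"

lemma image_irreducible:
  fixes M :: "('k::field, 'a, 'v) lmodule" and j :: "'v \<Rightarrow> 'u"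
  assumes M: "irreducible_lmodule A M" and j: "inj_on j (carrier M)"
  shows "irreducible_lmodule A (image_lmodule j M)" and "iso_lmodule A M (image_lmodule j M)"
proof -
  interpret M: left_module A M using M by (rule irreducible_lmodule_left_module)
  let ?N = "image_lmodule j M"
  note simps = image_lmodule_def inv_into_f_f[OF j]
  have [simp]: "carrier ?N = j ` carrier M" "\<zero>\<^bsub>?N\<^esub> = j \<zero>\<^bsub>M\<^esub>" by (simp_all add: image_lmodule_def)
  have [simp]: "j v \<oplus>\<^bsub>?N\<^esub> j w = j (v \<oplus>\<^bsub>M\<^esub> w)" if "v \<in> carrier M" "w \<in> carrier M" for v w
    using that by (simp add: simps)
  have [simp]: "c \<odot>\<^bsub>?N\<^esub> j v = j (c \<odot>\<^bsub>M\<^esub> v)" "act ?N a (j v) = j (act M a v)" if "v \<in> carrier M" for a c v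
    using that by (simp_all add: simps)
  have vs: "vectorspace class_ring ?N"
  proof (rule vs_criteria)
    show "field (class_ring :: 'k ring)" by (rule class_field)
    show "\<forall>v\<in>carrier ?N. \<exists>neg_v\<in>carrier ?N. v \<oplus>\<^bsub>?N\<^esub> neg_v = \<zero>\<^bsub>?N\<^esub>"
    proof
      fix x assume "x \<in> carrier ?N"
      then obtain v where "v \<in> carrier M" "x = j v" by auto
      then show "\<exists>neg_v\<in>carrier ?N. x \<oplus>\<^bsub>?N\<^esub> neg_v = \<zero>\<^bsub>?N\<^esub>"
        by (intro bexI[of _ "j (\<ominus>\<^bsub>M\<^esub> v)"]) (auto simp: M.M.r_neg)
    qed
  qed (auto simp: M.M.a_ac M.smult_l_distr[simplified] M.smult_r_distr[simplified]
      M.smult_assoc1[simplified] smult_class_ring[OF M.vectorspace_axioms])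
  have N: "left_module A ?N"
    unfolding left_module_def left_module_axioms_def
    using vs by (auto simp: M.act_closed M.act_add_right M.act_smult_right M.act_add_left
        M.act_smult_left M.act_one M.act_mult)
  have jhom: "j \<in> lmodule_hom A M ?N" by (rule lmodule_homI) (auto simp: M.act_closed)
  with j show "iso_lmodule A M ?N" by (auto simp: iso_lmodule_alt bij_betw_def)
  obtain v where v: "v \<in> carrier M" "v \<noteq> \<zero>\<^bsub>M\<^esub>" using M by (rule irreducible_lmodule_nonzero)
  show "irreducible_lmodule A ?N"
  proof (rule irreducible_lmoduleI[OF N])
    show "j v \<in> carrier ?N" "j v \<noteq> \<zero>\<^bsub>?N\<^esub>" using v j by (auto dest: inj_onD)
  next
    fix S w
    assume S: "S \<subseteq> carrier ?N" "\<zero>\<^bsub>?N\<^esub> \<in> S" "\<And>v w. v \<in> S \<Longrightarrow> w \<in> S \<Longrightarrow> v \<oplus>\<^bsub>?N\<^esub> w \<in> S"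
      "\<And>c v. v \<in> S \<Longrightarrow> c \<odot>\<^bsub>?N\<^esub> v \<in> S" "\<And>a v. a \<in> carrier A \<Longrightarrow> v \<in> S \<Longrightarrow> act ?N a v \<in> S"
      "w \<in> S" "w \<noteq> \<zero>\<^bsub>?N\<^esub>"
    from S obtain u where u: "u \<in> carrier M" "w = j u" by auto
    have "{v \<in> carrier M. j v \<in> S} = carrier M"
    proof (rule irreducible_lmoduleD[OF M])
      show "x \<oplus>\<^bsub>M\<^esub> y \<in> {v \<in> carrier M. j v \<in> S}"
          if "x \<in> {v \<in> carrier M. j v \<in> S}" "y \<in> {v \<in> carrier M. j v \<in> S}" for x y
        using that S(3)[of "j x" "j y"] by simp
      show "c \<odot>\<^bsub>M\<^esub> x \<in> {v \<in> carrier M. j v \<in> S}" if "x \<in> {v \<in> carrier M. j v \<in> S}" for c x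
        using that S(4)[of "j x" c] by simp
      show "act M a x \<in> {v \<in> carrier M. j v \<in> S}" if "a \<in> carrier A" "x \<in> {v \<in> carrier M. j v \<in> S}" for a x
        using that S(5)[of a "j x"] by (simp add: M.act_closed)
      show "u \<in> {v \<in> carrier M. j v \<in> S}" "u \<noteq> \<zero>\<^bsub>M\<^esub>" using u S by auto
    qed (use S in auto)
    then show "carrier ?N \<subseteq> S" by auto
  qed
qed

text \<open>Lists of irreducible modules are complete with respect to carriers in
  \<open>nat \<Rightarrow> 'k\<close>, so a module found on any other type has to be moved there
  before it can be located in the list. Its coordinate vector is an injective encoding.\<close>

lemma irreducible_nat_copy:
  fixes M :: "('k::field, 'a, 'v) lmodule"
  assumes M: "irreducible_lmodule A M" and bc: "dual_bases M I b c"
  obtains N :: "('k, 'a, nat \<Rightarrow> 'k) lmodule" where "irreducible_lmodule A N" "iso_lmodule A M N"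
proof -
  have "finite I" using bc by (simp add: dual_bases_def)
  then obtain n and h :: "nat \<Rightarrow> 'c" where h: "h ` {i. i < n} = I" using finite_imp_nat_seg_image_inj_on by metis
  \<comment> \<open>\<open>h\<close> lists the index set by the numbers below \<open>n\<close>; it
    need only be onto. Positions from \<open>n\<close> on get the default 0.\<close>
  define j where "j v = (\<lambda>i. if i < n then c (h i) v else 0)" for v
  have "inj_on j (carrier M)"
  proof (rule inj_onI)
    fix x y assume xy: "x \<in> carrier M" "y \<in> carrier M" "j x = j y"
    interpret left_module A M using M by (rule irreducible_lmodule_left_module)
    have "c i x = c i y" if "i \<in> I" for i
    proof -
      from that h obtain m where "m < n" "i = h m" by blast
      with fun_cong[OF xy(3), of m] show ?thesis by (simp add: j_def)
    qed
    then show "x = y" by (rule dual_bases_eqI[OF vectorspace_axioms bc xy(1,2)])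
  qed
  from image_irreducible[OF M this] that show ?thesis by blast
qed

section \<open>Algebras with a basis\<close>

text \<open>Summing over any finite set that contains the support allows functions with different
  supports to share one index set.\<close>

lemma linear_extension_eq:
  assumes "finite T" "{s. f s \<noteq> 0} \<subseteq> T"
  shows "linear_extension h f = (\<lambda>r. \<Sum>s\<in>T. f s * h s r)"
  unfolding linear_extension_def using assms by (intro ext sum.mono_neutral_left) auto

lemma linear_extension_add:
  assumes "f \<in> carrier (free_vs S)" "g \<in> carrier (free_vs S)"
  shows "linear_extension h (\<lambda>s. f s + g s) = (\<lambda>r. linear_extension h f r + linear_extension h g r)"
proof -
  let ?T = "{s. f s \<noteq> 0} \<union> {s. g s \<noteq> 0}"
  have "finite ?T" using assms by (simp add: free_vs_carrier)
  then show ?thesis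
    by (subst (1 2 3) linear_extension_eq[of ?T]) (auto simp: sum.distrib algebra_simps)
qed

lemma linear_extension_smult: "linear_extension h (\<lambda>s. c * f s) = (\<lambda>r. c * linear_extension h f r)"
proof (cases "c = 0")
  case True
  then show ?thesis by (simp add: linear_extension_def)
next
  case False
  then show ?thesis by (simp add: linear_extension_def sum_distrib_left mult.assoc)
qed

lemma linear_extension_zero: "linear_extension h (\<lambda>s. 0) = (\<lambda>r. 0)"
  by (simp add: linear_extension_def)

lemma linear_extension_closed:
  assumes "f \<in> carrier (free_vs S)" "\<And>s. s \<in> S \<Longrightarrow> h s \<in> carrier (free_vs T)"
  shows "linear_extension h f \<in> carrier (free_vs T)"
  using assms(1)
proof (induction rule: free_vs_induct)
  case zero
  show ?case by (simp add: linear_extension_zero free_vs_zero)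
next
  case (basis s c)
  then show ?case
    using free_vs_closed(2)[OF assms(2), of s c]
      by (simp add: linear_extension_smult linear_extension_basis_vec)
next
  case (add f g)
  then show ?case by (simp add: linear_extension_add free_vs_closed(1))
qed

lemma linear_extension_diff:
  assumes "f \<in> carrier (free_vs S)" "g \<in> carrier (free_vs S)"
  shows "linear_extension h (\<lambda>s. f s - g s) = (\<lambda>r. linear_extension h f r - linear_extension h g r)"
  using linear_extension_add[OF assms(1) free_vs_closed(2)[OF assms(2)], of h "-1"]
  by (simp add: linear_extension_smult[of h "-1", simplified])

lemma linear_extension_fun_add:
  "linear_extension (\<lambda>s r. h s r + k s r) f = (\<lambda>r. linear_extension h f r + linear_extension k f r)"
  by (simp add: linear_extension_def sum.distrib algebra_simps)

lemma linear_extension_fun_smult: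
  "linear_extension (\<lambda>s r. c * h s r) f = (\<lambda>r. c * linear_extension h f r)"
  by (simp add: linear_extension_def sum_distrib_left mult.left_commute)

section \<open>Unital algebras given by structure constants\<close>

locale unital_algebra = vectorspace class_ring A for A :: "('k::field, 'a) module" (structure) +
  assumes mult_closed: "a \<in> carrier A \<Longrightarrow> b \<in> carrier A \<Longrightarrow> a \<otimes> b \<in> carrier A"
    and one_closed: "\<one> \<in> carrier A"
    and mult_assoc: "a \<in> carrier A \<Longrightarrow> b \<in> carrier A \<Longrightarrow> c \<in> carrier A \<Longrightarrow> (a \<otimes> b) \<otimes> c = a \<otimes> (b \<otimes> c)"
    and one_left: "a \<in> carrier A \<Longrightarrow> \<one> \<otimes> a = a"
    and one_right: "a \<in> carrier A \<Longrightarrow> a \<otimes> \<one> = a"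
    and add_mult: "a \<in> carrier A \<Longrightarrow> b \<in> carrier A \<Longrightarrow> c \<in> carrier A \<Longrightarrow> (a \<oplus> b) \<otimes> c = a \<otimes> c \<oplus> b \<otimes> c"
    and mult_add: "a \<in> carrier A \<Longrightarrow> b \<in> carrier A \<Longrightarrow> c \<in> carrier A \<Longrightarrow> a \<otimes> (b \<oplus> c) = a \<otimes> b \<oplus> a \<otimes> c"
    and smult_mult: "a \<in> carrier A \<Longrightarrow> b \<in> carrier A \<Longrightarrow> (k \<odot> a) \<otimes> b = k \<odot> (a \<otimes> b)"
    and mult_smult: "a \<in> carrier A \<Longrightarrow> b \<in> carrier A \<Longrightarrow> a \<otimes> (k \<odot> b) = k \<odot> (a \<otimes> b)"

lemma algebra_with_basis_simps [simp]:
  "carrier (algebra_with_basis S m u) = carrier (free_vs S)"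
  "zero (algebra_with_basis S m u) = (\<lambda>s. 0)"
  "add (algebra_with_basis S m u) = (\<lambda>f g s. f s + g s)"
  "module.smult (algebra_with_basis S m u) = (\<lambda>c f s. c * f s)"
  "one (algebra_with_basis S m u) = u"
  by (simp_all add: algebra_with_basis_def)

lemma algebra_with_basis_mult:
  "f \<otimes>\<^bsub>algebra_with_basis S m u\<^esub> g = linear_extension (\<lambda>s. linear_extension (m s) g) f"
  by (simp add: algebra_with_basis_def)

lemma algebra_with_basis_mult_basis:
  "\<ee> s \<otimes>\<^bsub>algebra_with_basis S m u\<^esub> \<ee> t = m s t"
  by (simp add: algebra_with_basis_mult linear_extension_basis_vec)

lemma algebra_with_basis_bilinear:
  fixes S m u
  defines "A \<equiv> algebra_with_basis S m u"
  shows "f \<in> carrier (free_vs S) \<Longrightarrow> g \<in> carrier (free_vs S) \<Longrightarrow>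
      (\<lambda>s. f s + g s) \<otimes>\<^bsub>A\<^esub> h = (\<lambda>s. (f \<otimes>\<^bsub>A\<^esub> h) s + (g \<otimes>\<^bsub>A\<^esub> h) s)"
    and "f \<in> carrier (free_vs S) \<Longrightarrow> g \<in> carrier (free_vs S) \<Longrightarrow>
      h \<otimes>\<^bsub>A\<^esub> (\<lambda>s. f s + g s) = (\<lambda>s. (h \<otimes>\<^bsub>A\<^esub> f) s + (h \<otimes>\<^bsub>A\<^esub> g) s)"
    and "(\<lambda>s. c * f s) \<otimes>\<^bsub>A\<^esub> h = (\<lambda>s. c * (f \<otimes>\<^bsub>A\<^esub> h) s)"
    and "h \<otimes>\<^bsub>A\<^esub> (\<lambda>s. c * f s) = (\<lambda>s. c * (h \<otimes>\<^bsub>A\<^esub> f) s)"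
  by (simp_all add: A_def algebra_with_basis_mult linear_extension_add linear_extension_smult
      linear_extension_fun_add linear_extension_fun_smult)

lemma algebra_with_basis_mult_zero:
  "(\<lambda>s. 0) \<otimes>\<^bsub>algebra_with_basis S m u\<^esub> h = (\<lambda>s. 0)" "h \<otimes>\<^bsub>algebra_with_basis S m u\<^esub> (\<lambda>s. 0) = (\<lambda>s. 0)"
  by (simp_all add: algebra_with_basis_mult linear_extension_def)

lemma algebra_with_basis_closed:
  assumes "\<And>s t. s \<in> S \<Longrightarrow> t \<in> S \<Longrightarrow> m s t \<in> carrier (free_vs S)"
    and "f \<in> carrier (free_vs S)" "g \<in> carrier (free_vs S)"
  shows "f \<otimes>\<^bsub>algebra_with_basis S m u\<^esub> g \<in> carrier (free_vs S)"
  unfolding algebra_with_basis_mult using assms by (intro linear_extension_closed[of _ S]) auto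

text \<open>Both sides of the associative law are trilinear and the unit laws are linear, so
  checking them on basis vectors is enough.\<close>

lemma algebra_with_basis_unital:
  fixes S m u
  defines "A \<equiv> algebra_with_basis S m u"
  assumes m: "\<And>s t. s \<in> S \<Longrightarrow> t \<in> S \<Longrightarrow> m s t \<in> carrier (free_vs S)"
    and u: "u \<in> carrier (free_vs S)"
    and assoc: "\<And>s t r. s \<in> S \<Longrightarrow> t \<in> S \<Longrightarrow> r \<in> S \<Longrightarrow> m s t \<otimes>\<^bsub>A\<^esub> \<ee> r = \<ee> s \<otimes>\<^bsub>A\<^esub> m t r"
    and unit: "\<And>s. s \<in> S \<Longrightarrow> u \<otimes>\<^bsub>A\<^esub> \<ee> s = \<ee> s" "\<And>s. s \<in> S \<Longrightarrow> \<ee> s \<otimes>\<^bsub>A\<^esub> u = \<ee> s"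
  shows "unital_algebra A"
proof -
  note bil = algebra_with_basis_bilinear[where S = S and m = m and u = u, folded A_def]
    and bil_zero = algebra_with_basis_mult_zero[where S = S and m = m and u = u, folded A_def]
  note closed = algebra_with_basis_closed[where S = S and m = m and u = u, folded A_def, OF m]
  have [simp]: "carrier A = carrier (free_vs S)" "zero A = (\<lambda>s. 0)" "add A = (\<lambda>f g s. f s + g s)"
    "module.smult A = (\<lambda>c f s. c * f s)" "one A = u" by (simp_all add: A_def)
  have basis_mult: "\<ee> s \<otimes>\<^bsub>A\<^esub> \<ee> t = m s t" for s t by (simp add: A_def algebra_with_basis_mult_basis)
  have A_vs: "vectorspace class_ring A"
    by (rule vectorspace_restrict[OF free_vs_vectorspace[of S]]) (simp_all add: free_vs_zero free_vs_closed)
  \<comment> \<open>The three arguments are freed from being basis vectors one at a time, beginning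
    with the rightmost.\<close>
  have assoc_e: "(\<ee> s \<otimes>\<^bsub>A\<^esub> \<ee> t) \<otimes>\<^bsub>A\<^esub> h = \<ee> s \<otimes>\<^bsub>A\<^esub> (\<ee> t \<otimes>\<^bsub>A\<^esub> h)"
    if "s \<in> S" "t \<in> S" "h \<in> carrier (free_vs S)" for s t h
    using that(3)
  proof (induction rule: free_vs_induct)
    case zero
    then show ?case by (simp add: bil_zero)
  next
    case (basis r c)
    then show ?case using that by (simp add: bil basis_mult assoc m)
  next
    case (add f g)
    then show ?case using that by (simp add: bil closed m)
  qed
  have assoc_g: "(\<ee> s \<otimes>\<^bsub>A\<^esub> g) \<otimes>\<^bsub>A\<^esub> h = \<ee> s \<otimes>\<^bsub>A\<^esub> (g \<otimes>\<^bsub>A\<^esub> h)"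
    if "s \<in> S" "h \<in> carrier (free_vs S)" "g \<in> carrier (free_vs S)" for s g h
    using that(3)
  proof (induction rule: free_vs_induct)
    case zero
    then show ?case by (simp add: bil_zero)
  next
    case (basis r c)
    then show ?case using that by (simp add: bil closed assoc_e)
  next
    case (add f g)
    then show ?case using that by (simp add: bil closed m)
  qed
  have assoc_f: "(f \<otimes>\<^bsub>A\<^esub> g) \<otimes>\<^bsub>A\<^esub> h = f \<otimes>\<^bsub>A\<^esub> (g \<otimes>\<^bsub>A\<^esub> h)"
    if "h \<in> carrier (free_vs S)" "g \<in> carrier (free_vs S)" "f \<in> carrier (free_vs S)" for f g h
    using that(3)
  proof (induction rule: free_vs_induct)
    case zero
    then show ?case by (simp add: bil_zero)
  next
    case (basis r c)
    then show ?case using that by (simp add: bil closed assoc_g)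
  next
    case (add f g)
    then show ?case using that by (simp add: bil closed m)
  qed
  have one: "u \<otimes>\<^bsub>A\<^esub> f = f \<and> f \<otimes>\<^bsub>A\<^esub> u = f" if "f \<in> carrier (free_vs S)" for f
    using that
  proof (induction rule: free_vs_induct)
    case zero
    then show ?case by (simp add: bil_zero)
  next
    case (basis r c)
    then show ?case by (simp add: bil unit)
  next
    case (add f g)
    then show ?case by (simp add: bil)
  qed
  show ?thesis
    unfolding unital_algebra_def unital_algebra_axioms_def
    using A_vs by (simp add: closed u assoc_f one bil)
qed

section \<open>Functionals on tensor products\<close>

lemma free_vs_minus:
  fixes f g :: "'s \<Rightarrow> 'k::field"
  assumes "f \<in> carrier (free_vs S)" "g \<in> carrier (free_vs S)"
  shows "f \<ominus>\<^bsub>free_vs S\<^esub> g = (\<lambda>s. f s - g s)"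
proof -
  interpret vectorspace class_ring "free_vs S :: ('k, 's \<Rightarrow> 'k) module" by (rule free_vs_vectorspace)
  have "\<ominus>\<^bsub>free_vs S\<^esub> g = (\<lambda>s. (-1) * g s)"
    using smult_minus_one[OF free_vs_vectorspace assms(2)] by simp
  then show ?thesis by (simp add: M.minus_eq)
qed

text \<open>The element written a (x) v in the tensor product of \<open>A\<close> and
  \<open>M\<close> over \<open>B\<close>, as a coset of the span of the relations.\<close>

definition pure_tensor ::
  "('k::field, 'a) module \<Rightarrow> 'a set \<Rightarrow> ('k, 'a, 'v) lmodule \<Rightarrow> 'a \<Rightarrow> 'v \<Rightarrow> ('a \<times> 'v \<Rightarrow> 'k) set" where
  "pure_tensor A B M a v =
    LinearCombinations.module.span class_ring (free_vs (carrier A \<times> carrier M)) (tensor_relations A B M)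
      +>\<^bsub>free_vs (carrier A \<times> carrier M)\<^esub> \<ee> (a, v)"

locale tensor_product = unital_algebra A
  for A :: "('k::field, 'a) module" (structure) and B :: "'a set" and M :: "('k, 'a, 'v) lmodule" +
  assumes B: "B \<subseteq> carrier A" and M: "vectorspace class_ring M"
    and B_act: "b \<in> B \<Longrightarrow> v \<in> carrier M \<Longrightarrow> act M b v \<in> carrier M"
begin

abbreviation "Fr \<equiv> free_vs (carrier A \<times> carrier M) :: ('k, 'a \<times> 'v \<Rightarrow> 'k) module"
abbreviation "rels \<equiv> tensor_relations A B M"
abbreviation "rspan \<equiv> LinearCombinations.module.span class_ring Fr rels"
abbreviation "T \<equiv> tensor_lmodule A B M"
abbreviation "cls x \<equiv> rspan +>\<^bsub>Fr\<^esub> x"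
abbreviation "tens \<equiv> pure_tensor A B M"
abbreviation "left_mult a \<equiv> linear_extension (\<lambda>(b, v). \<ee> (a \<otimes> b, v)) :: ('a \<times> 'v \<Rightarrow> 'k) \<Rightarrow> _"

interpretation Fr: vectorspace class_ring Fr by (rule free_vs_vectorspace)
interpretation M: vectorspace class_ring M by (rule M)

text \<open>The relations are stated with the subtraction of the record, which is determined only on
  its carrier. Once all terms are known to lie there, it becomes pointwise subtraction of
  functions.\<close>

lemma rels_eq:
  "rels = {\<lambda>s. \<ee> (a \<oplus> a', v) s - (\<ee> (a, v) s + \<ee> (a', v) s) | a a' v.
        a \<in> carrier A \<and> a' \<in> carrier A \<and> v \<in> carrier M}
   \<union> {\<lambda>s. \<ee> (a, v \<oplus>\<^bsub>M\<^esub> v') s - (\<ee> (a, v) s + \<ee> (a, v') s) | a v v'.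
        a \<in> carrier A \<and> v \<in> carrier M \<and> v' \<in> carrier M}
   \<union> {\<lambda>s. \<ee> (c \<odot> a, v) s - c * \<ee> (a, v) s | c a v. a \<in> carrier A \<and> v \<in> carrier M}
   \<union> {\<lambda>s. \<ee> (a, c \<odot>\<^bsub>M\<^esub> v) s - c * \<ee> (a, v) s | c a v. a \<in> carrier A \<and> v \<in> carrier M}
   \<union> {\<lambda>s. \<ee> (a \<otimes> b, v) s - \<ee> (a, act M b v) s | a b v.
        a \<in> carrier A \<and> b \<in> B \<and> v \<in> carrier M}"
proof -
  have eq: "(x = t \<and> P) = (x = t' \<and> P)" if "P \<Longrightarrow> t = t'" for x t t' :: "'a \<times> 'v \<Rightarrow> 'k" and P
    using that by auto
  show ?thesis
    unfolding tensor_relations_def Let_def free_vs_simps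
    by (intro arg_cong2[of _ _ _ _ "(\<union>)"] Collect_cong iff_exI eq free_vs_minus free_vs_closed)
      (use B in \<open>auto simp: subset_iff B_act mult_closed\<close>)
qed

lemma rels_memI:
  "a \<in> carrier A \<Longrightarrow> a' \<in> carrier A \<Longrightarrow> v \<in> carrier M \<Longrightarrow>
     (\<lambda>s. \<ee> (a \<oplus> a', v) s - (\<ee> (a, v) s + \<ee> (a', v) s)) \<in> rels"
  "a \<in> carrier A \<Longrightarrow> v \<in> carrier M \<Longrightarrow> v' \<in> carrier M \<Longrightarrow>
     (\<lambda>s. \<ee> (a, v \<oplus>\<^bsub>M\<^esub> v') s - (\<ee> (a, v) s + \<ee> (a, v') s)) \<in> rels"
  "a \<in> carrier A \<Longrightarrow> v \<in> carrier M \<Longrightarrow> (\<lambda>s. \<ee> (c \<odot> a, v) s - c * \<ee> (a, v) s) \<in> rels"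
  "a \<in> carrier A \<Longrightarrow> v \<in> carrier M \<Longrightarrow> (\<lambda>s. \<ee> (a, c \<odot>\<^bsub>M\<^esub> v) s - c * \<ee> (a, v) s) \<in> rels"
  "a \<in> carrier A \<Longrightarrow> b \<in> B \<Longrightarrow> v \<in> carrier M \<Longrightarrow>
     (\<lambda>s. \<ee> (a \<otimes> b, v) s - \<ee> (a, act M b v) s) \<in> rels"
  subgoal by (unfold rels_eq Un_iff mem_Collect_eq, (rule disjI1)+, (rule exI)+, rule conjI, rule refl,
      (intro conjI; assumption))
  subgoal by (unfold rels_eq Un_iff mem_Collect_eq, rule disjI1, rule disjI1, rule disjI1, rule disjI2,
      (rule exI)+, rule conjI, rule refl, (intro conjI; assumption))
  subgoal by (unfold rels_eq Un_iff mem_Collect_eq, rule disjI1, rule disjI1, rule disjI2, (rule exI)+, rule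
      conjI, rule refl, (intro conjI; assumption))
  subgoal by (unfold rels_eq Un_iff mem_Collect_eq, rule disjI1, rule disjI2, (rule exI)+, rule conjI, rule
      refl, (intro conjI; assumption))
  subgoal by (unfold rels_eq Un_iff mem_Collect_eq, rule disjI2, (rule exI)+, rule conjI, rule refl, (intro
      conjI; assumption))
  done

lemma rels_carrier: "rels \<subseteq> carrier Fr"
  unfolding rels_eq using B by (auto intro!: free_vs_closed simp: B_act mult_closed subset_iff)

lemma mem_cls: "y \<in> cls x \<longleftrightarrow> (\<lambda>s. y s - x s) \<in> rspan"
proof
  assume "y \<in> cls x"
  then obtain h where "h \<in> rspan" "y = (\<lambda>s. h s + x s)"
    by (auto simp: a_r_coset_def r_coset_def)
  then show "(\<lambda>s. y s - x s) \<in> rspan" by simp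
next
  assume "(\<lambda>s. y s - x s) \<in> rspan"
  then show "y \<in> cls x"
    by (auto simp: a_r_coset_def r_coset_def intro!: bexI[of _ "\<lambda>s. y s - x s"])
qed

interpretation sp: LinearCombinations.submodule class_ring rspan Fr
  by (rule Fr.span_is_submodule[OF rels_carrier])

lemma rspan_closed:
  "x \<in> rspan \<Longrightarrow> y \<in> rspan \<Longrightarrow> (\<lambda>s. x s + y s) \<in> rspan" "x \<in> rspan \<Longrightarrow> (\<lambda>s. c * x s) \<in> rspan"
  "(\<lambda>s. 0) \<in> rspan" "x \<in> rspan \<Longrightarrow> y \<in> rspan \<Longrightarrow> (\<lambda>s. x s - y s) \<in> rspan"
proof -
  show *: "x \<in> rspan \<Longrightarrow> y \<in> rspan \<Longrightarrow> (\<lambda>s. x s + y s) \<in> rspan" "x \<in> rspan \<Longrightarrow> (\<lambda>s. c * x s) \<in> rspan"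
    "(\<lambda>s. 0) \<in> rspan" for x y c
    using sp.m_closed[of x y] sp.smult_closed[of c x] sp.zero_closed by simp_all
  show "x \<in> rspan \<Longrightarrow> y \<in> rspan \<Longrightarrow> (\<lambda>s. x s - y s) \<in> rspan"
    using *(1)[of x "\<lambda>s. (-1) * y s"] *(2)[of y "-1"] by simp
qed

lemma cls_eq: "cls x = cls y \<longleftrightarrow> (\<lambda>s. x s - y s) \<in> rspan"
proof
  assume "cls x = cls y"
  moreover have "x \<in> cls x" by (simp add: mem_cls rspan_closed)
  ultimately show "(\<lambda>s. x s - y s) \<in> rspan" by (simp add: mem_cls)
next
  assume *: "(\<lambda>s. x s - y s) \<in> rspan"
  have "z \<in> cls x \<longleftrightarrow> z \<in> cls y" for z
    using rspan_closed(1)[OF _ *, of "\<lambda>s. z s - x s"] rspan_closed(4)[OF _ *, of "\<lambda>s. z s - y s"]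
    by (auto simp: mem_cls)
  then show "cls x = cls y" by blast
qed

lemma cls_self: "x \<in> cls x"
  by (simp add: mem_cls rspan_closed)

lemma T_carrier: "carrier T = cls ` carrier Fr"
  by (auto simp: tensor_lmodule_def Let_def A_RCOSETS_def RCOSETS_def a_r_coset_def)

lemma cls_carrier: "x \<in> carrier Fr \<Longrightarrow> cls x \<in> carrier T"
  by (simp add: T_carrier)

lemma T_add: "cls x \<oplus>\<^bsub>T\<^esub> cls y = cls (\<lambda>s. x s + y s)"
proof -
  have "z \<in> set_add Fr (cls x) (cls y) \<longleftrightarrow> z \<in> cls (\<lambda>s. x s + y s)" for z
  proof
    assume "z \<in> set_add Fr (cls x) (cls y)"
    then obtain h k where "h \<in> cls x" "k \<in> cls y" "z = (\<lambda>s. h s + k s)"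
      by (auto simp: set_add_def set_mult_def)
    then show "z \<in> cls (\<lambda>s. x s + y s)"
      using rspan_closed(1)[of "\<lambda>s. h s - x s" "\<lambda>s. k s - y s"] by (simp add: mem_cls algebra_simps)
  next
    assume "z \<in> cls (\<lambda>s. x s + y s)"
    then have "(\<lambda>s. z s - y s) \<in> cls x" by (simp add: mem_cls algebra_simps)
    moreover have "z = (\<lambda>s. (z s - y s) + y s)" by simp
    ultimately show "z \<in> set_add Fr (cls x) (cls y)"
      using cls_self[of y] unfolding set_add_def set_mult_def by fastforce
  qed
  then show ?thesis by (auto simp: tensor_lmodule_def Let_def)
qed

text \<open>Operations on classes are defined as unions over all representatives; compatibility of
  the operation with the classes collapses the union to a single class.\<close>

lemma UN_cls:
  assumes "\<And>y. y \<in> cls x \<Longrightarrow> cls (f y) = cls (f x)"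
  shows "(\<Union>y\<in>cls x. cls (f y)) = cls (f x)"
  using assms cls_self by blast

lemma T_smult: "c \<odot>\<^bsub>T\<^esub> cls x = cls (\<lambda>s. c * x s)"
proof -
  have "(\<Union>y\<in>cls x. cls (\<lambda>s. c * y s)) = cls (\<lambda>s. c * x s)"
  proof (rule UN_cls)
    fix y assume "y \<in> cls x"
    then have "(\<lambda>s. c * (y s - x s)) \<in> rspan" by (intro rspan_closed(2)) (simp add: mem_cls)
    then show "cls (\<lambda>s. c * y s) = cls (\<lambda>s. c * x s)" by (simp add: cls_eq right_diff_distrib)
  qed
  then show ?thesis by (simp add: tensor_lmodule_def Let_def)
qed

lemma left_mult_basis: "left_mult a (\<ee> (b, v)) = \<ee> (a \<otimes> b, v)"
  by (simp add: linear_extension_basis_vec)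

lemma left_mult_closed: "a \<in> carrier A \<Longrightarrow> x \<in> carrier Fr \<Longrightarrow> left_mult a x \<in> carrier Fr"
  by (rule linear_extension_closed) (auto simp: mult_closed)

text \<open>Each kind of relation is sent to a relation of the same kind: the additive and scalar
  ones by bilinearity of the product, the balancing one by associativity. This is what makes the
  action of \<open>A\<close> on classes well defined.\<close>

lemma left_mult_rels:
  assumes a: "a \<in> carrier A" and r: "r \<in> rels"
  shows "left_mult a r \<in> rels"
proof -
  note lm = linear_extension_diff[where S = "carrier A \<times> carrier M"]
    linear_extension_add[where S = "carrier A \<times> carrier M"]
  have BA: "b \<in> carrier A" if "b \<in> B" for b using B that by blast
  from r consider
      (1) b b' v where "r = (\<lambda>s. \<ee> (b \<oplus> b', v) s - (\<ee> (b, v) s + \<ee> (b', v) s))"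
        "b \<in> carrier A" "b' \<in> carrier A" "v \<in> carrier M"
    | (2) b v v' where "r = (\<lambda>s. \<ee> (b, v \<oplus>\<^bsub>M\<^esub> v') s - (\<ee> (b, v) s + \<ee> (b, v') s))"
        "b \<in> carrier A" "v \<in> carrier M" "v' \<in> carrier M"
    | (3) c b v where "r = (\<lambda>s. \<ee> (c \<odot> b, v) s - c * \<ee> (b, v) s)" "b \<in> carrier A" "v \<in> carrier M"
    | (4) c b v where "r = (\<lambda>s. \<ee> (b, c \<odot>\<^bsub>M\<^esub> v) s - c * \<ee> (b, v) s)" "b \<in> carrier A" "v \<in> carrier M"
    | (5) b b' v where "r = (\<lambda>s. \<ee> (b \<otimes> b', v) s - \<ee> (b, act M b' v) s)"
        "b \<in> carrier A" "b' \<in> B" "v \<in> carrier M"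
    unfolding rels_eq by blast
  then show ?thesis
  proof cases
    case 1
    then have "left_mult a r = (\<lambda>s. \<ee> (a \<otimes> b \<oplus> a \<otimes> b', v) s - (\<ee> (a \<otimes> b, v) s + \<ee> (a \<otimes> b', v) s))"
      using a by (simp add: lm(1,2) free_vs_closed left_mult_basis mult_add)
    with 1 a show ?thesis by (simp add: rels_memI mult_closed)
  next
    case 2
    then have "left_mult a r = (\<lambda>s. \<ee> (a \<otimes> b, v \<oplus>\<^bsub>M\<^esub> v') s - (\<ee> (a \<otimes> b, v) s + \<ee> (a \<otimes> b, v') s))"
      using a by (simp add: lm(1,2) free_vs_closed left_mult_basis)
    with 2 a show ?thesis by (simp add: rels_memI mult_closed)
  next
    case 3
    then have "left_mult a r = (\<lambda>s. \<ee> (c \<odot> (a \<otimes> b), v) s - c * \<ee> (a \<otimes> b, v) s)"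
      using a by (simp add: lm(1) linear_extension_smult free_vs_closed left_mult_basis mult_smult)
    with 3 a show ?thesis by (simp add: rels_memI mult_closed)
  next
    case 4
    then have "left_mult a r = (\<lambda>s. \<ee> (a \<otimes> b, c \<odot>\<^bsub>M\<^esub> v) s - c * \<ee> (a \<otimes> b, v) s)"
      using a by (simp add: lm(1) linear_extension_smult free_vs_closed left_mult_basis)
    with 4 a show ?thesis by (simp add: rels_memI mult_closed)
  next
    case 5
    then have "left_mult a r = (\<lambda>s. \<ee> ((a \<otimes> b) \<otimes> b', v) s - \<ee> (a \<otimes> b, act M b' v) s)"
      using a BA by (simp add: lm(1) left_mult_basis mult_assoc mult_closed B_act)
    with 5 a show ?thesis by (simp add: rels_memI mult_closed)
  qed
qed

text \<open>The preimage of the span under left multiplication is a subspace containing all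
  relations.\<close>

lemma left_mult_rspan:
  assumes a: "a \<in> carrier A" and x: "x \<in> rspan"
  shows "left_mult a x \<in> rspan"
proof -
  have "rspan \<subseteq> {x \<in> carrier Fr. left_mult a x \<in> rspan}"
  proof (rule Fr.span_is_subset)
    show "rels \<subseteq> {x \<in> carrier Fr. left_mult a x \<in> rspan}"
      using rels_carrier left_mult_rels[OF a] Fr.in_own_span[OF rels_carrier] by blast
    show "LinearCombinations.submodule class_ring {x \<in> carrier Fr. left_mult a x \<in> rspan} Fr"
      by unfold_locales
        (auto simp: free_vs_zero free_vs_closed linear_extension_zero linear_extension_smult
          linear_extension_add[of _ "carrier A \<times> carrier M"] rspan_closed)
  qed
  with x show ?thesis by blast
qed

lemma T_act:
  assumes a: "a \<in> carrier A" and x: "x \<in> carrier Fr"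
  shows "act T a (cls x) = cls (left_mult a x)"
proof -
  have "(\<Union>y\<in>cls x. cls (left_mult a y)) = cls (left_mult a x)"
  proof (rule UN_cls)
    fix y assume "y \<in> cls x"
    then have *: "(\<lambda>s. y s - x s) \<in> rspan" by (simp add: mem_cls)
    then have "(\<lambda>s. (y s - x s) + x s) \<in> carrier Fr" using sp.subset x by (intro free_vs_closed(1)) auto
    then have "y \<in> carrier Fr" by simp
    with left_mult_rspan[OF a *] x show "cls (left_mult a y) = cls (left_mult a x)"
      by (simp add: cls_eq linear_extension_diff)
  qed
  then show ?thesis by (simp add: tensor_lmodule_def Let_def)
qed

lemma tens_eq: "tens a v = cls (\<ee> (a, v))"
  by (simp add: pure_tensor_def)

lemma tens_carrier: "a \<in> carrier A \<Longrightarrow> v \<in> carrier M \<Longrightarrow> tens a v \<in> carrier T"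
  by (simp add: tens_eq cls_carrier)

lemma T_act_tens:
  "a \<in> carrier A \<Longrightarrow> b \<in> carrier A \<Longrightarrow> v \<in> carrier M \<Longrightarrow> act T a (tens b v) = tens (a \<otimes> b) v"
  by (simp add: tens_eq T_act left_mult_basis)

lemma tens_rels:
  assumes "v \<in> carrier M" "a \<in> carrier A"
  shows "a' \<in> carrier A \<Longrightarrow> tens (a \<oplus> a') v = tens a v \<oplus>\<^bsub>T\<^esub> tens a' v"
    and "v' \<in> carrier M \<Longrightarrow> tens a (v \<oplus>\<^bsub>M\<^esub> v') = tens a v \<oplus>\<^bsub>T\<^esub> tens a v'"
    and "tens (c \<odot> a) v = c \<odot>\<^bsub>T\<^esub> tens a v" and "tens a (c \<odot>\<^bsub>M\<^esub> v) = c \<odot>\<^bsub>T\<^esub> tens a v"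
    and "b \<in> B \<Longrightarrow> tens (a \<otimes> b) v = tens a (act M b v)"
  unfolding tens_eq T_add T_smult cls_eq
  using assms by (auto intro!: rels_memI Fr.in_own_span[OF rels_carrier, THEN subsetD])

section \<open>Functionals on the tensor product\<close>

lemma T_closed:
  "X \<in> carrier T \<Longrightarrow> Y \<in> carrier T \<Longrightarrow> X \<oplus>\<^bsub>T\<^esub> Y \<in> carrier T"
  "X \<in> carrier T \<Longrightarrow> c \<odot>\<^bsub>T\<^esub> X \<in> carrier T"
  "a \<in> carrier A \<Longrightarrow> X \<in> carrier T \<Longrightarrow> act T a X \<in> carrier T"
  unfolding T_carrier
  by (auto simp: T_add T_smult T_act intro!: imageI free_vs_closed left_mult_closed)

lemma T_act_linear:
  assumes a: "a \<in> carrier A" and X: "X \<in> carrier T"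
  shows "Y \<in> carrier T \<Longrightarrow> act T a (X \<oplus>\<^bsub>T\<^esub> Y) = act T a X \<oplus>\<^bsub>T\<^esub> act T a Y"
    and "act T a (c \<odot>\<^bsub>T\<^esub> X) = c \<odot>\<^bsub>T\<^esub> act T a X"
  using X unfolding T_carrier
  by (auto simp: T_add T_smult T_act a free_vs_closed linear_extension_add[of _ "carrier A \<times> carrier M"]
      linear_extension_smult)

lemma T_functional_zero: "linear_functional T \<phi> \<Longrightarrow> \<phi> (cls (\<lambda>s. 0)) = 0"
  using linear_functional_smult[of T \<phi> "cls (\<lambda>s. 0)" 0] by (simp add: T_smult cls_carrier free_vs_zero)

text \<open>A representative of a class is a finite combination of basis vectors, whose classes are
  the pure tensors, and linearity carries the agreement along.\<close>

lemma T_functional_eqI: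
  assumes \<phi>: "linear_functional T \<phi>" and \<psi>: "linear_functional T \<psi>"
    and eq: "\<And>a v. a \<in> carrier A \<Longrightarrow> v \<in> carrier M \<Longrightarrow> \<phi> (tens a v) = \<psi> (tens a v)"
    and X: "X \<in> carrier T"
  shows "\<phi> X = \<psi> X"
proof -
  obtain x where x: "x \<in> carrier Fr" "X = cls x" using X by (auto simp: T_carrier)
  have "\<phi> (cls x) = \<psi> (cls x)" using x(1)
  proof (induction rule: free_vs_induct)
    case zero
    then show ?case by (simp add: T_functional_zero \<phi> \<psi>)
  next
    case (basis s c)
    obtain a v where s: "s = (a, v)" "a \<in> carrier A" "v \<in> carrier M" using basis by auto
    have "cls (\<lambda>t. c * \<ee> s t) = c \<odot>\<^bsub>T\<^esub> tens a v" by (simp add: s T_smult tens_eq)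
    with s show ?case by (simp add: linear_functional_smult[OF \<phi>] linear_functional_smult[OF \<psi>] tens_carrier eq)
  next
    case (add f g)
    then show ?case
      using linear_functional_add[OF \<phi>, of "cls f" "cls g"] linear_functional_add[OF \<psi>, of "cls f" "cls g"]
      by (simp add: T_add cls_carrier)
  qed
  with x show ?thesis by simp
qed

lemma T_functional_act:
  "linear_functional T \<phi> \<Longrightarrow> a \<in> carrier A \<Longrightarrow> linear_functional T (\<lambda>X. \<phi> (act T a X))"
  by (auto simp: linear_functional_def T_act_linear T_closed)

text \<open>In each law both sides are functionals of the tensor, so they are compared on pure
  tensors, where the law becomes one of the algebra.\<close>

lemma dual_tensor_left_module: "left_module (opposite_algebra A) (dual_lmodule T)"
proof (rule dual_left_moduleI)
  fix \<phi> a b X assume \<phi>: "linear_functional T \<phi>" and a: "a \<in> carrier A" and X: "X \<in> carrier T"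
  note act = T_functional_act[OF \<phi>]
  show "\<phi> (act T (c \<odot> a) X) = c * \<phi> (act T a X)" for c
    using a X act[of a] act[of "c \<odot> a"]
    by (rule_tac T_functional_eqI[of "\<lambda>X. \<phi> (act T (c \<odot> a) X)" "\<lambda>X. c * \<phi> (act T a X)"])
      (auto simp: T_act_tens smult_mult tens_rels mult_closed tens_carrier linear_functional_smult[OF \<phi>],
          simp add: linear_functional_def algebra_simps)
  assume b: "b \<in> carrier A"
  show "\<phi> (act T (a \<oplus> b) X) = \<phi> (act T a X) + \<phi> (act T b X)"
    using a b X act[of a] act[of b] act[of "a \<oplus> b"]
    by (rule_tac T_functional_eqI[of "\<lambda>X. \<phi> (act T (a \<oplus> b) X)" "\<lambda>X. \<phi> (act T a X) + \<phi> (act T b X)"])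
      (auto simp: T_act_tens add_mult tens_rels mult_closed tens_carrier linear_functional_add[OF \<phi>], simp
          add: linear_functional_def algebra_simps)
  show "\<phi> (act T (a \<otimes> b) X) = \<phi> (act T a (act T b X))"
    using a b X T_functional_act[OF act[of a], of b] act[of "a \<otimes> b"]
    by (rule_tac T_functional_eqI[of "\<lambda>X. \<phi> (act T (a \<otimes> b) X)" "\<lambda>X. \<phi> (act T a (act T b X))"])
      (auto simp: T_act_tens mult_assoc mult_closed)
next
  fix \<phi> X assume \<phi>: "linear_functional T \<phi>" and X: "X \<in> carrier T"
  show "\<phi> (act T \<one> X) = \<phi> X"
    by (rule T_functional_eqI[OF T_functional_act[OF \<phi> one_closed] \<phi> _ X]) (simp add: T_act_tens one_closed
        one_left)
qed (auto simp: T_closed T_act_linear)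

lemma dual_tensor_rels:
  assumes \<phi>: "\<phi> \<in> carrier (dual_lmodule T)" and v: "v \<in> carrier M" and a: "a \<in> carrier A"
  shows "a' \<in> carrier A \<Longrightarrow> \<phi> (tens (a \<oplus> a') v) = \<phi> (tens a v) + \<phi> (tens a' v)"
    and "v' \<in> carrier M \<Longrightarrow> \<phi> (tens a (v \<oplus>\<^bsub>M\<^esub> v')) = \<phi> (tens a v) + \<phi> (tens a v')"
    and "\<phi> (tens (c \<odot> a) v) = c * \<phi> (tens a v)" and "\<phi> (tens a (c \<odot>\<^bsub>M\<^esub> v)) = c * \<phi> (tens a v)"
    and "b \<in> B \<Longrightarrow> \<phi> (tens (a \<otimes> b) v) = \<phi> (tens a (act M b v))"
    and "a' \<in> carrier A \<Longrightarrow> act (dual_lmodule T) a' \<phi> (tens a v) = \<phi> (tens (a' \<otimes> a) v)"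
  using \<phi> v a
  by (auto simp: tens_rels tens_carrier T_act_tens linear_functional_add[of T] linear_functional_smult[of T])

lemma dual_tensor_eqI:
  assumes "\<phi> \<in> carrier (dual_lmodule T)" "\<psi> \<in> carrier (dual_lmodule T)"
    and "\<And>a v. a \<in> carrier A \<Longrightarrow> v \<in> carrier M \<Longrightarrow> \<phi> (tens a v) = \<psi> (tens a v)"
  shows "\<phi> = \<psi>"
  using assms T_functional_eqI[of \<phi> \<psi>] by (intro extensionalityI[of \<phi> "carrier T" \<psi>]) auto

text \<open>The universal property for scalar-valued balanced bilinear maps: the linear extension to
  the free space kills the relations, hence their span, and descends to classes.\<close>

lemma dual_tensor_exists:
  assumes add1: "\<And>a a' v. a \<in> carrier A \<Longrightarrow> a' \<in> carrier A \<Longrightarrow> v \<in> carrier M \<Longrightarrow>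
      \<beta> (a \<oplus> a') v = \<beta> a v + \<beta> a' v"
    and add2: "\<And>a v v'. a \<in> carrier A \<Longrightarrow> v \<in> carrier M \<Longrightarrow> v' \<in> carrier M \<Longrightarrow>
      \<beta> a (v \<oplus>\<^bsub>M\<^esub> v') = \<beta> a v + \<beta> a v'"
    and smult1: "\<And>c a v. a \<in> carrier A \<Longrightarrow> v \<in> carrier M \<Longrightarrow> \<beta> (c \<odot> a) v = c * \<beta> a v"
    and smult2: "\<And>c a v. a \<in> carrier A \<Longrightarrow> v \<in> carrier M \<Longrightarrow> \<beta> a (c \<odot>\<^bsub>M\<^esub> v) = c * \<beta> a v"
    and balanced: "\<And>a b v. a \<in> carrier A \<Longrightarrow> b \<in> B \<Longrightarrow> v \<in> carrier M \<Longrightarrow>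
      \<beta> (a \<otimes> b) v = \<beta> a (act M b v)"
  obtains \<phi> where "\<phi> \<in> carrier (dual_lmodule T)"
    "\<And>a v. a \<in> carrier A \<Longrightarrow> v \<in> carrier M \<Longrightarrow> \<phi> (tens a v) = \<beta> a v"
proof -
  \<comment> \<open>\<open>linear_extension\<close> produces functions; functions on the one-element
    type \<open>unit\<close> play the part of scalars.\<close>
  define L where "L x = linear_extension (\<lambda>(a, v) (_::unit). \<beta> a v) x ()" for x
  have L_basis: "L (\<ee> (a, v)) = \<beta> a v" for a v by (simp add: L_def linear_extension_basis_vec)
  have L_lin: "x \<in> carrier Fr \<Longrightarrow> y \<in> carrier Fr \<Longrightarrow> L (\<lambda>s. x s + y s) = L x + L y"
    "x \<in> carrier Fr \<Longrightarrow> y \<in> carrier Fr \<Longrightarrow> L (\<lambda>s. x s - y s) = L x - L y"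
    "L (\<lambda>s. c * x s) = c * L x" for x y c
    by (simp_all add: L_def linear_extension_add linear_extension_diff linear_extension_smult)
  have L_zero: "L (\<lambda>s. 0) = 0" by (simp add: L_def linear_extension_zero)
  have "rspan \<subseteq> {x \<in> carrier Fr. L x = 0}"
  proof (rule Fr.span_is_subset)
    show "rels \<subseteq> {x \<in> carrier Fr. L x = 0}"
    proof
      fix r assume r: "r \<in> rels"
      then have "r \<in> carrier Fr" using rels_carrier by blast
      moreover have "L r = 0"
        using r B unfolding rels_eq
        by (auto simp: L_lin free_vs_closed L_basis add1 add2 smult1 smult2 balanced subset_iff mult_closed
            B_act)
      ultimately show "r \<in> {x \<in> carrier Fr. L x = 0}" by simp
    qed
    show "LinearCombinations.submodule class_ring {x \<in> carrier Fr. L x = 0} Fr"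
      by unfold_locales (auto simp: free_vs_zero free_vs_closed L_zero L_lin)
  qed
  then have L_cong: "L x = L y" if "cls x = cls y" "x \<in> carrier Fr" "y \<in> carrier Fr" for x y
    using that L_lin(2)[of x y] by (auto simp: cls_eq)
  \<comment> \<open>A representative is chosen for each class; \<open>L_cong\<close> makes the value
    independent of the choice. Off the carrier the function is left undefined, as membership in the
    dual requires.\<close>
  define \<phi> where "\<phi> = (\<lambda>X\<in>carrier T. L (SOME x. x \<in> carrier Fr \<and> cls x = X))"
  have \<phi>: "\<phi> (cls x) = L x" if x: "x \<in> carrier Fr" for x
  proof -
    let ?P = "\<lambda>y. y \<in> carrier Fr \<and> cls y = cls x"
    have "\<exists>y. ?P y" using x by blast
    then have P: "?P (Eps ?P)" by (rule someI_ex)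
    have "\<phi> (cls x) = L (Eps ?P)" using cls_carrier[OF x] by (simp add: \<phi>_def)
    also have "\<dots> = L x" using P x by (intro L_cong) auto
    finally show ?thesis .
  qed
  have "linear_functional T \<phi>"
    unfolding linear_functional_def
  proof (intro conjI ballI allI)
    fix X Y c assume "X \<in> carrier T" "Y \<in> carrier T"
    then have X: "X \<in> cls ` carrier Fr" and Y: "Y \<in> cls ` carrier Fr" by (simp_all only: T_carrier)
    obtain x where x: "X = cls x" "x \<in> carrier Fr" using X by (rule imageE)
    obtain y where y: "Y = cls y" "y \<in> carrier Fr" using Y by (rule imageE)
    show "\<phi> (X \<oplus>\<^bsub>T\<^esub> Y) = \<phi> X + \<phi> Y"
      unfolding x(1) y(1) T_add
      by (simp only: \<phi>[OF x(2)] \<phi>[OF y(2)] \<phi>[OF free_vs_closed(1)[OF x(2) y(2)]] L_lin(1)[OF x(2) y(2)])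
    show "\<phi> (c \<odot>\<^bsub>T\<^esub> X) = c * \<phi> X"
      unfolding x(1) T_smult by (simp only: \<phi>[OF x(2)] \<phi>[OF free_vs_closed(2)[OF x(2)]] L_lin(3))
  qed
  then have "\<phi> \<in> carrier (dual_lmodule T)" by (simp add: \<phi>_def)
  with \<phi> that show ?thesis by (simp add: tens_eq L_basis)
qed

end

section \<open>The algebra of a twisted factorization\<close>

lemma sum_basis_carrier:
  assumes "finite P" "\<And>p. p \<in> P \<Longrightarrow> k p \<in> S"
  shows "(\<lambda>r. \<Sum>p\<in>P. \<ee> (k p) r :: 'k::field) \<in> carrier (free_vs S)"
  using assms
proof (induction P)
  case empty
  then show ?case by (simp add: free_vs_zero)
next
  case (insert p P)
  then have "(\<lambda>r. \<ee> (k p) r + (\<Sum>p\<in>P. \<ee> (k p) r :: 'k)) \<in> carrier (free_vs S)" by (intro free_vs_closed(1)) auto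
  with insert.hyps show ?case by simp
qed

lemma linear_extension_sum_basis:
  assumes "finite P"
  shows "linear_extension h (\<lambda>r. \<Sum>p\<in>P. \<ee> (k p) r) = (\<lambda>r. \<Sum>p\<in>P. h (k p) r)"
  using assms
proof (induction P)
  case empty
  then show ?case by (simp add: linear_extension_zero)
next
  case (insert p P)
  then show ?case
    using linear_extension_add[of "\<ee> (k p)" UNIV "\<lambda>r. \<Sum>p\<in>P. \<ee> (k p) r" h]
    by (simp add: linear_extension_basis_vec sum_basis_carrier)
qed

section \<open>The right action of F on Q, the cocycle sigma and the smash product\<close>

context twisted_factorization
begin

abbreviation ract :: "'g \<Rightarrow> 'g \<Rightarrow> 'g" (infixl \<open>\<triangleleft>\<close> 70) where "q \<triangleleft> x \<equiv> right_act G F Q q x"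
abbreviation smash :: "('k, 'g \<times> 'g \<Rightarrow> 'k) module" (\<open>\<A>\<close>) where "\<A> \<equiv> cocycle_smash G F Q \<sigma>"
abbreviation smash_mult :: "('g \<times> 'g \<Rightarrow> 'k) \<Rightarrow> ('g \<times> 'g \<Rightarrow> 'k) \<Rightarrow> 'g \<times> 'g \<Rightarrow> 'k" (infixl \<open>\<star>\<close> 70) where
  "a \<star> b \<equiv> a \<otimes>\<^bsub>\<A>\<^esub> b"
abbreviation isot :: "'g \<Rightarrow> 'g set" (\<open>\<H>\<close>) where "\<H> p \<equiv> isotropy G F Q p"
abbreviation twisted :: "'g \<Rightarrow> ('k, 'g \<Rightarrow> 'k) module" (\<open>\<T>\<close>) where
  "\<T> p \<equiv> twisted_group_algebra G (\<H> p) (\<sigma> p)"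

interpretation F: subgroup F G by (rule subgroup_F)

lemma Q_carrier: "q \<in> Q \<Longrightarrow> q \<in> carrier G"
  using Q_subset by blast

lemma finite_F: "finite F" and finite_Q: "finite Q"
  using finite_G F.subset Q_subset finite_subset by blast+

lemma ract_factorization:
  assumes "q \<in> Q" "x \<in> F"
  shows "q \<triangleleft> x \<in> Q" and "\<exists>y\<in>F. q \<otimes> x = y \<otimes> (q \<triangleleft> x)"
proof -
  have "q \<otimes> x \<in> carrier G" using assms Q_carrier by simp
  from theI'[OF factorization_ex1[OF this]]
  show "q \<triangleleft> x \<in> Q" "\<exists>y\<in>F. q \<otimes> x = y \<otimes> (q \<triangleleft> x)" unfolding right_act_def by auto
qed

lemmas ract_closed = ract_factorization(1)

lemma ract_one:
  assumes "q \<in> Q"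
  shows "q \<triangleleft> \<one> = q"
proof -
  have "q \<otimes> \<one> = \<one> \<otimes> q" using Q_carrier[OF assms] by simp
  then show ?thesis using assms F.one_closed by (subst right_act_eq_iff) blast+
qed

text \<open>Pulling the factors in \<open>F\<close> to the left gives q x y = a (q.x) y = (a b)
  ((q.x).y), where the dot is the action, and the factorization through \<open>F\<close> and
  \<open>Q\<close> is unique.\<close>

lemma ract_mult:
  assumes "q \<in> Q" "x \<in> F" "y \<in> F"
  shows "q \<triangleleft> (x \<otimes> y) = q \<triangleleft> x \<triangleleft> y"
proof -
  obtain a where a: "a \<in> F" "q \<otimes> x = a \<otimes> (q \<triangleleft> x)"
    using ract_factorization(2)[OF assms(1,2)] by blast
  obtain b where b: "b \<in> F" "(q \<triangleleft> x) \<otimes> y = b \<otimes> (q \<triangleleft> x \<triangleleft> y)"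
    using ract_factorization(2)[OF ract_closed[OF assms(1,2)] assms(3)] by blast
  have Q: "q \<triangleleft> x \<in> Q" "q \<triangleleft> x \<triangleleft> y \<in> Q" using assms ract_closed by blast+
  have "q \<otimes> (x \<otimes> y) = (q \<otimes> x) \<otimes> y" using assms by (simp add: m_assoc Q_carrier)
  also have "\<dots> = a \<otimes> ((q \<triangleleft> x) \<otimes> y)" using assms a Q by (simp add: m_assoc Q_carrier)
  also have "\<dots> = (a \<otimes> b) \<otimes> (q \<triangleleft> x \<triangleleft> y)" using a(1) b Q by (simp add: m_assoc Q_carrier)
  finally show ?thesis using a(1) b(1) assms Q by (subst right_act_eq_iff) auto
qed

lemma ract_inv:
  assumes "q \<in> Q" "x \<in> F"
  shows "q \<triangleleft> x \<triangleleft> inv x = q" "q \<triangleleft> inv x \<triangleleft> x = q"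
  using assms ract_mult[of q x "inv x"] ract_mult[of q "inv x" x] by (simp_all add: ract_one)

lemma ract_eq_swap:
  assumes "q \<in> Q" "p \<in> Q" "x \<in> F"
  shows "q \<triangleleft> x = p \<longleftrightarrow> q = p \<triangleleft> inv x"
  using ract_inv assms by metis

lemma sigma_one:
  assumes "p \<in> Q" "x \<in> F"
  shows "\<sigma> p \<one> x = 1" "\<sigma> p x \<one> = 1"
  using assms \<omega>_normalized[of p x] by (simp_all add: \<sigma>_eq Q_carrier)

lemma sigma_nonzero: "p \<in> Q \<Longrightarrow> x \<in> F \<Longrightarrow> y \<in> F \<Longrightarrow> \<sigma> p x y \<noteq> 0"
  by (simp add: \<sigma>_eq \<omega>_nonzero Q_carrier)

text \<open>
  In the cocycle identity for \<open>(p, x, y, z)\<close>, \<open>\<omega> (p x) y z = \<omega> (p \<triangleleft> x) y z\<close>: apply the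
  identity once more to \<open>p x = (p \<triangleright> x) (p \<triangleleft> x)\<close>.
\<close>

lemma sigma_cocycle:
  assumes "p \<in> Q" "x \<in> F" "y \<in> F" "z \<in> F"
  shows "\<sigma> (p \<triangleleft> x) y z * \<sigma> p x (y \<otimes> z) = \<sigma> p x y * \<sigma> p (x \<otimes> y) z"
proof -
  obtain a where a: "a \<in> F" "p \<otimes> x = a \<otimes> (p \<triangleleft> x)"
    using ract_factorization(2)[OF assms(1,2)] by blast
  have r: "p \<triangleleft> x \<in> Q" using assms by (simp add: ract_closed)
  have G: "p \<in> carrier G" "p \<triangleleft> x \<in> carrier G" "a \<in> carrier G" "x \<in> carrier G" "y \<in> carrier G" "z \<in> carrier G"
    using assms a r by (auto intro: Q_carrier F.mem_carrier)
  have 1: "\<omega> (p \<otimes> x) y z = \<omega> (p \<triangleleft> x) y z"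
    using \<omega>_cocycle[OF G(3,2,5,6)] a(2)
    by (simp only: \<omega>_FGG[OF a(1)] G m_closed mult_1_left mult_1_right)
  have "\<omega> (p \<otimes> x) y z * \<omega> p x (y \<otimes> z) = \<omega> p x y * \<omega> p (x \<otimes> y) z * \<omega> x y z"
    by (rule \<omega>_cocycle[OF G(1,4,5,6)])
  with 1 show ?thesis
    using assms r by (simp only: \<sigma>_eq \<omega>_FGG[OF assms(2)] G F.m_closed mult_1_right)
qed

lemma isotropy_iff: "x \<in> \<H> p \<longleftrightarrow> x \<in> F \<and> p \<triangleleft> x = p"
  by (simp add: isotropy_def)

lemma isotropy_subgroup:
  assumes p: "p \<in> Q"
  shows "subgroup (\<H> p) G"
proof (rule subgroupI)
  have "\<one> \<in> \<H> p" using ract_one[OF p] by (simp add: isotropy_iff)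
  then show "\<H> p \<noteq> {}" by blast
  show "inv a \<in> \<H> p" if "a \<in> \<H> p" for a using that ract_inv(1)[OF p, of a] by (auto simp: isotropy_iff)
qed (use p in \<open>auto simp: isotropy_iff ract_mult\<close>)

lemma isotropy_ract_eq: "q \<in> Q \<Longrightarrow> p \<in> Q \<Longrightarrow> h \<in> \<H> p \<Longrightarrow> q \<triangleleft> h = p \<longleftrightarrow> q = p"
  using ract_eq_swap[of q p h] ract_eq_swap[of p p h] by (auto simp: isotropy_iff)

lemma smash_simps [simp]:
  "carrier \<A> = carrier (free_vs (Q \<times> F))" "zero \<A> = (\<lambda>s. 0)" "add \<A> = (\<lambda>f g s. f s + g s)"
  "module.smult \<A> = (\<lambda>c f s. c * f s)" "one \<A> = (\<lambda>r. \<Sum>p\<in>Q. \<ee> (p, \<one>) r)"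
  by (simp_all add: cocycle_smash_def)

lemma twisted_simps [simp]:
  "carrier (\<T> p) = carrier (free_vs (\<H> p))" "zero (\<T> p) = (\<lambda>s. 0)" "add (\<T> p) = (\<lambda>f g s. f s + g s)"
  "module.smult (\<T> p) = (\<lambda>c f s. c * f s)" "one (\<T> p) = \<ee> \<one>"
  by (simp_all add: twisted_group_algebra_def)

lemma smash_mult_basis:
  "\<ee> (p, x) \<star> \<ee> (q, y) = (if p \<triangleleft> x = q then (\<lambda>r. \<sigma> p x y * \<ee> (p, x \<otimes> y) r) else (\<lambda>r. 0))"
  by (simp add: cocycle_smash_mult)

lemmas smash_bilinear = algebra_with_basis_bilinear[where S = "Q \<times> F" and
    m = "\<lambda>(p, x) (q, y). if p \<triangleleft> x = q then (\<lambda>r. \<sigma> p x y * \<ee> (p, x \<otimes> y) r) else (\<lambda>r. 0)" and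
    u = "\<lambda>r. \<Sum>p\<in>Q. \<ee> (p, \<one>) r", folded cocycle_smash_def]

lemmas smash_mult_zero = algebra_with_basis_mult_zero[where S = "Q \<times> F" and
    m = "\<lambda>(p, x) (q, y). if p \<triangleleft> x = q then (\<lambda>r. \<sigma> p x y * \<ee> (p, x \<otimes> y) r) else (\<lambda>r. 0)" and
    u = "\<lambda>r. \<Sum>p\<in>Q. \<ee> (p, \<one>) r", folded cocycle_smash_def]

lemmas twisted_bilinear = algebra_with_basis_bilinear[where S = "\<H> p" and
    m = "\<lambda>x y r. \<sigma> p x y * \<ee> (x \<otimes> y) r" and u = "\<ee> \<one>", folded twisted_group_algebra_def] for p

lemmas twisted_mult_zero = algebra_with_basis_mult_zero[where S = "\<H> p" and
    m = "\<lambda>x y r. \<sigma> p x y * \<ee> (x \<otimes> y) r" and u = "\<ee> \<one>", folded twisted_group_algebra_def] for p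

lemma twisted_closed:
  assumes "p \<in> Q" "a \<in> carrier (\<T> p)" "b \<in> carrier (\<T> p)"
  shows "a \<otimes>\<^bsub>\<T> p\<^esub> b \<in> carrier (\<T> p)"
proof -
  interpret H: subgroup "\<H> p" G using assms(1) by (rule isotropy_subgroup)
  show "a \<otimes>\<^bsub>\<T> p\<^esub> b \<in> carrier (\<T> p)"
    using assms unfolding twisted_group_algebra_def
    by (simp, intro algebra_with_basis_closed) (auto intro!: free_vs_closed)
qed

text \<open>On basis elements both bracketings vanish unless the Q-components match along the chain,
  and then \<open>sigma_cocycle\<close> compares the scalars. In the unit, multiplication of (q, y)
  from the left meets only the summand p = q, from the right only the summand where p is q acted on
  by y.\<close>

lemma smash_unital_algebra: "unital_algebra \<A>"
  unfolding cocycle_smash_def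
proof (rule algebra_with_basis_unital, fold cocycle_smash_def)
  let ?m = "\<lambda>(p, x) (q, y). if p \<triangleleft> x = q then (\<lambda>r. \<sigma> p x y * \<ee> (p, x \<otimes> y) r) else (\<lambda>r. 0)"
  let ?u = "\<lambda>r. \<Sum>p\<in>Q. \<ee> (p, \<one>) r :: 'k"
  show "?u \<in> carrier (free_vs (Q \<times> F))" using finite_Q by (rule sum_basis_carrier) simp
  fix s assume s: "s \<in> Q \<times> F"
  obtain q y where qy: "s = (q, y)" "q \<in> Q" "y \<in> F" using s by auto
  have "?u \<star> \<ee> s = (\<lambda>r. \<Sum>p\<in>Q. ?m (p, \<one>) s r)"
    using linear_extension_sum_basis[OF finite_Q, of "\<lambda>t. linear_extension (?m t) (\<ee> s)" "\<lambda>p. (p, \<one>)"]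
    by (simp add: cocycle_smash_def algebra_with_basis_mult linear_extension_basis_vec)
  also have "\<dots> = (\<lambda>r. \<Sum>p\<in>Q. if p = q then \<ee> (q, y) r else 0)"
    using qy by (intro ext sum.cong) (auto simp: ract_one sigma_one)
  also have "\<dots> = \<ee> s" using qy finite_Q by simp
  finally show "?u \<star> \<ee> s = \<ee> s" .
  have "\<ee> s \<star> ?u = (\<lambda>r. \<Sum>p\<in>Q. ?m s (p, \<one>) r)"
    using linear_extension_sum_basis[OF finite_Q, of "?m s" "\<lambda>p. (p, \<one>)"]
    by (simp add: cocycle_smash_def algebra_with_basis_mult linear_extension_basis_vec)
  also have "\<dots> = (\<lambda>r. \<Sum>p\<in>Q. if q \<triangleleft> y = p then \<ee> (q, y) r else 0)"
    using qy by (intro ext sum.cong) (auto simp: sigma_one)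
  also have "\<dots> = \<ee> s" using qy finite_Q by (simp add: ract_closed)
  finally show "\<ee> s \<star> ?u = \<ee> s" .
  fix t assume t: "t \<in> Q \<times> F"
  obtain r z where rz: "t = (r, z)" "r \<in> Q" "z \<in> F" using t by auto
  show "?m s t \<in> carrier (free_vs (Q \<times> F))"
    using qy rz by (auto intro!: free_vs_closed simp: free_vs_zero)
  fix t' assume t': "t' \<in> Q \<times> F"
  obtain r' z' where rz': "t' = (r', z')" "r' \<in> Q" "z' \<in> F" using t' by auto
  show "?m s t \<star> \<ee> t' = \<ee> s \<star> ?m t t'"
    using qy rz rz' sigma_cocycle[of q y z z']
    by (auto simp: smash_bilinear smash_mult_zero smash_mult_basis ract_mult m_assoc fun_eq_iff algebra_simps)
qed

sublocale smash: unital_algebra \<A> by (rule smash_unital_algebra)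

section \<open>The corner at a point p and the twisted group algebra of its isotropy group\<close>

definition iota :: "'g \<Rightarrow> ('g \<Rightarrow> 'k) \<Rightarrow> 'g \<times> 'g \<Rightarrow> 'k" where
  "iota p b = (\<lambda>(q, x). if q = p then b x else 0)"

text \<open>The compression of \<open>a\<close> by the idempotent at \<open>p\<close>, read in the
  twisted group algebra; \<open>iota p\<close> is the inclusion in the other direction. Coefficients
  off the isotropy group are cut away because the right-hand idempotent kills those basis
  elements.\<close>

definition corner :: "'g \<Rightarrow> ('g \<times> 'g \<Rightarrow> 'k) \<Rightarrow> 'g \<Rightarrow> 'k" where
  "corner p a = (\<lambda>x. if x \<in> \<H> p then a (p, x) else 0)"

lemma iota_simps:
  "iota p (\<lambda>s. b s + c s) = (\<lambda>s. iota p b s + iota p c s)" "iota p (\<lambda>s. k * b s) = (\<lambda>s. k * iota p b s)"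
  "iota p (\<lambda>s. 0) = (\<lambda>s. 0)" "iota p (\<ee> h) = \<ee> (p, h)"
  by (auto simp: iota_def basis_vec_def fun_eq_iff)

lemma iota_inject: "iota p b = iota p c \<longleftrightarrow> b = c"
proof
  assume "iota p b = iota p c"
  then have "iota p b (p, x) = iota p c (p, x)" for x by simp
  then show "b = c" by (simp add: iota_def fun_eq_iff)
qed simp

lemma finite_isotropy: "finite (\<H> p)"
  using finite_F by (rule rev_finite_subset) (auto simp: isotropy_iff)

lemma finite_basis_index: "finite (Q \<times> F)" "finite (Q \<times> \<H> p)"
  using finite_F finite_Q finite_isotropy by simp_all

lemma free_vs_subalgebra: "carrier (free_vs (Q \<times> \<H> p)) \<subseteq> carrier \<A>"
  by (auto simp: free_vs_carrier isotropy_iff)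

lemma iota_closed: "p \<in> Q \<Longrightarrow> b \<in> carrier (\<T> p) \<Longrightarrow> iota p b \<in> carrier (free_vs (Q \<times> \<H> p))"
  by (auto simp: free_vs_finite finite_basis_index finite_isotropy iota_def)

lemma iota_smash: "p \<in> Q \<Longrightarrow> b \<in> carrier (\<T> p) \<Longrightarrow> iota p b \<in> carrier \<A>"
  using iota_closed free_vs_subalgebra by blast

lemma corner_closed: "corner p a \<in> carrier (\<T> p)"
  by (simp add: corner_def free_vs_finite finite_isotropy)

lemma corner_simps:
  "corner p (\<lambda>s. a s + b s) = (\<lambda>x. corner p a x + corner p b x)"
  "corner p (\<lambda>s. k * a s) = (\<lambda>x. k * corner p a x)"
  "corner p (\<lambda>s. 0) = (\<lambda>x. 0)"
  by (auto simp: corner_def fun_eq_iff)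

lemma corner_basis: "corner p (\<ee> (q, x)) = (if q = p \<and> x \<in> \<H> p then \<ee> x else (\<lambda>_. 0))"
  by (auto simp: corner_def basis_vec_def fun_eq_iff)

lemma slice_closed: "a \<in> carrier (free_vs (Q \<times> \<H> p)) \<Longrightarrow> (\<lambda>x. a (p, x)) \<in> carrier (\<T> p)"
  by (auto simp: free_vs_finite finite_basis_index finite_isotropy)

lemma slice_eq_corner: "a \<in> carrier (free_vs (Q \<times> \<H> p)) \<Longrightarrow> (\<lambda>x. a (p, x)) = corner p a"
  by (auto simp: free_vs_finite finite_basis_index corner_def fun_eq_iff)

lemma iota_corner: "b \<in> carrier (\<T> p) \<Longrightarrow> corner p (iota p b) = b"
  by (auto simp: corner_def iota_def free_vs_carrier fun_eq_iff)

text \<open>Elements of the isotropy group fix \<open>p\<close>, so the Kronecker condition of the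
  smash product always holds and just the scalar \<open>\<sigma> p x y\<close> remains.\<close>

lemma iota_mult:
  assumes p: "p \<in> Q" and a: "a \<in> carrier (\<T> p)" and b: "b \<in> carrier (\<T> p)"
  shows "iota p (a \<otimes>\<^bsub>\<T> p\<^esub> b) = iota p a \<star> iota p b"
proof -
  note simps = twisted_bilinear twisted_mult_zero smash_bilinear smash_mult_zero iota_simps
    iota_smash[OF p, simplified]
  have e: "iota p (\<ee> x \<otimes>\<^bsub>\<T> p\<^esub> b) = iota p (\<ee> x) \<star> iota p b" if x: "x \<in> \<H> p" for x
    using b unfolding twisted_simps
  proof (induction rule: free_vs_induct)
    case zero
    then show ?case by (simp add: simps)
  next
    case (basis s c)
    then show ?case using x
      by (simp add: simps twisted_group_algebra_mult smash_mult_basis isotropy_iff)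
  next
    case (add f g)
    then show ?case by (simp add: simps)
  qed
  show ?thesis
    using a unfolding twisted_simps
  proof (induction rule: free_vs_induct)
    case zero
    then show ?case by (simp add: simps)
  next
    case (basis s c)
    then show ?case using e by (simp add: simps)
  next
    case (add f g)
    then show ?case by (simp add: simps)
  qed
qed

text \<open>From the left an idempotent tests the point at which a basis element starts, from the
  right the point to which its group element moves it.\<close>

lemma smash_idem_mult:
  assumes "p \<in> Q" "q \<in> Q" "x \<in> F"
  shows "\<ee> (p, \<one>) \<star> \<ee> (q, x) = (if p = q then \<ee> (q, x) else (\<lambda>_. 0))"
    and "\<ee> (q, x) \<star> \<ee> (p, \<one>) = (if q \<triangleleft> x = p then \<ee> (q, x) else (\<lambda>_. 0))"
  using assms by (auto simp: smash_mult_basis ract_one sigma_one)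

lemma corner_eq:
  assumes p: "p \<in> Q" and a: "a \<in> carrier \<A>"
  shows "\<ee> (p, \<one>) \<star> a \<star> \<ee> (p, \<one>) = iota p (corner p a)"
  using a unfolding smash_simps
proof (induction rule: free_vs_induct)
  case zero
  then show ?case by (simp add: smash_mult_zero iota_simps corner_simps)
next
  case (basis s c)
  then show ?case using p
    by (auto simp: smash_bilinear smash_mult_zero smash_idem_mult corner_simps corner_basis iota_simps
        isotropy_iff)
next
  case (add f g)
  then show ?case
    using p smash.mult_closed[of "\<ee> (p, \<one>)" f] smash.mult_closed[of "\<ee> (p, \<one>)" g]
    by (simp add: smash_bilinear iota_simps corner_simps)
qed

text \<open>Inside the subalgebra the idempotent on the right alone already produces the corner: an
  element fixing \<open>p\<close> moves \<open>q\<close> to \<open>p\<close> exactly when q =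
  p.\<close>

lemma slice_eq:
  assumes p: "p \<in> Q" and a: "a \<in> carrier (free_vs (Q \<times> \<H> p))"
  shows "a \<star> \<ee> (p, \<one>) = iota p (corner p a)"
  using a
proof (induction rule: free_vs_induct)
  case zero
  then show ?case by (simp add: smash_mult_zero iota_simps corner_simps)
next
  case (basis s c)
  then obtain q h where "s = (q, h)" "q \<in> Q" "h \<in> \<H> p" "h \<in> F" by (auto simp: isotropy_iff)
  then show ?case using p
    by (simp add: smash_bilinear smash_mult_zero smash_idem_mult corner_simps corner_basis iota_simps
        isotropy_ract_eq)
next
  case (add f g)
  then show ?case using p free_vs_subalgebra[of p]
    by (auto simp: smash_bilinear iota_simps corner_simps subset_iff)
qed

lemma iota_idem:
  assumes p: "p \<in> Q" and b: "b \<in> carrier (\<T> p)"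
  shows "iota p b \<star> \<ee> (p, \<one>) = iota p b" "\<ee> (p, \<one>) \<star> iota p b = iota p b"
proof -
  show 1: "iota p b \<star> \<ee> (p, \<one>) = iota p b"
    using slice_eq[OF p iota_closed[OF p b]] b by (simp add: iota_corner)
  have "\<ee> (p, \<one>) \<star> iota p b \<star> \<ee> (p, \<one>) = iota p b"
    using corner_eq[OF p iota_smash[OF p b]] b by (simp add: iota_corner)
  moreover have "\<ee> (p, \<one>) \<star> iota p b \<star> \<ee> (p, \<one>) = \<ee> (p, \<one>) \<star> iota p b"
    using smash.mult_assoc[OF _ iota_smash[OF p b], of "\<ee> (p, \<one>)" "\<ee> (p, \<one>)"] p 1 by simp
  ultimately show "\<ee> (p, \<one>) \<star> iota p b = iota p b" by simp
qed

text \<open>Compression is in general not multiplicative, but it is when the right factor lies in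
  the subalgebra: then b e = e b' with b' the corner of b, so an idempotent can be inserted between
  the factors. This is the balancing condition behind \<open>coind\<close>.\<close>

lemma corner_mult:
  assumes p: "p \<in> Q" and a: "a \<in> carrier \<A>" and b: "b \<in> carrier (free_vs (Q \<times> \<H> p))"
  shows "corner p (a \<star> b) = corner p a \<otimes>\<^bsub>\<T> p\<^esub> corner p b"
proof -
  let ?e = "\<ee> (p, \<one>) :: 'g \<times> 'g \<Rightarrow> 'k"
  have e: "?e \<in> carrier \<A>" using p by simp
  have bA: "b \<in> carrier \<A>" using b free_vs_subalgebra by blast
  have ib: "iota p (corner p b) \<in> carrier \<A>" by (rule iota_smash[OF p corner_closed])
  note cl = e a bA ib smash.mult_closed
  have "iota p (corner p (a \<star> b)) = ?e \<star> (a \<star> b) \<star> ?e"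
    using corner_eq[OF p smash.mult_closed[OF a bA]] by simp
  also have "\<dots> = ?e \<star> a \<star> (b \<star> ?e)" by (simp only: smash.mult_assoc cl)
  also have "\<dots> = ?e \<star> a \<star> (?e \<star> iota p (corner p b))"
    by (simp only: slice_eq[OF p b] iota_idem[OF p corner_closed])
  also have "\<dots> = ?e \<star> a \<star> ?e \<star> iota p (corner p b)" by (simp only: smash.mult_assoc cl)
  also have "\<dots> = iota p (corner p a \<otimes>\<^bsub>\<T> p\<^esub> corner p b)"
    by (simp only: corner_eq[OF p a] iota_mult[OF p corner_closed corner_closed])
  finally show ?thesis by (simp only: iota_inject)
qed

text \<open>
  Modules over \<open>opposite_algebra \<A>\<close> are right \<open>\<A>\<close>-modules; the product is therefore applied
  from left to right.
\<close>

lemma op_act_mult: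
  assumes "left_module (opposite_algebra \<A>) N" "a \<in> carrier \<A>" "b \<in> carrier \<A>" "n \<in> carrier N"
  shows "act N (a \<star> b) n = act N b (act N a n)"
  using left_module.act_mult[OF assms(1), of b a n] assms by simp

lemma op_act_zero:
  assumes N: "left_module (opposite_algebra \<A>) N" and n: "n \<in> carrier N"
  shows "act N (\<lambda>s. 0) n = \<zero>\<^bsub>N\<^esub>"
proof -
  have z: "(\<lambda>s. 0) \<in> carrier \<A>" by (simp add: free_vs_zero)
  have "act N (\<lambda>s. 0) n = 0 \<odot>\<^bsub>N\<^esub> act N (\<lambda>s. 0) n"
    using left_module.act_smult_left[OF N, of "\<lambda>s. 0" n 0] n z by simp
  also have "\<dots> = \<zero>\<^bsub>N\<^esub>"
    using left_module_closed(4)[OF N, of "\<lambda>s. 0" n] n z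
    by (intro smult_class_ring(2)[OF left_module_vectorspace[OF N]]) simp
  finally show ?thesis .
qed

text \<open>The unit is the sum of the idempotents at the points of \<open>Q\<close>, so
  \<open>n\<close> is the sum of its components.\<close>

lemma op_decompose:
  assumes N: "left_module (opposite_algebra \<A>) N" and n: "n \<in> carrier N"
    and S: "\<zero>\<^bsub>N\<^esub> \<in> S" "\<And>v w. v \<in> S \<Longrightarrow> w \<in> S \<Longrightarrow> v \<oplus>\<^bsub>N\<^esub> w \<in> S"
    and q: "\<And>q. q \<in> Q \<Longrightarrow> act N (\<ee> (q, \<one>)) n \<in> S"
  shows "n \<in> S"
proof -
  interpret N: left_module "opposite_algebra \<A>" N by (rule N)
  \<comment> \<open>The claim also records that the partial sums lie in the algebra, which
    additivity of the action asks for at the next summand.\<close>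
  have "act N (\<lambda>r. \<Sum>p\<in>P. \<ee> (p, \<one>) r) n \<in> S \<and> (\<lambda>r. \<Sum>p\<in>P. \<ee> (p, \<one>) r :: 'k) \<in> carrier \<A>"
    if "finite P" "P \<subseteq> Q" for P
    using that
  proof (induction P)
    case empty
    then show ?case using op_act_zero[OF N n] S by (simp add: free_vs_zero)
  next
    case (insert p P)
    then have "(\<lambda>r. \<ee> (p, \<one>) r + (\<Sum>p\<in>P. \<ee> (p, \<one>) r :: 'k)) \<in> carrier \<A>"
      unfolding smash_simps by (intro free_vs_closed(1)) auto
    then show ?case
      using insert N.act_add_left[of "\<ee> (p, \<one>)" "\<lambda>r. \<Sum>p\<in>P. \<ee> (p, \<one>) r" n] n S(2) q
      by simp
  qed
  from this[OF finite_Q] N.act_one[OF n] show ?thesis by simp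
qed

end

section \<open>The dual of an induced module\<close>

lemma point_lmodule_simps [simp]:
  "carrier (point_lmodule p W) = carrier W" "zero (point_lmodule p W) = zero W"
  "add (point_lmodule p W) = add W" "module.smult (point_lmodule p W) = module.smult W"
  "act (point_lmodule p W) f = act W (\<lambda>x. f (p, x))"
  by (simp_all add: point_lmodule_def)

locale isotropy_module = twisted_factorization G F Q \<omega> \<sigma>
  for G :: "('g, 'm) monoid_scheme" (structure) and F Q \<omega>
    and \<sigma> :: "'g \<Rightarrow> 'g \<Rightarrow> 'g \<Rightarrow> 'k::{alg_closed_field, field_char_0}" +
  fixes p :: 'g and W :: "('k, 'g \<Rightarrow> 'k, 'w) lmodule"
  assumes p: "p \<in> Q" and W: "left_module (\<T> p) W"
begin

interpretation F: subgroup F G by (rule subgroup_F)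
interpretation W: left_module "\<T> p" W by (rule W)

abbreviation "\<B> \<equiv> carrier (free_vs (Q \<times> \<H> p)) :: ('g \<times> 'g \<Rightarrow> 'k) set"

lemma tensor_setting: "tensor_product \<A> \<B> (point_lmodule p W)"
proof (intro tensor_product.intro tensor_product_axioms.intro smash_unital_algebra)
  show "vectorspace class_ring (point_lmodule p W)"
    using W.vectorspace_axioms by (rule vectorspace_restrict) auto
  show "act (point_lmodule p W) b v \<in> carrier (point_lmodule p W)"
    if "b \<in> \<B>" "v \<in> carrier (point_lmodule p W)" for b v
    using that W.act_closed[OF slice_closed] by simp
qed (rule free_vs_subalgebra)

interpretation tp: tensor_product \<A> \<B> "point_lmodule p W" by (rule tensor_setting)

abbreviation "U \<equiv> dual_lmodule (induced_lmodule G F Q \<sigma> p W)"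
abbreviation "tens \<equiv> pure_tensor \<A> \<B> (point_lmodule p W)"
abbreviation "e\<^sub>p \<equiv> \<ee> (p, \<one>) :: 'g \<times> 'g \<Rightarrow> 'k"

lemma U_module: "left_module (opposite_algebra \<A>) U"
  unfolding induced_lmodule_def by (rule tp.dual_tensor_left_module)

interpretation U: left_module "opposite_algebra \<A>" U by (rule U_module)

lemma tens_carrier: "a \<in> carrier \<A> \<Longrightarrow> w \<in> carrier W \<Longrightarrow> tens a w \<in> carrier (induced_lmodule G F Q \<sigma> p W)"
  unfolding induced_lmodule_def by (rule tp.tens_carrier) simp_all

lemma ep_carrier: "e\<^sub>p \<in> carrier \<A>"
  using p by simp

lemma ep_idem: "e\<^sub>p \<star> e\<^sub>p = e\<^sub>p"
  using smash_idem_mult(1)[OF p p F.one_closed] by simp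

lemma U_eqI:
  assumes "\<phi> \<in> carrier U" "\<psi> \<in> carrier U"
    and "\<And>a w. a \<in> carrier \<A> \<Longrightarrow> w \<in> carrier W \<Longrightarrow> \<phi> (tens a w) = \<psi> (tens a w)"
  shows "\<phi> = \<psi>"
  using assms unfolding induced_lmodule_def by (intro tp.dual_tensor_eqI) simp_all

text \<open>The subalgebra acts on the point module through the slice of coefficients at
  \<open>p\<close>; on the subalgebra this slice is \<open>corner p b\<close>, the form in which
  balancing is used from here on.\<close>

lemma U_rels:
  assumes "\<phi> \<in> carrier U" "w \<in> carrier W" "a \<in> carrier \<A>"
  shows U_add: "a' \<in> carrier \<A> \<Longrightarrow> \<phi> (tens (\<lambda>s. a s + a' s) w) = \<phi> (tens a w) + \<phi> (tens a' w)"
    and U_add_right: "w' \<in> carrier W \<Longrightarrow> \<phi> (tens a (w \<oplus>\<^bsub>W\<^esub> w')) = \<phi> (tens a w) + \<phi> (tens a w')"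
    and U_smult: "\<phi> (tens (\<lambda>s. c * a s) w) = c * \<phi> (tens a w)"
    and U_smult_right: "\<phi> (tens a (c \<odot>\<^bsub>W\<^esub> w)) = c * \<phi> (tens a w)"
    and U_balanced: "b \<in> \<B> \<Longrightarrow> \<phi> (tens (a \<star> b) w) = \<phi> (tens a (act W (corner p b) w))"
    and U_act: "a' \<in> carrier \<A> \<Longrightarrow> act U a' \<phi> (tens a w) = \<phi> (tens (a' \<star> a) w)"
  using tp.dual_tensor_rels[of \<phi> w a] assms by (simp_all add: induced_lmodule_def slice_eq_corner)

lemma U_functional: "\<phi> \<in> carrier U \<Longrightarrow> a \<in> carrier \<A> \<Longrightarrow> linear_functional W (\<lambda>w. \<phi> (tens a w))"
  by (simp add: linear_functional_def U_add_right U_smult_right del: smash_simps dual_lmodule_simps)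

lemma W_act_zero: "w \<in> carrier W \<Longrightarrow> act W (\<lambda>_. 0) w = \<zero>\<^bsub>W\<^esub>"
  using W.act_smult_left[of "\<lambda>_. 0" w 0] smult_class_ring(2)[OF W.vectorspace_axioms W.act_closed[of "\<lambda>_. 0" w]]
  by (simp add: free_vs_zero)

lemma U_zero:
  assumes "\<phi> \<in> carrier U" "w \<in> carrier W"
  shows "\<phi> (tens (\<lambda>_. 0) w) = 0" and "a \<in> carrier \<A> \<Longrightarrow> \<phi> (tens a \<zero>\<^bsub>W\<^esub>) = 0"
proof -
  have "(\<lambda>_. 0) \<in> carrier \<A>" by (simp add: free_vs_zero)
  from U_smult[OF assms this, of 0] show "\<phi> (tens (\<lambda>_. 0) w) = 0" by simp
  show "\<phi> (tens a \<zero>\<^bsub>W\<^esub>) = 0" if "a \<in> carrier \<A>"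
    by (rule linear_functional_zero[OF W.vectorspace_axioms U_functional[OF assms(1) that]])
qed

text \<open>The basis element (q, x) is unchanged by the idempotent at its target point on the
  right. That idempotent lies in the subalgebra, so it moves across the tensor sign, and there it
  acts as zero unless the target is \<open>p\<close>.\<close>

lemma U_support:
  assumes \<phi>: "\<phi> \<in> carrier U" and w: "w \<in> carrier W" and q: "q \<in> Q" "x \<in> F" "q \<triangleleft> x \<noteq> p"
  shows "\<phi> (tens (\<ee> (q, x)) w) = 0"
proof -
  have r: "q \<triangleleft> x \<in> Q" using q by (simp add: ract_closed)
  have "\<one> \<in> \<H> p" using isotropy_subgroup[OF p] by (rule subgroup.one_closed)
  then have b: "\<ee> (q \<triangleleft> x, \<one>) \<in> \<B>" using r by simp
  have a: "\<ee> (q, x) \<in> carrier \<A>" using q by simp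
  have "\<phi> (tens (\<ee> (q, x)) w) = \<phi> (tens (\<ee> (q, x) \<star> \<ee> (q \<triangleleft> x, \<one>)) w)"
    using q r by (simp add: smash_idem_mult)
  also have "\<dots> = \<phi> (tens (\<ee> (q, x)) (act W (corner p (\<ee> (q \<triangleleft> x, \<one>))) w))" by (rule U_balanced[OF \<phi> w a b])
  also have "\<dots> = 0" using q U_zero(2)[OF \<phi> w a] by (simp add: corner_basis W_act_zero[OF w])
  finally show ?thesis .
qed

lemma U_eqI_basis:
  assumes \<phi>: "\<phi> \<in> carrier U" and \<psi>: "\<psi> \<in> carrier U"
    and eq: "\<And>q x w. q \<in> Q \<Longrightarrow> x \<in> F \<Longrightarrow> q \<triangleleft> x = p \<Longrightarrow> w \<in> carrier W \<Longrightarrow>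
      \<phi> (tens (\<ee> (q, x)) w) = \<psi> (tens (\<ee> (q, x)) w)"
  shows "\<phi> = \<psi>"
proof (rule U_eqI[OF \<phi> \<psi>])
  fix a w assume a: "a \<in> carrier \<A>" and w: "w \<in> carrier W"
  show "\<phi> (tens a w) = \<psi> (tens a w)" using a unfolding smash_simps
  proof (induction rule: free_vs_induct)
    case zero
    then show ?case by (simp only: U_zero[OF \<phi> w] U_zero[OF \<psi> w])
  next
    case (basis s c)
    obtain q x where s: "s = (q, x)" "q \<in> Q" "x \<in> F" using basis by auto
    have "\<ee> s \<in> carrier \<A>" using s by simp
    note sm = U_smult[OF \<phi> w this] U_smult[OF \<psi> w this]
    have "\<phi> (tens (\<ee> s) w) = \<psi> (tens (\<ee> s) w)"
    proof (cases "q \<triangleleft> x = p")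
      case True
      then show ?thesis using eq[OF s(2,3) True w] s(1) by simp
    next
      case False
      then show ?thesis using U_support[OF \<phi> w s(2,3)] U_support[OF \<psi> w s(2,3)] s(1) by simp
    qed
    then show ?case by (simp only: sm)
  next
    case (add f g)
    then have "f \<in> carrier \<A>" "g \<in> carrier \<A>" by simp_all
    with add.IH show ?case by (simp only: U_add[OF \<phi> w] U_add[OF \<psi> w])
  qed
qed

text \<open>The functional on \<open>W\<close> cut out by the slice of tensors with first factor
  \<open>e\<^sub>p\<close>. On the corner of \<open>U\<close> at \<open>p\<close> it is an
  isomorphism onto the dual of \<open>W\<close>, with inverse \<open>coind\<close>.\<close>

definition base :: "(((('g \<times> 'g \<Rightarrow> 'k) \<times> 'w \<Rightarrow> 'k) set) \<Rightarrow> 'k) \<Rightarrow> 'w \<Rightarrow> 'k" where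
  "base \<phi> = (\<lambda>w\<in>carrier W. \<phi> (tens e\<^sub>p w))"

text \<open>The choice is in fact a definite description: values on pure tensors determine an
  element of \<open>U\<close> by \<open>U_eqI\<close>.\<close>

definition coind :: "('w \<Rightarrow> 'k) \<Rightarrow> ((('g \<times> 'g \<Rightarrow> 'k) \<times> 'w \<Rightarrow> 'k) set) \<Rightarrow> 'k" where
  "coind \<mu> = (SOME \<phi>. \<phi> \<in> carrier U \<and>
     (\<forall>a\<in>carrier \<A>. \<forall>w\<in>carrier W. \<phi> (tens a w) = \<mu> (act W (corner p a) w)))"

text \<open>The formula is bilinear, and \<open>corner_mult\<close> makes it balanced, so the
  universal property applies.\<close>

lemma coind:
  assumes \<mu>: "\<mu> \<in> carrier (dual_lmodule W)"
  shows coind_carrier: "coind \<mu> \<in> carrier U"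
    and coind_tens: "a \<in> carrier \<A> \<Longrightarrow> w \<in> carrier W \<Longrightarrow> coind \<mu> (tens a w) = \<mu> (act W (corner p a) w)"
proof -
  have lin: "linear_functional W \<mu>" using \<mu> by simp
  note cl = W.act_closed[OF corner_closed]
  have "\<exists>\<phi>. \<phi> \<in> carrier U \<and> (\<forall>a\<in>carrier \<A>. \<forall>w\<in>carrier W. \<phi> (tens a w) = \<mu> (act W (corner p a) w))"
  proof (rule tp.dual_tensor_exists[where \<beta> = "\<lambda>a w. \<mu> (act W (corner p a) w)"])
    fix a a' v v' c assume *: "a \<in> carrier \<A>" "a' \<in> carrier \<A>"
      "v \<in> carrier (point_lmodule p W)" "v' \<in> carrier (point_lmodule p W)"
    show "\<mu> (act W (corner p (a \<oplus>\<^bsub>\<A>\<^esub> a')) v) = \<mu> (act W (corner p a) v) + \<mu> (act W (corner p a') v)"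
      using * W.act_add_left[OF corner_closed corner_closed, of v a a'] linear_functional_add[OF lin] cl
      by (simp add: corner_simps)
    show "\<mu> (act W (corner p a) (v \<oplus>\<^bsub>point_lmodule p W\<^esub> v')) =
        \<mu> (act W (corner p a) v) + \<mu> (act W (corner p a) v')"
      using * W.act_add_right[OF corner_closed, of v v'] linear_functional_add[OF lin] cl by simp
    show "\<mu> (act W (corner p (c \<odot>\<^bsub>\<A>\<^esub> a)) v) = c * \<mu> (act W (corner p a) v)"
      using * W.act_smult_left[OF corner_closed, of v c a] linear_functional_smult[OF lin] cl
      by (simp add: corner_simps)
    show "\<mu> (act W (corner p a) (c \<odot>\<^bsub>point_lmodule p W\<^esub> v)) = c * \<mu> (act W (corner p a) v)"
      using * W.act_smult_right[OF corner_closed, of v] linear_functional_smult[OF lin] cl by simp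
    fix b assume b: "b \<in> \<B>"
    show "\<mu> (act W (corner p (a \<star> b)) v) = \<mu> (act W (corner p a) (act (point_lmodule p W) b v))"
      using * b W.act_mult[OF corner_closed corner_closed, of v a b]
      by (simp add: corner_mult[OF p] slice_eq_corner)
  next
    fix \<phi> assume "\<phi> \<in> carrier (dual_lmodule (tensor_lmodule \<A> \<B> (point_lmodule p W)))"
      "\<And>a v. a \<in> carrier \<A> \<Longrightarrow> v \<in> carrier (point_lmodule p W) \<Longrightarrow> \<phi> (tens a v) = \<mu> (act W (corner p a) v)"
    then show ?thesis unfolding induced_lmodule_def by auto
  qed
  then have "coind \<mu> \<in> carrier U \<and> (\<forall>a\<in>carrier \<A>. \<forall>w\<in>carrier W. coind \<mu> (tens a w) = \<mu> (act W (corner p a) w))"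
    unfolding coind_def by (rule someI_ex)
  then show "coind \<mu> \<in> carrier U"
    and "a \<in> carrier \<A> \<Longrightarrow> w \<in> carrier W \<Longrightarrow> coind \<mu> (tens a w) = \<mu> (act W (corner p a) w)" by blast+
qed

lemma base_carrier: "\<phi> \<in> carrier U \<Longrightarrow> base \<phi> \<in> carrier (dual_lmodule W)"
  using U_functional[OF _ ep_carrier, of \<phi>] by (simp add: base_def linear_functional_def)

lemma corner_one: "corner p e\<^sub>p = \<ee> \<one>"
  using subgroup.one_closed[OF isotropy_subgroup[OF p]] by (simp add: corner_basis)

lemma base_coind: "\<mu> \<in> carrier (dual_lmodule W) \<Longrightarrow> base (coind \<mu>) = \<mu>"
  using W.act_one
  by (auto simp: base_def fun_eq_iff coind_tens[OF _ ep_carrier] corner_one extensional_def)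

lemma corner_ep_mult:
  assumes a: "a \<in> carrier \<A>"
  shows "corner p (e\<^sub>p \<star> a) = corner p a"
proof -
  have "e\<^sub>p \<star> (e\<^sub>p \<star> a) = e\<^sub>p \<star> a"
    by (simp only: smash.mult_assoc[OF ep_carrier ep_carrier a, symmetric] ep_idem)
  then have "iota p (corner p (e\<^sub>p \<star> a)) = iota p (corner p a)"
    using corner_eq[OF p a] corner_eq[OF p smash.mult_closed[OF ep_carrier a]] by (simp only:)
  then show ?thesis by (simp only: iota_inject)
qed

lemma coind_idem:
  assumes \<mu>: "\<mu> \<in> carrier (dual_lmodule W)"
  shows "act U e\<^sub>p (coind \<mu>) = coind \<mu>"
proof (rule U_eqI)
  note c = coind_carrier[OF \<mu>]
  show "act U e\<^sub>p (coind \<mu>) \<in> carrier U" "coind \<mu> \<in> carrier U"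
    using U.act_closed[of e\<^sub>p "coind \<mu>"] c p by simp_all
  fix a w assume *: "a \<in> carrier \<A>" "w \<in> carrier W"
  then show "act U e\<^sub>p (coind \<mu>) (tens a w) = coind \<mu> (tens a w)"
    using U_act[OF c *(2,1) ep_carrier] coind_tens[OF \<mu> smash.mult_closed[OF ep_carrier *(1)] *(2)]
      coind_tens[OF \<mu> *] by (simp only: corner_ep_mult)
qed

text \<open>Invariance under \<open>e\<^sub>p\<close> kills the value at (q, x) unless q = p, and
  \<open>U_support\<close> kills it unless x moves q to p. What remains has x in the isotropy group,
  and such an element moves across the tensor sign to \<open>W\<close>.\<close>

lemma ep_determined:
  assumes \<phi>: "\<phi> \<in> carrier U" and idem: "act U e\<^sub>p \<phi> = \<phi>"
  shows "\<phi> = coind (base \<phi>)"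
proof (rule U_eqI_basis[OF \<phi> coind_carrier[OF base_carrier[OF \<phi>]]])
  fix q x w assume q: "q \<in> Q" "x \<in> F" "q \<triangleleft> x = p" and w: "w \<in> carrier W"
  have e: "\<ee> (q, x) \<in> carrier \<A>" using q by simp
  have 1: "\<phi> (tens (\<ee> (q, x)) w) = \<phi> (tens (e\<^sub>p \<star> \<ee> (q, x)) w)"
    using U_act[OF \<phi> w e ep_carrier] by (simp only: idem)
  have cl: "act W (corner p (\<ee> (q, x))) w \<in> carrier W" by (rule W.act_closed[OF corner_closed w])
  have 2: "coind (base \<phi>) (tens (\<ee> (q, x)) w) = \<phi> (tens e\<^sub>p (act W (corner p (\<ee> (q, x))) w))"
    unfolding coind_tens[OF base_carrier[OF \<phi>] e w] using cl by (simp add: base_def)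
  show "\<phi> (tens (\<ee> (q, x)) w) = coind (base \<phi>) (tens (\<ee> (q, x)) w)"
  proof (cases "q = p")
    case True
    then have "\<ee> (q, x) \<in> \<B>" using q by (simp add: isotropy_iff)
    then show ?thesis unfolding 1 2 by (rule U_balanced[OF \<phi> w ep_carrier])
  next
    case False
    then show ?thesis unfolding 1 2
      using U_zero[OF \<phi> w] ep_carrier p q by (simp add: smash_idem_mult corner_basis W_act_zero[OF w])
  qed
qed

text \<open>Elements of the corner absorb \<open>e\<^sub>p\<close> on both sides, so
  \<open>iota p b\<close> can be moved to its right and then across the tensor sign.\<close>

lemma base_act:
  assumes \<phi>: "\<phi> \<in> carrier U" and b: "b \<in> carrier (\<T> p)"
  shows "base (act U (iota p b) \<phi>) = act (dual_lmodule W) b (base \<phi>)"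
proof
  fix w
  show "base (act U (iota p b) \<phi>) w = act (dual_lmodule W) b (base \<phi>) w"
  proof (cases "w \<in> carrier W")
    case True
    have "base (act U (iota p b) \<phi>) w = \<phi> (tens (iota p b \<star> e\<^sub>p) w)"
      using True U_act[OF \<phi> True ep_carrier iota_smash[OF p b]] by (simp add: base_def)
    also have "\<dots> = \<phi> (tens (e\<^sub>p \<star> iota p b) w)" by (simp only: iota_idem[OF p b])
    also have "\<dots> = \<phi> (tens e\<^sub>p (act W b w))"
      using U_balanced[OF \<phi> True ep_carrier iota_closed[OF p b]] by (simp only: iota_corner[OF b])
    finally show ?thesis using True W.act_closed[OF b True] by (simp add: base_def)
  qed (simp add: base_def)
qed

lemma base_linear:
  assumes "\<phi> \<in> carrier U" "\<psi> \<in> carrier U"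
  shows "base (\<phi> \<oplus>\<^bsub>U\<^esub> \<psi>) = base \<phi> \<oplus>\<^bsub>dual_lmodule W\<^esub> base \<psi>"
    and "base (c \<odot>\<^bsub>U\<^esub> \<phi>) = c \<odot>\<^bsub>dual_lmodule W\<^esub> base \<phi>"
    and "base \<zero>\<^bsub>U\<^esub> = \<zero>\<^bsub>dual_lmodule W\<^esub>"
  using tens_carrier[OF ep_carrier] by (auto simp: base_def fun_eq_iff)

lemma base_idem:
  assumes \<phi>: "\<phi> \<in> carrier U"
  shows "base (act U e\<^sub>p \<phi>) = base \<phi>"
  unfolding base_def by (intro restrict_ext) (simp only: U_act[OF \<phi> _ ep_carrier ep_carrier] ep_idem)

text \<open>Each right-hand side is fixed by \<open>e\<^sub>p\<close> and has the required
  \<open>base\<close>, so \<open>ep_determined\<close> identifies it with the left-hand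
  side.\<close>

lemma coind_hom:
  assumes \<mu>: "\<mu> \<in> carrier (dual_lmodule W)"
  shows coind_add: "\<nu> \<in> carrier (dual_lmodule W) \<Longrightarrow>
      coind (\<mu> \<oplus>\<^bsub>dual_lmodule W\<^esub> \<nu>) = coind \<mu> \<oplus>\<^bsub>U\<^esub> coind \<nu>"
    and coind_smult: "coind (k \<odot>\<^bsub>dual_lmodule W\<^esub> \<mu>) = k \<odot>\<^bsub>U\<^esub> coind \<mu>"
    and coind_act: "b \<in> carrier (\<T> p) \<Longrightarrow>
      coind (act (dual_lmodule W) b \<mu>) = act U (iota p b) (coind \<mu>)"
proof -
  have eqI: "coind \<nu> = \<phi>" if "\<phi> \<in> carrier U" "act U e\<^sub>p \<phi> = \<phi>" "base \<phi> = \<nu>" for \<phi> \<nu>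
    using ep_determined[OF that(1,2)] that(3) by simp
  note ep = ep_carrier[folded opposite_algebra_simps(1)[of \<A>]]
  note c = coind_carrier[OF \<mu>]
  show "coind (\<mu> \<oplus>\<^bsub>dual_lmodule W\<^esub> \<nu>) = coind \<mu> \<oplus>\<^bsub>U\<^esub> coind \<nu>"
    if \<nu>: "\<nu> \<in> carrier (dual_lmodule W)"
  proof (rule eqI)
    note d = coind_carrier[OF \<nu>]
    show "act U e\<^sub>p (coind \<mu> \<oplus>\<^bsub>U\<^esub> coind \<nu>) = coind \<mu> \<oplus>\<^bsub>U\<^esub> coind \<nu>"
      by (simp only: U.act_add_right[OF ep c d] coind_idem[OF \<mu>] coind_idem[OF \<nu>])
    show "base (coind \<mu> \<oplus>\<^bsub>U\<^esub> coind \<nu>) = \<mu> \<oplus>\<^bsub>dual_lmodule W\<^esub> \<nu>"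
      by (simp only: base_linear[OF c d] base_coind[OF \<mu>] base_coind[OF \<nu>])
    show "coind \<mu> \<oplus>\<^bsub>U\<^esub> coind \<nu> \<in> carrier U" by (rule left_module_closed(1)[OF U_module c d])
  qed
  show "coind (k \<odot>\<^bsub>dual_lmodule W\<^esub> \<mu>) = k \<odot>\<^bsub>U\<^esub> coind \<mu>"
  proof (rule eqI)
    show "act U e\<^sub>p (k \<odot>\<^bsub>U\<^esub> coind \<mu>) = k \<odot>\<^bsub>U\<^esub> coind \<mu>"
      by (simp only: U.act_smult_right[OF ep c] coind_idem[OF \<mu>])
    show "base (k \<odot>\<^bsub>U\<^esub> coind \<mu>) = k \<odot>\<^bsub>dual_lmodule W\<^esub> \<mu>"
      by (simp only: base_linear[OF c c] base_coind[OF \<mu>])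
    show "k \<odot>\<^bsub>U\<^esub> coind \<mu> \<in> carrier U" by (rule left_module_closed(2)[OF U_module c])
  qed
  show "coind (act (dual_lmodule W) b \<mu>) = act U (iota p b) (coind \<mu>)" if b: "b \<in> carrier (\<T> p)"
  proof (rule eqI)
    have ib: "iota p b \<in> carrier \<A>" by (rule iota_smash[OF p b])
    show "act U (iota p b) (coind \<mu>) \<in> carrier U"
      using U.act_closed[of "iota p b", unfolded opposite_algebra_simps, OF ib c] .
    show "act U e\<^sub>p (act U (iota p b) (coind \<mu>)) = act U (iota p b) (coind \<mu>)"
      using op_act_mult[OF U_module ib ep_carrier c] by (simp only: iota_idem[OF p b])
    show "base (act U (iota p b) (coind \<mu>)) = act (dual_lmodule W) b \<mu>"
      by (simp only: base_act[OF c b] base_coind[OF \<mu>])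
  qed
qed

end

section \<open>Irreducible modules and their characters\<close>

context twisted_factorization
begin

interpretation F: subgroup F G by (rule subgroup_F)

lemma op_act_closed:
  "left_module (opposite_algebra \<A>) N \<Longrightarrow> a \<in> carrier \<A> \<Longrightarrow> n \<in> carrier N \<Longrightarrow> act N a n \<in> carrier N"
  using left_module_closed(4)[of "opposite_algebra \<A>" N a n] by simp

lemma op_act_smult:
  "left_module (opposite_algebra \<A>) N \<Longrightarrow> a \<in> carrier \<A> \<Longrightarrow> n \<in> carrier N \<Longrightarrow>
    act N (\<lambda>s. c * a s) n = c \<odot>\<^bsub>N\<^esub> act N a n"
  using left_module.act_smult_left[of "opposite_algebra \<A>" N a n c] by simp

lemma smash_mult_inv:
  assumes "q \<in> Q" "y \<in> F"
  shows "\<ee> (q, y) \<star> \<ee> (q \<triangleleft> y, inv y) = (\<lambda>s. \<sigma> q y (inv y) * \<ee> (q, \<one>) s)"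
  using assms by (simp add: smash_mult_basis)

text \<open>The basis elements (q, y) and, at the target point, y^{-1} multiply to
  \<open>\<sigma> q y (inv y)\<close> times the idempotent at q. Moving a component along its orbit
  is therefore reversible up to this nonzero scalar.\<close>

lemma op_act_recover:
  assumes N: "left_module (opposite_algebra \<A>) N" and n: "n \<in> carrier N" and q: "q \<in> Q" "y \<in> F"
  shows "act N (\<ee> (q, \<one>)) n =
    inverse (\<sigma> q y (inv y)) \<odot>\<^bsub>N\<^esub> act N (\<ee> (q \<triangleleft> y, inv y)) (act N (\<ee> (q, y)) n)"
proof -
  interpret N: left_module "opposite_algebra \<A>" N by (rule N)
  have e: "\<ee> (q, \<one>) \<in> carrier \<A>" "\<ee> (q, y) \<in> carrier \<A>" "\<ee> (q \<triangleleft> y, inv y) \<in> carrier \<A>"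
    using q by (simp_all add: ract_closed)
  have eq: "act N (\<ee> (q \<triangleleft> y, inv y)) (act N (\<ee> (q, y)) n) = \<sigma> q y (inv y) \<odot>\<^bsub>N\<^esub> act N (\<ee> (q, \<one>)) n"
    using op_act_mult[OF N e(2,3) n] op_act_smult[OF N e(1) n] by (simp only: smash_mult_inv[OF q])
  have "\<sigma> q y (inv y) \<noteq> 0" using q by (intro sigma_nonzero) auto
  moreover have "act N (\<ee> (q, \<one>)) n \<in> carrier N" by (rule op_act_closed[OF N e(1) n])
  ultimately show ?thesis
    unfolding eq using N.smult_assoc1[of "inverse (\<sigma> q y (inv y))" "\<sigma> q y (inv y)" "act N (\<ee> (q, \<one>)) n"]
      smult_class_ring(1)[OF N.vectorspace_axioms] by simp
qed

text \<open>The space N e for the idempotent e at \<open>p\<close>, encoded as the fixed vectors of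
  e. The twisted group algebra acts through \<open>iota p\<close>, again from the right.\<close>

definition corner_lmodule :: "'g \<Rightarrow> ('k, 'g \<times> 'g \<Rightarrow> 'k, 'u) lmodule \<Rightarrow> ('k, 'g \<Rightarrow> 'k, 'u) lmodule" where
  "corner_lmodule p N =
    \<lparr>carrier = {n \<in> carrier N. act N (\<ee> (p, \<one>)) n = n}, mult = undefined, one = undefined,
     zero = zero N, add = add N, smult = module.smult N, act = (\<lambda>b. act N (iota p b))\<rparr>"

lemma corner_lmodule_simps [simp]:
  "carrier (corner_lmodule p N) = {n \<in> carrier N. act N (\<ee> (p, \<one>)) n = n}"
  "zero (corner_lmodule p N) = zero N" "add (corner_lmodule p N) = add N"
  "module.smult (corner_lmodule p N) = module.smult N" "act (corner_lmodule p N) b = act N (iota p b)"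
  by (simp_all add: corner_lmodule_def)

text \<open>A nonzero submodule \<open>S\<close> of the corner is enlarged to the set of all v with
  v A e inside \<open>S\<close>. This is a submodule of \<open>N\<close>, hence everything, and a
  corner vector v then lies in \<open>S\<close> because v = v e e.\<close>

lemma corner_irreducible:
  assumes N: "irreducible_lmodule (opposite_algebra \<A>) N" and p: "p \<in> Q"
    and n: "n \<in> carrier N" "n \<noteq> \<zero>\<^bsub>N\<^esub>" "act N (\<ee> (p, \<one>)) n = n"
  shows "irreducible_lmodule (opposite_algebra (\<T> p)) (corner_lmodule p N)"
proof -
  interpret N: left_module "opposite_algebra \<A>" N using N by (rule irreducible_lmodule_left_module)
  have Nm: "left_module (opposite_algebra \<A>) N" by unfold_locales
  let ?e = "\<ee> (p, \<one>) :: 'g \<times> 'g \<Rightarrow> 'k"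
  have e: "?e \<in> carrier \<A>" using p by simp
  have e': "?e \<in> carrier (opposite_algebra \<A>)" using e by simp
  have ee: "?e \<star> ?e = ?e" using smash_idem_mult(1)[OF p p F.one_closed] by simp
  have ib: "iota p b \<in> carrier \<A>" if "b \<in> carrier (\<T> p)" for b by (rule iota_smash[OF p that])
  have ib': "iota p b \<in> carrier (opposite_algebra \<A>)" if "b \<in> carrier (\<T> p)" for b using ib[OF that] by simp
  have e_act: "act N ?e (act N (iota p b) v) = act N (iota p b) v"
      if "b \<in> carrier (\<T> p)" "v \<in> carrier N" for b v
    using op_act_mult[OF Nm ib[OF that(1)] e that(2)] by (simp only: iota_idem[OF p that(1)])
  have vs: "vectorspace class_ring (corner_lmodule p N)"
  proof (rule vectorspace_restrict[OF N.vectorspace_axioms])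
    show "\<zero>\<^bsub>N\<^esub> \<in> carrier (corner_lmodule p N)" using act_zero[OF Nm e'] by simp
    show "v \<oplus>\<^bsub>N\<^esub> w \<in> carrier (corner_lmodule p N)"
      if "v \<in> carrier (corner_lmodule p N)" "w \<in> carrier (corner_lmodule p N)" for v w
      using that N.act_add_right[OF e', of v w] by simp
    show "c \<odot>\<^bsub>N\<^esub> v \<in> carrier (corner_lmodule p N)" if "v \<in> carrier (corner_lmodule p N)" for c v
      using that N.act_smult_right[OF e', of v c] by simp
  qed auto
  have M: "left_module (opposite_algebra (\<T> p)) (corner_lmodule p N)"
  proof (intro left_module.intro left_module_axioms.intro vs, goal_cases)
    case (1 a v)
    then have "a \<in> carrier (\<T> p)" "v \<in> carrier N" by simp_all
    then show ?case using op_act_closed[OF Nm ib] e_act by simp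
  next
    case (2 a v w)
    then have "a \<in> carrier (\<T> p)" "v \<in> carrier N" "w \<in> carrier N" by simp_all
    then show ?case using N.act_add_right[OF ib'] by simp
  next
    case (3 a v c)
    then have "a \<in> carrier (\<T> p)" "v \<in> carrier N" by simp_all
    then show ?case using N.act_smult_right[OF ib'] by simp
  next
    case (4 a b v)
    then have "a \<in> carrier (\<T> p)" "b \<in> carrier (\<T> p)" "v \<in> carrier N" by simp_all
    then show ?case using N.act_add_left[OF ib' ib'] by (simp add: iota_simps)
  next
    case (5 a v c)
    then have "a \<in> carrier (\<T> p)" "v \<in> carrier N" by simp_all
    then show ?case using op_act_smult[OF Nm ib] by (simp add: iota_simps)
  next
    case (6 v)
    then show ?case by (simp add: iota_simps)
  next
    case (7 a b v)
    then have *: "a \<in> carrier (\<T> p)" "b \<in> carrier (\<T> p)" "v \<in> carrier N" by simp_all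
    then show ?case using op_act_mult[OF Nm ib ib] by (simp add: iota_mult[OF p *(2,1)])
  qed
  show ?thesis
  proof (rule irreducible_lmoduleI[OF M])
    show "n \<in> carrier (corner_lmodule p N)" "n \<noteq> \<zero>\<^bsub>corner_lmodule p N\<^esub>" using n by simp_all
    fix S s
    assume S: "S \<subseteq> carrier (corner_lmodule p N)" "\<zero>\<^bsub>corner_lmodule p N\<^esub> \<in> S"
      "\<And>v w. v \<in> S \<Longrightarrow> w \<in> S \<Longrightarrow> v \<oplus>\<^bsub>corner_lmodule p N\<^esub> w \<in> S"
      "\<And>c v. v \<in> S \<Longrightarrow> c \<odot>\<^bsub>corner_lmodule p N\<^esub> v \<in> S"
      "\<And>a v. a \<in> carrier (opposite_algebra (\<T> p)) \<Longrightarrow> v \<in> S \<Longrightarrow> act (corner_lmodule p N) a v \<in> S"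
      and s: "s \<in> S" "s \<noteq> \<zero>\<^bsub>corner_lmodule p N\<^esub>"
    let ?K = "{v \<in> carrier N. \<forall>a\<in>carrier \<A>. act N ?e (act N a v) \<in> S}"
    have S_carrier: "v \<in> carrier N" "act N ?e v = v" if "v \<in> S" for v using that S(1) by auto
    \<comment> \<open>For v in the corner, v a e equals v (e a e), the action of
      \<open>corner p a\<close>; hence \<open>S\<close> is contained in \<open>?K\<close>, which is
      therefore nonzero.\<close>
    have S_corner: "act N ?e (act N a v) \<in> S" if "a \<in> carrier \<A>" "v \<in> S" for a v
    proof -
      have v: "v \<in> carrier N" "act N ?e v = v" using S_carrier[OF that(2)] by auto
      have "act N ?e (act N a v) = act N (?e \<star> a \<star> ?e) v"
        using op_act_mult[OF Nm smash.mult_closed[OF e that(1)] e v(1)] op_act_mult[OF Nm e that(1) v(1)]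
            v(2) by simp
      also have "\<dots> = act (corner_lmodule p N) (corner p a) v" by (simp add: corner_eq[OF p that(1)])
      also have "\<dots> \<in> S" using corner_closed that(2) by (intro S(5)) simp_all
      finally show ?thesis .
    qed
    have "?K = carrier N"
    proof (rule irreducible_lmoduleD[OF N])
      show "s \<in> ?K" using S_carrier[OF s(1)] S_corner[OF _ s(1)] by blast
      show "s \<noteq> \<zero>\<^bsub>N\<^esub>" using s by simp
      show "\<zero>\<^bsub>N\<^esub> \<in> ?K" using S(2) act_zero[OF Nm] e by (simp del: smash_simps)
      show "v \<oplus>\<^bsub>N\<^esub> w \<in> ?K" if "v \<in> ?K" "w \<in> ?K" for v w
      proof -
        have "act N ?e (act N a (v \<oplus>\<^bsub>N\<^esub> w)) \<in> S" if a: "a \<in> carrier \<A>" for a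
        proof -
          have "a \<in> carrier (opposite_algebra \<A>)" using a by simp
          then have "act N ?e (act N a (v \<oplus>\<^bsub>N\<^esub> w)) = act N ?e (act N a v) \<oplus>\<^bsub>N\<^esub> act N ?e (act N a w)"
            using \<open>v \<in> ?K\<close> \<open>w \<in> ?K\<close> e' by (simp add: N.act_add_right N.act_closed)
          also have "\<dots> \<in> S" using \<open>v \<in> ?K\<close> \<open>w \<in> ?K\<close> a S(3) by simp
          finally show ?thesis .
        qed
        then show ?thesis using that by simp
      qed
      show "c \<odot>\<^bsub>N\<^esub> v \<in> ?K" if "v \<in> ?K" for c v
      proof -
        have "act N ?e (act N a (c \<odot>\<^bsub>N\<^esub> v)) \<in> S" if a: "a \<in> carrier \<A>" for a
        proof -
          have "a \<in> carrier (opposite_algebra \<A>)" using a by simp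
          then have "act N ?e (act N a (c \<odot>\<^bsub>N\<^esub> v)) = c \<odot>\<^bsub>N\<^esub> act N ?e (act N a v)"
            using \<open>v \<in> ?K\<close> e' by (simp add: N.act_smult_right N.act_closed)
          also have "\<dots> \<in> S" using \<open>v \<in> ?K\<close> a S(4) by simp
          finally show ?thesis .
        qed
        then show ?thesis using that by simp
      qed
      show "act N b v \<in> ?K" if b: "b \<in> carrier (opposite_algebra \<A>)" and v: "v \<in> ?K" for b v
      proof -
        have bA: "b \<in> carrier \<A>" using b by simp
        have vN: "v \<in> carrier N" using v by simp
        have "act N ?e (act N a (act N b v)) \<in> S" if a: "a \<in> carrier \<A>" for a
        proof -
          have "act N ?e (act N (b \<star> a) v) \<in> S" using v smash.mult_closed[OF bA a] by blast
          then show ?thesis by (simp only: op_act_mult[OF Nm bA a vN])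
        qed
        then show ?thesis using op_act_closed[OF Nm bA vN] by blast
      qed
    qed auto
    show "carrier (corner_lmodule p N) \<subseteq> S"
    proof
      fix v assume "v \<in> carrier (corner_lmodule p N)"
      then have v: "v \<in> carrier N" "act N ?e v = v" by simp_all
      with \<open>?K = carrier N\<close> have "v \<in> ?K" by blast
      then have "act N ?e (act N ?e v) \<in> S" using e by blast
      then show "v \<in> S" by (simp only: v(2))
    qed
  qed
qed

text \<open>Both sides are covered since \<open>W\<close> is a left module and corners of right
  modules are right modules.\<close>

lemma twisted_dual_bases:
  fixes M :: "('k, 'g \<Rightarrow> 'k, 'v) lmodule"
  assumes p: "p \<in> Q" and M: "irreducible_lmodule A M" and A: "A = \<T> p \<or> A = opposite_algebra (\<T> p)"
  obtains B c where "dual_bases M B (\<lambda>x. x) c"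
proof (rule irreducible_finite_dual_bases[OF M finite_isotropy[of p]])
  show "carrier A = carrier (free_vs (\<H> p))" "(\<oplus>\<^bsub>A\<^esub>) = (\<oplus>\<^bsub>free_vs (\<H> p)\<^esub>)"
    "(\<odot>\<^bsub>A\<^esub>) = (\<odot>\<^bsub>free_vs (\<H> p)\<^esub>)" using A by auto
  show "\<one>\<^bsub>A\<^esub> \<in> carrier A" using A subgroup.one_closed[OF isotropy_subgroup[OF p]] by auto
  show "a \<otimes>\<^bsub>A\<^esub> b \<in> carrier A" if "a \<in> carrier A" "b \<in> carrier A" for a b
    using A that twisted_closed[OF p] by auto
qed (rule that)

end

section \<open>Irreducibility of the dual of an induced module\<close>

context isotropy_module
begin

interpretation F: subgroup F G by (rule subgroup_F)
interpretation W: left_module "\<T> p" W by (rule W)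
interpretation U: left_module "opposite_algebra \<A>" U by (rule U_module)
interpretation tp: tensor_product \<A> \<B> "point_lmodule p W" by (rule tensor_setting)

text \<open>A functional in \<open>U\<close> lives on basis elements (r, x) with x moving r to
  \<open>p\<close>, so r lies in the orbit of \<open>p\<close>; the idempotent at a point outside
  the orbit annihilates all of these.\<close>

lemma U_act_outside_orbit:
  assumes \<psi>: "\<psi> \<in> carrier U" and q: "q \<in> Q" "\<And>y. y \<in> F \<Longrightarrow> q \<triangleleft> y \<noteq> p"
  shows "act U (\<ee> (q, \<one>)) \<psi> = \<zero>\<^bsub>U\<^esub>"
proof (rule U_eqI_basis)
  have e: "\<ee> (q, \<one>) \<in> carrier \<A>" using q by simp
  show "act U (\<ee> (q, \<one>)) \<psi> \<in> carrier U" by (rule op_act_closed[OF U_module e \<psi>])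
  show "\<zero>\<^bsub>U\<^esub> \<in> carrier U" by (rule left_module_closed(3)[OF U_module])
  fix r x w assume r: "r \<in> Q" "x \<in> F" "r \<triangleleft> x = p" and w: "w \<in> carrier W"
  have c: "\<ee> (r, x) \<in> carrier \<A>" using r by simp
  have "act U (\<ee> (q, \<one>)) \<psi> (tens (\<ee> (r, x)) w) = \<psi> (tens (\<ee> (q, \<one>) \<star> \<ee> (r, x)) w)"
    by (rule U_act[OF \<psi> w c e])
  also have "\<dots> = \<psi> (tens (\<lambda>_. 0) w)" using q(2)[OF r(2)] r(3) smash_idem_mult(1)[OF q(1) r(1,2)] by auto
  also have "\<dots> = \<zero>\<^bsub>U\<^esub> (tens (\<ee> (r, x)) w)"
    using U_zero(1)[OF \<psi> w] tens_carrier[OF c w] by simp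
  finally show "act U (\<ee> (q, \<one>)) \<psi> (tens (\<ee> (r, x)) w) = \<zero>\<^bsub>U\<^esub> (tens (\<ee> (r, x)) w)" .
qed

text \<open>A basis element with target \<open>p\<close> absorbs \<open>e\<^sub>p\<close> on the
  right. So it carries \<open>U\<close> into the corner, and the base of the result reads off the
  values of the functional at that basis element.\<close>

lemma U_act_into_corner:
  assumes \<psi>: "\<psi> \<in> carrier U" and q: "q \<in> Q" "y \<in> F" "q \<triangleleft> y = p"
  shows "act U e\<^sub>p (act U (\<ee> (q, y)) \<psi>) = act U (\<ee> (q, y)) \<psi>"
    and "w \<in> carrier W \<Longrightarrow> base (act U (\<ee> (q, y)) \<psi>) w = \<psi> (tens (\<ee> (q, y)) w)"
proof -
  have e: "\<ee> (q, y) \<in> carrier \<A>" using q by simp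
  have m: "\<ee> (q, y) \<star> e\<^sub>p = \<ee> (q, y)" using smash_idem_mult(2)[OF p q(1,2)] q(3) by simp
  show "act U e\<^sub>p (act U (\<ee> (q, y)) \<psi>) = act U (\<ee> (q, y)) \<psi>"
    using op_act_mult[OF U_module e ep_carrier \<psi>] by (simp only: m)
  show "base (act U (\<ee> (q, y)) \<psi>) w = \<psi> (tens (\<ee> (q, y)) w)" if "w \<in> carrier W"
    using U_act[OF \<psi> that ep_carrier e] that unfolding base_def by (simp only: m restrict_apply')
qed

lemma U_nonzero_value:
  assumes "\<psi> \<in> carrier U" "\<psi> \<noteq> \<zero>\<^bsub>U\<^esub>"
  obtains q x w where "q \<in> Q" "x \<in> F" "q \<triangleleft> x = p" "w \<in> carrier W" "\<psi> (tens (\<ee> (q, x)) w) \<noteq> 0"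
proof (rule ccontr)
  assume c: "\<not> thesis"
  have "\<psi> = \<zero>\<^bsub>U\<^esub>"
  proof (rule U_eqI_basis[OF assms(1) left_module_closed(3)[OF U_module]])
    fix q x w assume *: "q \<in> Q" "x \<in> F" "q \<triangleleft> x = p" "w \<in> carrier W"
    have "\<psi> (tens (\<ee> (q, x)) w) = 0" using * c that by blast
    then show "\<psi> (tens (\<ee> (q, x)) w) = \<zero>\<^bsub>U\<^esub> (tens (\<ee> (q, x)) w)"
      using tens_carrier[of "\<ee> (q, x)" w] * by simp
  qed
  with assms(2) show False by simp
qed

lemma U_irreducible:
  assumes Wi: "irreducible_lmodule (\<T> p) W"
  shows "irreducible_lmodule (opposite_algebra \<A>) U"
proof -
  obtain B c where "dual_bases W B (\<lambda>x. x) c" using twisted_dual_bases[OF p Wi] by blast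
  then have DW: "irreducible_lmodule (opposite_algebra (\<T> p)) (dual_lmodule W)"
    by (rule dual_irreducible[OF Wi])
  obtain \<mu> where \<mu>: "\<mu> \<in> carrier (dual_lmodule W)" "\<mu> \<noteq> \<zero>\<^bsub>dual_lmodule W\<^esub>"
    using DW by (rule irreducible_lmodule_nonzero)
  show ?thesis
  proof (rule irreducible_lmoduleI[OF U_module coind_carrier[OF \<mu>(1)]])
    show "coind \<mu> \<noteq> \<zero>\<^bsub>U\<^esub>"
      using \<mu>(2) base_coind[OF \<mu>(1)] base_linear(3)[OF coind_carrier[OF \<mu>(1)] coind_carrier[OF \<mu>(1)]] by metis
  next
    fix S s
    assume S: "S \<subseteq> carrier U" "\<zero>\<^bsub>U\<^esub> \<in> S" "\<And>v w. v \<in> S \<Longrightarrow> w \<in> S \<Longrightarrow> v \<oplus>\<^bsub>U\<^esub> w \<in> S"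
      "\<And>c v. v \<in> S \<Longrightarrow> c \<odot>\<^bsub>U\<^esub> v \<in> S"
      "\<And>a v. a \<in> carrier (opposite_algebra \<A>) \<Longrightarrow> v \<in> S \<Longrightarrow> act U a v \<in> S"
      and s: "s \<in> S" "s \<noteq> \<zero>\<^bsub>U\<^esub>"
    have SU: "\<phi> \<in> carrier U" if "\<phi> \<in> S" for \<phi> using S(1) that by (rule subsetD)
    have act_S: "act U a \<phi> \<in> S" if "a \<in> carrier \<A>" "\<phi> \<in> S" for a \<phi>
      using S(5)[unfolded opposite_algebra_simps] that by blast
    obtain q x w where q: "q \<in> Q" "x \<in> F" "q \<triangleleft> x = p" "w \<in> carrier W" "s (tens (\<ee> (q, x)) w) \<noteq> 0"
      using U_nonzero_value[OF SU[OF s(1)] s(2)] by blast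
    \<comment> \<open>The given vector may have zero component at \<open>p\<close>; it is first
      moved into the corner along a basis element at which it is nonzero, so that its base is
      nonzero at \<open>w\<close>.\<close>
    let ?s = "act U (\<ee> (q, x)) s"
    have s': "?s \<in> S" using s(1) q by (intro act_S) simp_all
    have "base ` S = carrier (dual_lmodule W)"
    proof (rule irreducible_lmoduleD[OF DW])
      show "base ` S \<subseteq> carrier (dual_lmodule W)" using base_carrier[OF SU] by blast
      show "\<zero>\<^bsub>dual_lmodule W\<^esub> \<in> base ` S"
        using S(2) base_linear(3)[OF SU[OF s(1)] SU[OF s(1)]] by (metis imageI)
      show "\<phi> \<oplus>\<^bsub>dual_lmodule W\<^esub> \<psi> \<in> base ` S" if "\<phi> \<in> base ` S" "\<psi> \<in> base ` S" for \<phi> \<psi>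
      proof -
        from that obtain \<phi>' \<psi>' where *: "\<phi>' \<in> S" "\<psi>' \<in> S" "\<phi> = base \<phi>'" "\<psi> = base \<psi>'" by blast
        have "\<phi> \<oplus>\<^bsub>dual_lmodule W\<^esub> \<psi> = base (\<phi>' \<oplus>\<^bsub>U\<^esub> \<psi>')"
          by (simp only: *(3,4) base_linear(1)[OF SU[OF *(1)] SU[OF *(2)]])
        then show ?thesis using S(3)[OF *(1,2)] by (rule image_eqI)
      qed
      show "k \<odot>\<^bsub>dual_lmodule W\<^esub> \<phi> \<in> base ` S" if "\<phi> \<in> base ` S" for k \<phi>
      proof -
        from that obtain \<phi>' where *: "\<phi>' \<in> S" "\<phi> = base \<phi>'" by blast
        have "k \<odot>\<^bsub>dual_lmodule W\<^esub> \<phi> = base (k \<odot>\<^bsub>U\<^esub> \<phi>')"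
          by (simp only: *(2) base_linear(2)[OF SU[OF *(1)] SU[OF *(1)]])
        then show ?thesis using S(4)[OF *(1)] by (rule image_eqI)
      qed
      show "act (dual_lmodule W) b \<phi> \<in> base ` S"
        if "b \<in> carrier (opposite_algebra (\<T> p))" "\<phi> \<in> base ` S" for b \<phi>
      proof -
        have b: "b \<in> carrier (\<T> p)" using that by simp
        from that obtain \<phi>' where *: "\<phi>' \<in> S" "\<phi> = base \<phi>'" by blast
        have "act (dual_lmodule W) b \<phi> = base (act U (iota p b) \<phi>')"
          by (simp only: *(2) base_act[OF SU[OF *(1)] b])
        then show ?thesis using act_S[OF iota_smash[OF p b] *(1)] by (rule image_eqI)
      qed
      show "base ?s \<in> base ` S" using s' by (rule imageI)
      show "base ?s \<noteq> \<zero>\<^bsub>dual_lmodule W\<^esub>"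
      proof
        assume "base ?s = \<zero>\<^bsub>dual_lmodule W\<^esub>"
        then have "base ?s w = 0" using q(4) by simp
        with U_act_into_corner(2)[OF SU[OF s(1)] q(1,2,3,4)] q(5) show False by simp
      qed
    qed
    note base_S = this
    show "carrier U \<subseteq> S"
    proof
      fix \<psi> assume \<psi>: "\<psi> \<in> carrier U"
      show "\<psi> \<in> S"
      proof (rule op_decompose[OF U_module \<psi> S(2,3)])
        fix q assume q: "q \<in> Q"
        show "act U (\<ee> (q, \<one>)) \<psi> \<in> S"
        proof (cases "\<exists>y\<in>F. q \<triangleleft> y = p")
          case False
          then have "act U (\<ee> (q, \<one>)) \<psi> = \<zero>\<^bsub>U\<^esub>" by (intro U_act_outside_orbit[OF \<psi> q]) blast
          with S(2) show ?thesis by (simp only:)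
        next
          case True
          then obtain y where y: "y \<in> F" "q \<triangleleft> y = p" by blast
          let ?\<psi> = "act U (\<ee> (q, y)) \<psi>"
          have \<psi>': "?\<psi> \<in> carrier U" using q y by (intro op_act_closed[OF U_module _ \<psi>]) simp
          have "base ?\<psi> \<in> base ` S" using base_carrier[OF \<psi>'] by (simp only: base_S)
          then obtain \<phi> where \<phi>: "base ?\<psi> = base \<phi>" "\<phi> \<in> S" by (rule imageE)
          note \<phi> = \<phi>(2) \<phi>(1)[symmetric]
          \<comment> \<open>The preimage \<open>\<phi>\<close> merely shares its base with
            \<open>?\<psi>\<close>. Acting by \<open>e\<^sub>p\<close> keeps the base and stays in
            \<open>S\<close>, and two corner elements with the same base coincide.\<close>
          have e\<phi>: "act U e\<^sub>p \<phi> \<in> S" by (rule act_S[OF ep_carrier \<phi>(1)])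
          have "act U e\<^sub>p (act U e\<^sub>p \<phi>) = act U e\<^sub>p \<phi>"
            using op_act_mult[OF U_module ep_carrier ep_carrier SU[OF \<phi>(1)]] by (simp only: ep_idem)
          from ep_determined[OF SU[OF e\<phi>] this] have "act U e\<^sub>p \<phi> = coind (base ?\<psi>)"
            by (simp only: base_idem[OF SU[OF \<phi>(1)]] \<phi>(2))
          also have "\<dots> = ?\<psi>" by (rule ep_determined[OF \<psi>' U_act_into_corner(1)[OF \<psi> q y], symmetric])
          finally have "?\<psi> \<in> S" using e\<phi> by simp
          moreover have "\<ee> (q \<triangleleft> y, inv y) \<in> carrier \<A>" using q y(1) by (simp add: ract_closed)
          ultimately have "act U (\<ee> (q \<triangleleft> y, inv y)) ?\<psi> \<in> S" by (rule act_S[rotated])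
          \<comment> \<open>The component at q is a scalar multiple of the corner vector moved back
            by y^{-1}.\<close>
          then show ?thesis using S(4) by (simp only: op_act_recover[OF U_module \<psi> q y(1)])
        qed
      qed
    qed
  qed
qed

end

section \<open>Embedding an irreducible module into U; the character of U\<close>

context isotropy_module
begin

interpretation F: subgroup F G by (rule subgroup_F)
interpretation W: left_module "\<T> p" W by (rule W)
interpretation U: left_module "opposite_algebra \<A>" U by (rule U_module)
interpretation tp: tensor_product \<A> \<B> "point_lmodule p W" by (rule tensor_setting)

text \<open>Inverting the isomorphism turns w into a functional \<open>\<tau> w\<close> on the
  corner, and the pairing of n with the tensor of a and w is \<open>\<tau> w\<close> evaluated at n
  a e. A nonzero morphism from \<open>N\<close> to \<open>U\<close> results, and Schur's lemma
  applies.\<close>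

lemma corner_dual_iso_imp_iso:
  fixes N :: "('k, 'g \<times> 'g \<Rightarrow> 'k, 'u) lmodule"
  assumes N: "irreducible_lmodule (opposite_algebra \<A>) N" and Wi: "irreducible_lmodule (\<T> p) W"
    and n0: "n0 \<in> carrier N" "n0 \<noteq> \<zero>\<^bsub>N\<^esub>" "act N e\<^sub>p n0 = n0"
    and iso: "iso_lmodule (\<T> p) (dual_lmodule (corner_lmodule p N)) W"
  shows "iso_lmodule (opposite_algebra \<A>) N U"
proof -
  let ?M = "corner_lmodule p N"
  let ?DM = "dual_lmodule ?M"
  have Nm: "left_module (opposite_algebra \<A>) N" using N by (rule irreducible_lmodule_left_module)
  interpret N: left_module "opposite_algebra \<A>" N by (rule Nm)
  have Mi: "irreducible_lmodule (opposite_algebra (\<T> p)) ?M" by (rule corner_irreducible[OF N p n0])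
  have Mm: "left_module (opposite_algebra (\<T> p)) ?M" using Mi by (rule irreducible_lmodule_left_module)
  have DMm: "left_module (\<T> p) ?DM" using dual_left_module[OF Mm] by (simp only: opposite_algebra_simps)
  obtain B c where bc: "dual_bases ?M B (\<lambda>x. x) c" using twisted_dual_bases[OF p Mi] by blast
  obtain \<theta> where \<theta>: "\<theta> \<in> lmodule_hom (\<T> p) ?DM W" "bij_betw \<theta> (carrier ?DM) (carrier W)"
    using iso by (auto simp only: iso_lmodule_alt)
  note hom = lmodule_homD[OF \<theta>(1)]
  define \<tau> where "\<tau> = inv_into (carrier ?DM) \<theta>"
  have \<tau>_closed: "\<tau> w \<in> carrier ?DM" and \<theta>\<tau>: "\<theta> (\<tau> w) = w" if "w \<in> carrier W" for w
  proof -
    have "w \<in> \<theta> ` carrier ?DM" using \<theta>(2) that by (simp only: bij_betw_def)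
    then show "\<tau> w \<in> carrier ?DM" "\<theta> (\<tau> w) = w"
      unfolding \<tau>_def by (rule inv_into_into, rule f_inv_into_f)
  qed
  \<comment> \<open>All laws for \<open>\<tau>\<close> are pulled back from those for
    \<open>\<theta>\<close> by injectivity.\<close>
  have \<tau>I: "\<tau> w = \<mu>" if "\<mu> \<in> carrier ?DM" "\<theta> \<mu> = w" for w \<mu>
    using \<theta>(2) that unfolding \<tau>_def bij_betw_def by (auto simp del: dual_lmodule_simps)
  have \<tau>_add: "\<tau> (w \<oplus>\<^bsub>W\<^esub> w') = \<tau> w \<oplus>\<^bsub>?DM\<^esub> \<tau> w'" if "w \<in> carrier W" "w' \<in> carrier W" for w w'
  proof (rule \<tau>I)
    show "\<theta> (\<tau> w \<oplus>\<^bsub>?DM\<^esub> \<tau> w') = w \<oplus>\<^bsub>W\<^esub> w'"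
      by (simp only: hom(2)[OF \<tau>_closed[OF that(1)] \<tau>_closed[OF that(2)]] \<theta>\<tau>[OF that(1)] \<theta>\<tau>[OF that(2)])
  qed (rule left_module_closed(1)[OF DMm \<tau>_closed[OF that(1)] \<tau>_closed[OF that(2)]])
  have \<tau>_smult: "\<tau> (k \<odot>\<^bsub>W\<^esub> w) = k \<odot>\<^bsub>?DM\<^esub> \<tau> w" if "w \<in> carrier W" for k w
  proof (rule \<tau>I)
    show "\<theta> (k \<odot>\<^bsub>?DM\<^esub> \<tau> w) = k \<odot>\<^bsub>W\<^esub> w"
      by (simp only: hom(3)[OF \<tau>_closed[OF that]] \<theta>\<tau>[OF that])
  qed (rule left_module_closed(2)[OF DMm \<tau>_closed[OF that]])
  have \<tau>_act: "\<tau> (act W b w) = act ?DM b (\<tau> w)" if "b \<in> carrier (\<T> p)" "w \<in> carrier W" for b w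
  proof (rule \<tau>I)
    show "\<theta> (act ?DM b (\<tau> w)) = act W b w"
      by (simp only: hom(4)[OF that(1) \<tau>_closed[OF that(2)]] \<theta>\<tau>[OF that(2)])
  qed (rule left_module_closed(4)[OF DMm that(1) \<tau>_closed[OF that(2)]])
  define pr where "pr a n = act N e\<^sub>p (act N a n)" for a n
  have pr_M: "pr a n \<in> carrier ?M" if "a \<in> carrier \<A>" "n \<in> carrier N" for a n
  proof -
    have an: "act N a n \<in> carrier N" by (rule op_act_closed[OF Nm that])
    have "act N e\<^sub>p (pr a n) = pr a n" unfolding pr_def
      using op_act_mult[OF Nm ep_carrier ep_carrier an] by (simp only: ep_idem)
    moreover have "pr a n \<in> carrier N" unfolding pr_def by (rule op_act_closed[OF Nm ep_carrier an])
    ultimately show ?thesis by simp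
  qed
  have ep': "e\<^sub>p \<in> carrier (opposite_algebra \<A>)" using ep_carrier by simp
  have op: "a \<in> carrier \<A> \<Longrightarrow> a \<in> carrier (opposite_algebra \<A>)" for a by simp
  have pr_add: "pr a (n \<oplus>\<^bsub>N\<^esub> n') = pr a n \<oplus>\<^bsub>?M\<^esub> pr a n'"
      if "a \<in> carrier \<A>" "n \<in> carrier N" "n' \<in> carrier N" for a n n'
    unfolding pr_def corner_lmodule_simps
    by (simp only: N.act_add_right[OF op[OF that(1)] that(2,3)] N.act_add_right[OF ep' op_act_closed[OF Nm
        that(1,2)] op_act_closed[OF Nm that(1,3)]])
  have pr_smult: "pr a (k \<odot>\<^bsub>N\<^esub> n) = k \<odot>\<^bsub>?M\<^esub> pr a n" if "a \<in> carrier \<A>" "n \<in> carrier N" for a n k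
    unfolding pr_def corner_lmodule_simps
    by (simp only: N.act_smult_right[OF op[OF that(1)] that(2)] N.act_smult_right[OF ep' op_act_closed[OF Nm
        that]])
  have pr_add_left: "pr (a \<oplus>\<^bsub>\<A>\<^esub> a') n = pr a n \<oplus>\<^bsub>?M\<^esub> pr a' n"
      if "a \<in> carrier \<A>" "a' \<in> carrier \<A>" "n \<in> carrier N" for a a' n
    unfolding pr_def corner_lmodule_simps
    using N.act_add_left[OF op[OF that(1)] op[OF that(2)] that(3)]
    by (simp only: opposite_algebra_simps N.act_add_right[OF ep' op_act_closed[OF Nm that(1,3)]
        op_act_closed[OF Nm that(2,3)]])
  have pr_smult_left: "pr (k \<odot>\<^bsub>\<A>\<^esub> a) n = k \<odot>\<^bsub>?M\<^esub> pr a n" if "a \<in> carrier \<A>" "n \<in> carrier N" for a n k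
    unfolding pr_def corner_lmodule_simps
    using N.act_smult_left[OF op[OF that(1)] that(2)]
    by (simp only: opposite_algebra_simps N.act_smult_right[OF ep' op_act_closed[OF Nm that]])
  \<comment> \<open>For b in the subalgebra, a b e = a e b' with b' the corner of b, so b acts on
    the corner vector n a e; transposed by \<open>\<tau>\<close>, this is its action on w.\<close>
  have pr_balanced: "pr (a \<star> b) n = act ?M (corner p b) (pr a n)"
    if "a \<in> carrier \<A>" "b \<in> \<B>" "n \<in> carrier N" for a b n
  proof -
    have b: "b \<in> carrier \<A>" using that(2) free_vs_subalgebra by blast
    have ib: "iota p (corner p b) \<in> carrier \<A>" by (rule iota_smash[OF p corner_closed])
    have "pr (a \<star> b) n = act N (a \<star> b \<star> e\<^sub>p) n"
      unfolding pr_def by (rule op_act_mult[OF Nm smash.mult_closed[OF that(1) b] ep_carrier that(3),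
          symmetric])
    also have "a \<star> b \<star> e\<^sub>p = a \<star> e\<^sub>p \<star> iota p (corner p b)"
      by (simp only: smash.mult_assoc[OF that(1) b ep_carrier] slice_eq[OF p that(2)]
          smash.mult_assoc[OF that(1) ep_carrier ib] iota_idem[OF p corner_closed])
    also have "act N \<dots> n = act ?M (corner p b) (pr a n)"
      by (simp only: op_act_mult[OF Nm smash.mult_closed[OF that(1) ep_carrier] ib that(3)]
          op_act_mult[OF Nm that(1) ep_carrier that(3)] pr_def corner_lmodule_simps)
    finally show ?thesis .
  qed
  have "\<exists>\<phi>. \<phi> \<in> carrier U \<and> (\<forall>a\<in>carrier \<A>. \<forall>w\<in>carrier W. \<phi> (tens a w) = \<tau> w (pr a n))"
    if n: "n \<in> carrier N" for n
  proof (rule tp.dual_tensor_exists[where \<beta> = "\<lambda>a w. \<tau> w (pr a n)"], goal_cases)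
    case (1 a a' w)
    then have w: "w \<in> carrier W" by simp
    have l: "linear_functional ?M (\<tau> w)" using \<tau>_closed[OF w] by simp
    show ?case unfolding pr_add_left[OF 1(1,2) n]
      by (rule linear_functional_add[OF l pr_M[OF 1(1) n] pr_M[OF 1(2) n]])
  next
    case (2 a w w')
    then have w: "w \<in> carrier W" "w' \<in> carrier W" by simp_all
    show ?case using pr_M[OF 2(1) n] unfolding point_lmodule_simps \<tau>_add[OF w]
      by (simp del: corner_lmodule_simps)
  next
    case (3 k a w)
    then have w: "w \<in> carrier W" by simp
    have l: "linear_functional ?M (\<tau> w)" using \<tau>_closed[OF w] by simp
    show ?case unfolding pr_smult_left[OF 3(1) n] by (rule linear_functional_smult[OF l pr_M[OF 3(1) n]])
  next
    case (4 k a w)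
    then have w: "w \<in> carrier W" by simp
    show ?case using pr_M[OF 4(1) n] unfolding point_lmodule_simps \<tau>_smult[OF w]
      by (simp del: corner_lmodule_simps)
  next
    case (5 a b w)
    then have w: "w \<in> carrier W" by simp
    show ?case using pr_M[OF 5(1) n]
      unfolding point_lmodule_simps pr_balanced[OF 5(1,2) n] slice_eq_corner[OF 5(2)] \<tau>_act[OF corner_closed w]
      by (simp del: corner_lmodule_simps)
  next
    case (6 \<phi>)
    then show ?case unfolding induced_lmodule_def by auto
  qed
  then obtain f where f: "\<And>n. n \<in> carrier N \<Longrightarrow> f n \<in> carrier U"
    and ft: "\<And>n a w. n \<in> carrier N \<Longrightarrow> a \<in> carrier \<A> \<Longrightarrow> w \<in> carrier W \<Longrightarrow> f n (tens a w) = \<tau> w (pr a n)"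
    by metis
  have "f \<in> lmodule_hom (opposite_algebra \<A>) N U"
  proof (rule lmodule_homI, goal_cases)
    case (1 n)
    then show ?case by (rule f)
  next
    case (2 n n')
    have nn: "n \<oplus>\<^bsub>N\<^esub> n' \<in> carrier N" using 2 by simp
    show ?case
    proof (rule U_eqI[OF f[OF nn] left_module_closed(1)[OF U_module f[OF 2(1)] f[OF 2(2)]]])
      fix a w assume a: "a \<in> carrier \<A>" and w: "w \<in> carrier W"
      have l: "linear_functional ?M (\<tau> w)" using \<tau>_closed[OF w] by simp
      show "f (n \<oplus>\<^bsub>N\<^esub> n') (tens a w) = (f n \<oplus>\<^bsub>U\<^esub> f n') (tens a w)"
        using tens_carrier[OF a w] unfolding ft[OF nn a w] pr_add[OF a 2] linear_functional_add[OF l pr_M[OF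
            a 2(1)] pr_M[OF a 2(2)]]
        by (simp add: ft[OF 2(1) a w] ft[OF 2(2) a w])
    qed
  next
    case (3 k n)
    have kn: "k \<odot>\<^bsub>N\<^esub> n \<in> carrier N" using 3 by simp
    show ?case
    proof (rule U_eqI[OF f[OF kn] left_module_closed(2)[OF U_module f[OF 3]]])
      fix a w assume a: "a \<in> carrier \<A>" and w: "w \<in> carrier W"
      have l: "linear_functional ?M (\<tau> w)" using \<tau>_closed[OF w] by simp
      show "f (k \<odot>\<^bsub>N\<^esub> n) (tens a w) = (k \<odot>\<^bsub>U\<^esub> f n) (tens a w)"
        using tens_carrier[OF a w] unfolding ft[OF kn a w] pr_smult[OF a 3] linear_functional_smult[OF l
            pr_M[OF a 3]]
        by (simp add: ft[OF 3 a w])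
    qed
  next
    case (4 b n)
    have b: "b \<in> carrier \<A>" using 4 by simp
    have bn: "act N b n \<in> carrier N" by (rule op_act_closed[OF Nm b 4(2)])
    show ?case
    proof (rule U_eqI[OF f[OF bn] op_act_closed[OF U_module b f[OF 4(2)]]])
      fix a w assume a: "a \<in> carrier \<A>" and w: "w \<in> carrier W"
      show "f (act N b n) (tens a w) = act U b (f n) (tens a w)"
        unfolding ft[OF bn a w] U_act[OF f[OF 4(2)] w a b] ft[OF 4(2) smash.mult_closed[OF b a] w]
        by (simp only: pr_def op_act_mult[OF Nm b a 4(2)])
    qed
  qed
  moreover have "f n0 \<noteq> \<zero>\<^bsub>U\<^esub>"
  proof
    assume 0: "f n0 = \<zero>\<^bsub>U\<^esub>"
    have n0M: "n0 \<in> carrier ?M" using n0 by simp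
    have "n0 \<noteq> \<zero>\<^bsub>?M\<^esub>" using n0 by simp
    then obtain i where i: "i \<in> B" "c i n0 \<noteq> 0" using bc n0M unfolding dual_bases_def by blast
    \<comment> \<open>A coordinate functional not vanishing at \<open>n0\<close>. Its image under
      \<open>\<theta>\<close> is the vector of \<open>W\<close> at which \<open>f n0\<close> is
      tested, with a = \<open>e\<^sub>p\<close> because \<open>n0\<close> is fixed by it.\<close>
    let ?\<mu> = "restrict (c i) (carrier ?M)"
    have \<mu>: "?\<mu> \<in> carrier ?DM"
      using bc i left_module_closed[OF Mm] by (auto simp: dual_bases_def linear_functional_def)
    have w: "\<theta> ?\<mu> \<in> carrier W" by (rule hom(1)[OF \<mu>])
    have "pr e\<^sub>p n0 = n0" by (simp only: pr_def n0(3))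
    then have "f n0 (tens e\<^sub>p (\<theta> ?\<mu>)) = ?\<mu> n0" using ft[OF n0(1) ep_carrier w] \<tau>I[OF \<mu> refl] by simp
    also have "\<dots> = c i n0" using n0M by (simp only: restrict_apply')
    finally show False using i tens_carrier[OF ep_carrier w] unfolding 0 by simp
  qed
  ultimately show ?thesis using schur[OF N U_irreducible[OF Wi] _ n0(1)] by blast
qed

lemma coind_zero: "coind \<zero>\<^bsub>dual_lmodule W\<^esub> = \<zero>\<^bsub>U\<^esub>"
proof -
  have z: "\<zero>\<^bsub>U\<^esub> \<in> carrier U" by (rule left_module_closed(3)[OF U_module])
  have "act U e\<^sub>p \<zero>\<^bsub>U\<^esub> = \<zero>\<^bsub>U\<^esub>" using act_zero[OF U_module, of e\<^sub>p] ep_carrier by simp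
  from ep_determined[OF z this] show ?thesis by (simp only: base_linear(3)[OF z z])
qed

lemma U_act_tens_basis:
  assumes "\<phi> \<in> carrier U" "w \<in> carrier W" "q \<in> Q" "z \<in> F" "r \<in> Q" "x \<in> F"
  shows "act U (\<ee> (q, z)) \<phi> (tens (\<ee> (r, x)) w) =
    (if q \<triangleleft> z = r then \<sigma> q z x * \<phi> (tens (\<ee> (q, z \<otimes> x)) w) else 0)"
proof -
  have e: "\<ee> (q, z) \<in> carrier \<A>" "\<ee> (r, x) \<in> carrier \<A>" "\<ee> (q, z \<otimes> x) \<in> carrier \<A>" using assms by simp_all
  show ?thesis
    using U_zero(1)[OF assms(1,2)] U_smult[OF assms(1,2) e(3)]
    unfolding U_act[OF assms(1,2) e(2,1)] smash_mult_basis by simp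
qed

lemma coind_tens_basis:
  assumes "\<mu> \<in> carrier (dual_lmodule W)" "w \<in> carrier W" "x \<in> F"
  shows "coind \<mu> (tens (\<ee> (p, x)) w) = (if x \<in> \<H> p then \<mu> (act W (\<ee> x) w) else 0)"
proof -
  have e: "\<ee> (p, x) \<in> carrier \<A>" using assms p by simp
  have "linear_functional W \<mu>" using assms(1) by simp
  then show ?thesis
    using linear_functional_zero[OF W.vectorspace_axioms]
    by (simp add: coind_tens[OF assms(1) e assms(2)] corner_basis W_act_zero[OF assms(2)])
qed

text \<open>\<open>U\<close> is the sum of its components at the points p.y^{-1} (dot for the
  action), y in \<open>R\<close>, each a translate of the corner, that is, of the dual of
  \<open>W\<close>. In the resulting dual bases the diagonal entry at y vanishes unless q is the
  point of that component and y^{-1}zy lies in the isotropy group; the remaining entries over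
  \<open>I\<close> sum to the trace on \<open>W\<close>.\<close>

lemma U_character:
  assumes bc: "dual_bases W I b c"
    and R: "representatives ((\<lambda>y. y <# \<H> p) ` F) R" and q: "q \<in> Q" and z: "z \<in> F"
  shows "character U (\<ee> (q, z)) =
    (\<Sum>y | y \<in> R \<and> inv y \<otimes> z \<otimes> y \<in> \<H> p.
       (if p = q \<triangleleft> y then 1 else 0) * \<sigma> q z y * inverse (\<sigma> q y (inv y \<otimes> z \<otimes> y)) *
       character W (\<ee> (inv y \<otimes> z \<otimes> y)))"
proof -
  interpret H: subgroup "\<H> p" G by (rule isotropy_subgroup[OF p])
  have HF: "h \<in> F" if "h \<in> \<H> p" for h using that by (simp add: isotropy_iff)
  have RF: "y \<in> F" if y: "y \<in> R" for y
  proof -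
    from R y obtain x where "x \<in> F" "y \<in> x <# \<H> p" by (auto simp: representatives_def)
    then show ?thesis using HF by (auto simp: l_coset_def)
  qed
  have R_unique: "y = y'" if y: "y \<in> R" "y' \<in> R" and h: "inv y' \<otimes> y \<in> \<H> p" for y y'
  proof -
    have "y' <# \<H> p \<in> (\<lambda>y. y <# \<H> p) ` F" using RF y by blast
    then have ex1: "\<exists>!r. r \<in> R \<and> r \<in> y' <# \<H> p" using R unfolding representatives_def by blast
    have G: "y \<in> carrier G" "y' \<in> carrier G" using RF[OF y(1)] RF[OF y(2)] by simp_all
    have "y' \<in> y' <# \<H> p" using H.one_closed G unfolding l_coset_def by force
    moreover have "y = y' \<otimes> (inv y' \<otimes> y)" using G by (simp add: m_assoc[symmetric])
    then have "y \<in> y' <# \<H> p" using h unfolding l_coset_def by blast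
    ultimately show ?thesis using ex1 y by blast
  qed
  have R_exists: "\<exists>y\<in>R. \<exists>h\<in>\<H> p. x = y \<otimes> h" if x: "x \<in> F" for x
  proof -
    have "\<exists>!r. r \<in> R \<and> r \<in> x <# \<H> p" using R x by (simp add: representatives_def)
    then obtain y where y: "y \<in> R" "y \<in> x <# \<H> p" by blast
    then obtain h where h: "h \<in> \<H> p" "y = x \<otimes> h" by (auto simp: l_coset_def)
    have G: "x \<in> carrier G" "h \<in> carrier G" using x h HF by simp_all
    have "x = y \<otimes> inv h" using h G by (simp add: m_assoc)
    then show ?thesis using y h by blast
  qed
  have finR: "finite R" using finite_F RF by (meson finite_subset subsetI)
  have finI: "finite I" using bc by (simp add: dual_bases_def)
  have b: "b i \<in> carrier W" and c: "linear_functional W (c i)" if "i \<in> I" for i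
    using bc that by (auto simp: dual_bases_def)
  let ?c = "\<lambda>i. restrict (c i) (carrier W)"
  have c': "?c i \<in> carrier (dual_lmodule W)" if "i \<in> I" for i
    using c[OF that] by (auto simp: linear_functional_def)
  \<comment> \<open>The point of \<open>Q\<close> that y moves to \<open>p\<close>; (r y, y) is thus
    a basis element with target \<open>p\<close>.\<close>
  define r where "r y = p \<triangleleft> inv y" for y
  have r: "r y \<in> Q" "r y \<triangleleft> y = p" if "y \<in> F" for y
    unfolding r_def using ract_inv(2)[OF p that] ract_closed[OF p] that by auto
  \<comment> \<open>The functional dual to \<open>b i\<close>, coinduced to the corner and moved by
    y^{-1} to the component at \<open>r y\<close>.\<close>
  define V where "V = (\<lambda>(y, i). act U (\<ee> (p, inv y)) (coind (?c i)))"
  \<comment> \<open>Evaluation at the tensor of (r y, y) with \<open>b i\<close>. Applied to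
    \<open>V (y, i)\<close> it would give \<open>\<sigma> p (inv y) y\<close>, by which it is
    divided.\<close>
  define C where "C = (\<lambda>(y, i) \<phi>. inverse (\<sigma> p (inv y) y) * \<phi> (tens (\<ee> (r y, y)) (b i)))"
  have V: "V (y, i) \<in> carrier U" if "y \<in> F" "i \<in> I" for y i
    unfolding V_def prod.case using p that by (intro op_act_closed[OF U_module _ coind_carrier[OF c']]) simp_all
  have \<sigma>0: "\<sigma> p (inv y) y \<noteq> 0" if "y \<in> F" for y using sigma_nonzero[OF p _ that] that by simp
  have dual: "dual_bases U (R \<times> I) V C"
    unfolding dual_bases_def
  proof (intro conjI ballI impI)
    show "finite (R \<times> I)" using finR finI by simp
    show "V \<in> R \<times> I \<rightarrow> carrier U" using V RF by auto
    show "linear_functional U (C yi)" if "yi \<in> R \<times> I" for yi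
    proof -
      from that obtain y i where yi: "yi = (y, i)" "y \<in> R" "i \<in> I" by auto
      have "tens (\<ee> (r y, y)) (b i) \<in> carrier (induced_lmodule G F Q \<sigma> p W)"
        using tens_carrier[OF _ b[OF yi(3)], of "\<ee> (r y, y)"] r(1)[OF RF[OF yi(2)]] RF[OF yi(2)] by simp
      then show ?thesis by (simp add: yi C_def linear_functional_def[of U] algebra_simps)
    qed
    show "C yi (V yj) = (if yi = yj then 1 else 0)" if "yi \<in> R \<times> I" "yj \<in> R \<times> I" for yi yj
    proof -
      from that obtain y i y' j where yi: "yi = (y, i)" "y \<in> R" "i \<in> I" and yj: "yj = (y', j)" "y' \<in> R" "j \<in> I"
        by auto
      have F: "y \<in> F" "y' \<in> F" using RF yi yj by auto
      have val: "V yj (tens (\<ee> (r y, y)) (b i)) =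
          (if r y' = r y then \<sigma> p (inv y') y * coind (?c j) (tens (\<ee> (p, inv y' \<otimes> y)) (b i)) else 0)"
        unfolding yj V_def prod.case r_def
        using F p by (intro U_act_tens_basis[OF coind_carrier[OF c'[OF yj(3)]] b[OF yi(3)]]) (auto simp:
            ract_closed)
      show ?thesis
      proof (cases "y = y'")
        case True
        have "inv y \<otimes> y = \<one>" using F by simp
        then have "V yj (tens (\<ee> (r y, y)) (b i)) = \<sigma> p (inv y) y * c j (b i)"
          unfolding val True[symmetric] using coind_tens_basis[OF c'[OF yj(3)] b[OF yi(3)] F.one_closed]
            W.act_one[OF b[OF yi(3)]] b[OF yi(3)] by simp
        then show ?thesis using True yi yj \<sigma>0[OF F(1)] bc by (simp add: C_def dual_bases_def)
      next
        case False
        \<comment> \<open>Equal points would place y'^{-1}y in the isotropy group, so y and y' would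
          represent the same coset.\<close>
        have "r y' \<noteq> r y"
        proof
          assume "r y' = r y"
          then have "p \<triangleleft> (inv y' \<otimes> y) = p" using F p r(2)[OF F(1)] by (simp add: ract_mult r_def)
          then have "inv y' \<otimes> y \<in> \<H> p" using F by (simp add: isotropy_iff)
          with False R_unique yi yj show False by blast
        qed
        then show ?thesis using False val by (simp add: C_def yi yj)
      qed
    qed
    show "\<phi> = \<zero>\<^bsub>U\<^esub>" if \<phi>: "\<phi> \<in> carrier U" and 0: "\<forall>yi\<in>R \<times> I. C yi \<phi> = 0" for \<phi>
    proof (rule U_eqI_basis[OF \<phi> left_module_closed(3)[OF U_module]])
      fix q x w assume q: "q \<in> Q" "x \<in> F" "q \<triangleleft> x = p" and w: "w \<in> carrier W"
      obtain y h where y: "y \<in> R" "h \<in> \<H> p" "x = y \<otimes> h" using R_exists[OF q(2)] by blast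
      have F: "y \<in> F" "h \<in> F" using RF HF y by auto
      have qy: "q \<triangleleft> y = p" using q y F p isotropy_ract_eq[of "q \<triangleleft> y" p h] by (simp add: ract_mult ract_closed)
      then have ry: "q = r y" unfolding r_def using ract_eq_swap[OF q(1) p F(1)] by simp
      have e: "\<ee> (r y, y) \<in> carrier \<A>" "\<ee> (q, x) \<in> carrier \<A>" "\<ee> (p, h) \<in> \<B>" using r(1) F q p y by simp_all
      have z0: "\<phi> (tens (\<ee> (r y, y)) v) = 0" if v: "v \<in> carrier W" for v
      proof -
        have "\<phi> (tens (\<ee> (r y, y)) v) = (\<Sum>i\<in>I. c i v * \<phi> (tens (\<ee> (r y, y)) (b i)))"
          by (rule functional_expansion[OF W.vectorspace_axioms bc U_functional[OF \<phi> e(1)] v])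
        also have "\<dots> = 0"
          using 0 y(1) \<sigma>0[OF F(1)] by (intro sum.neutral) (auto simp: C_def)
        finally show ?thesis .
      qed
      \<comment> \<open>With x = y h, the basis element (q, x) is up to a nonzero scalar the product
        of (r y, y) and (p, h), and (p, h) moves across the tensor sign; hence the vanishing at (r
        y, y) for all vectors of \<open>W\<close> suffices.\<close>
      have "\<sigma> q y h * \<phi> (tens (\<ee> (q, x)) w) = \<phi> (tens (\<ee> (r y, y) \<star> \<ee> (p, h)) w)"
        using U_smult[OF \<phi> w e(2), of "\<sigma> q y h"] qy y(3) unfolding smash_mult_basis ry[symmetric] by simp
      also have "\<dots> = 0" unfolding U_balanced[OF \<phi> w e(1,3)]
        by (rule z0[OF W.act_closed[OF corner_closed w]])
      finally have "\<phi> (tens (\<ee> (q, x)) w) = 0" using sigma_nonzero[OF q(1) F] by simp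
      then show "\<phi> (tens (\<ee> (q, x)) w) = \<zero>\<^bsub>U\<^esub> (tens (\<ee> (q, x)) w)"
        using tens_carrier[OF e(2) w] by simp
    qed
  qed
  have eqz: "\<ee> (q, z) \<in> carrier \<A>" using q z by simp
  have act_hom: "act U (\<ee> (q, z)) \<in> LinearCombinations.module_hom class_ring U U"
    using U.act_closed[of "\<ee> (q, z)"] U.act_add_right[of "\<ee> (q, z)"] U.act_smult_right[of "\<ee> (q, z)"] eqz
    unfolding LinearCombinations.module_hom_def opposite_algebra_simps by blast
  have summand: "C (y, i) (act U (\<ee> (q, z)) (V (y, i))) =
      (if inv y \<otimes> z \<otimes> y \<in> \<H> p then (if p = q \<triangleleft> y then 1 else 0) * \<sigma> q z y *
         inverse (\<sigma> q y (inv y \<otimes> z \<otimes> y)) * c i (act W (\<ee> (inv y \<otimes> z \<otimes> y)) (b i)) else 0)"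
    if y: "y \<in> R" and i: "i \<in> I" for y i
  proof -
    define h where "h = inv y \<otimes> z \<otimes> y"
    have yF: "y \<in> F" by (rule RF[OF y])
    have hF: "h \<in> F" unfolding h_def using yF z by simp
    have G: "y \<in> carrier G" "z \<in> carrier G" using yF z by simp_all
    have zy: "z \<otimes> y = y \<otimes> h" unfolding h_def using G by (simp add: m_assoc[symmetric])
    have izy: "inv y \<otimes> (z \<otimes> y) = h" unfolding h_def using G by (simp add: m_assoc)
    have rq: "r y = q \<longleftrightarrow> p = q \<triangleleft> y" unfolding r_def using ract_eq_swap[OF q p yF] by auto
    have 1: "act U (\<ee> (q, z)) (V (y, i)) (tens (\<ee> (r y, y)) (b i)) =
        (if q \<triangleleft> z = r y then \<sigma> q z y * V (y, i) (tens (\<ee> (q, z \<otimes> y)) (b i)) else 0)"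
      by (rule U_act_tens_basis[OF V[OF yF i] b[OF i] q z r(1)[OF yF] yF])
    have 2: "V (y, i) (tens (\<ee> (q, z \<otimes> y)) (b i)) =
        (if r y = q then \<sigma> p (inv y) (z \<otimes> y) * coind (?c i) (tens (\<ee> (p, h)) (b i)) else 0)"
      unfolding V_def prod.case r_def izy[symmetric]
      using yF z p q by (intro U_act_tens_basis[OF coind_carrier[OF c'[OF i]] b[OF i]]) simp_all
    have 3: "coind (?c i) (tens (\<ee> (p, h)) (b i)) = (if h \<in> \<H> p then c i (act W (\<ee> h) (b i)) else 0)"
      using coind_tens_basis[OF c'[OF i] b[OF i] hF] W.act_closed[of "\<ee> h" "b i"] b[OF i] by simp
    show ?thesis
    proof (cases "h \<in> \<H> p \<and> p = q \<triangleleft> y")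
      case True
      then have ry: "r y = q" using rq by simp
      \<comment> \<open>The Kronecker condition from the action of (q, z) follows from the other
        two: since z y = y h, moving q by z and then y leads to \<open>p\<close>.\<close>
      have "q \<triangleleft> z \<triangleleft> y = q \<triangleleft> y \<triangleleft> h" using zy ract_mult[OF q z yF] ract_mult[OF q yF hF] by simp
      also have "\<dots> = p" using True unfolding isotropy_iff by metis
      finally have "q \<triangleleft> z = r y" unfolding r_def using ract_eq_swap[OF ract_closed[OF q z] p yF] by simp
      \<comment> \<open>The cocycle identity at (p, y^{-1}, y, h), in which
        \<open>\<sigma> p \<one> h\<close> equals 1; it exchanges the normalizing constants for the
        factor of the character formula.\<close>
      moreover have "\<sigma> q y h * \<sigma> p (inv y) (z \<otimes> y) = \<sigma> p (inv y) y"
      proof -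
        have "\<sigma> (p \<triangleleft> inv y) y h * \<sigma> p (inv y) (y \<otimes> h) = \<sigma> p (inv y) y * \<sigma> p (inv y \<otimes> y) h"
          by (rule sigma_cocycle[OF p _ yF hF]) (use yF in simp)
        then show ?thesis using ry G sigma_one(1)[OF p hF] by (simp add: zy r_def)
      qed
      then have "inverse (\<sigma> p (inv y) y) * \<sigma> p (inv y) (z \<otimes> y) = inverse (\<sigma> q y h)"
        using \<sigma>0[OF yF] sigma_nonzero[OF q yF hF] by (simp add: field_simps)
      ultimately show ?thesis
        using True ry 1 2 3 unfolding C_def prod.case h_def[symmetric]
        by (simp add: mult.left_commute mult.assoc)
    next
      case False
      then have "act U (\<ee> (q, z)) (V (y, i)) (tens (\<ee> (r y, y)) (b i)) = 0" unfolding 1 2 3 using rq by auto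
      then show ?thesis using False unfolding C_def prod.case h_def[symmetric] by auto
    qed
  qed
  have W_char: "character W (\<ee> h) = (\<Sum>i\<in>I. c i (act W (\<ee> h) (b i)))" if h: "h \<in> \<H> p" for h
  proof -
    have e: "\<ee> h \<in> carrier (\<T> p)" using h by simp
    have "act W (\<ee> h) \<in> LinearCombinations.module_hom class_ring W W"
      using W.act_closed[OF e] W.act_add_right[OF e] W.act_smult_right[OF e]
      unfolding LinearCombinations.module_hom_def by blast
    from trace_eq_sum[OF W.vectorspace_axioms this bc] show ?thesis by (simp only: character_def)
  qed
  have "character U (\<ee> (q, z)) = (\<Sum>yi\<in>R \<times> I. C yi (act U (\<ee> (q, z)) (V yi)))"
    unfolding character_def by (rule trace_eq_sum[OF U.vectorspace_axioms act_hom dual])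
  also have "\<dots> = (\<Sum>y\<in>R. \<Sum>i\<in>I. C (y, i) (act U (\<ee> (q, z)) (V (y, i))))"
    by (simp only: sum.cartesian_product case_prod_unfold prod.collapse)
  also have "\<dots> = (\<Sum>y\<in>R. if inv y \<otimes> z \<otimes> y \<in> \<H> p then (if p = q \<triangleleft> y then 1 else 0) * \<sigma> q z y *
      inverse (\<sigma> q y (inv y \<otimes> z \<otimes> y)) * character W (\<ee> (inv y \<otimes> z \<otimes> y)) else 0)"
  proof (rule sum.cong[OF refl])
    fix y assume y: "y \<in> R"
    show "(\<Sum>i\<in>I. C (y, i) (act U (\<ee> (q, z)) (V (y, i)))) =
      (if inv y \<otimes> z \<otimes> y \<in> \<H> p then (if p = q \<triangleleft> y then 1 else 0) * \<sigma> q z y *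
        inverse (\<sigma> q y (inv y \<otimes> z \<otimes> y)) * character W (\<ee> (inv y \<otimes> z \<otimes> y)) else 0)"
    proof (cases "inv y \<otimes> z \<otimes> y \<in> \<H> p")
      case True
      show ?thesis unfolding W_char[OF True] sum_distrib_left if_P[OF True]
        by (rule sum.cong[OF refl]) (simp only: summand[OF y] if_P[OF True])
    next
      case False
      then show ?thesis by (simp only: summand[OF y] if_False sum.neutral_const cong: sum.cong)
    qed
  qed
  also have "\<dots> = (\<Sum>y | y \<in> R \<and> inv y \<otimes> z \<otimes> y \<in> \<H> p.
       (if p = q \<triangleleft> y then 1 else 0) * \<sigma> q z y * inverse (\<sigma> q y (inv y \<otimes> z \<otimes> y)) *
       character W (\<ee> (inv y \<otimes> z \<otimes> y)))"
    by (rule sum.inter_filter[OF finR, symmetric])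
  finally show ?thesis .
qed

end

section \<open>Orbits and double cosets, isomorphisms between the U, and the parametrization\<close>

context twisted_factorization
begin

interpretation F: subgroup F G by (rule subgroup_F)

text \<open>For q and r in \<open>Q\<close>, an equation r = a q b with a and b in \<open>F\<close>
  says that q b = a^{-1} r, that is, b moves q to r. So \<open>P\<close> meets each orbit of
  \<open>F\<close> on \<open>Q\<close> exactly once.\<close>

lemma double_cosets_orbit:
  assumes P: "P \<subseteq> Q" "representatives (double_cosets G F) P"
  shows "p \<in> P \<Longrightarrow> p' \<in> P \<Longrightarrow> x \<in> F \<Longrightarrow> p \<triangleleft> x = p' \<Longrightarrow> p = p'"
    and "q \<in> Q \<Longrightarrow> \<exists>p\<in>P. \<exists>x\<in>F. q \<triangleleft> x = p"
proof -
  have mem: "g \<in> F #> q <#> F \<longleftrightarrow> (\<exists>a\<in>F. \<exists>b\<in>F. g = a \<otimes> q \<otimes> b)" for g q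
    by (auto simp: r_coset_def set_mult_def)
  have ex1: "\<exists>!r. r \<in> P \<and> r \<in> F #> q <#> F" if "q \<in> Q" for q
    using P(2) Q_carrier[OF that] unfolding representatives_def double_cosets_def by blast
  show "p = p'" if p: "p \<in> P" "p' \<in> P" and x: "x \<in> F" "p \<triangleleft> x = p'"
  proof -
    have Q: "p \<in> Q" "p' \<in> Q" using P(1) p by auto
    note G = Q_carrier[OF Q(1)] Q_carrier[OF Q(2)]
    obtain y where y: "y \<in> F" "p \<otimes> x = y \<otimes> p'" using ract_factorization(2)[OF Q(1) x(1)] x(2) by blast
    have "p' = inv y \<otimes> (p \<otimes> x)" using y G by (simp add: m_assoc[symmetric])
    also have "\<dots> = inv y \<otimes> p \<otimes> x" using y x G by (simp add: m_assoc)
    finally have "p' \<in> F #> p <#> F" using y x unfolding mem by blast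
    moreover have "p = \<one> \<otimes> p \<otimes> \<one>" using G by simp
    then have "p \<in> F #> p <#> F" unfolding mem using F.one_closed by blast
    ultimately show ?thesis using ex1[OF Q(1)] p by blast
  qed
  show "\<exists>p\<in>P. \<exists>x\<in>F. q \<triangleleft> x = p" if q: "q \<in> Q"
  proof -
    obtain r where r: "r \<in> P" "r \<in> F #> q <#> F" using ex1[OF q] by blast
    then obtain a b where ab: "a \<in> F" "b \<in> F" "r = a \<otimes> q \<otimes> b" unfolding mem by blast
    have rQ: "r \<in> Q" using r P by blast
    note G = Q_carrier[OF q] Q_carrier[OF rQ]
    have "inv a \<otimes> r = q \<otimes> b"
      unfolding ab(3) using ab(1,2) G(1) by (simp add: m_assoc[symmetric])
    then have "q \<triangleleft> b = r" using right_act_eq_iff[OF q ab(2) rQ] ab(1) by (metis F.m_inv_closed)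
    then show ?thesis using r ab by blast
  qed
qed

text \<open>An isomorphism respects the idempotent at \<open>p\<close>. A nonzero functional fixed
  by it in the second module forces \<open>p\<close> into the orbit of \<open>p'\<close>; for equal
  points, \<open>coind\<close>, the isomorphism and \<open>base\<close> compose to a nonzero
  morphism from the dual of \<open>W\<close> to that of \<open>W'\<close>, whose transpose runs from
  \<open>W'\<close> to \<open>W\<close>.\<close>

lemma induced_iso:
  fixes W W' :: "('k, 'g \<Rightarrow> 'k, 'w) lmodule"
  assumes p: "p \<in> Q" "p' \<in> Q" and W: "irreducible_lmodule (\<T> p) W" and W': "irreducible_lmodule (\<T> p') W'"
    and iso: "iso_lmodule (opposite_algebra \<A>) (dual_lmodule (induced_lmodule G F Q \<sigma> p W))
      (dual_lmodule (induced_lmodule G F Q \<sigma> p' W'))"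
  shows "\<exists>x\<in>F. p \<triangleleft> x = p'" and "p = p' \<Longrightarrow> iso_lmodule (\<T> p) W' W"
proof -
  interpret X: isotropy_module G F Q \<omega> \<sigma> p W
    by (intro isotropy_module.intro isotropy_module_axioms.intro twisted_factorization_axioms p
        irreducible_lmodule_left_module[OF W])
  interpret Y: isotropy_module G F Q \<omega> \<sigma> p' W'
    by (intro isotropy_module.intro isotropy_module_axioms.intro twisted_factorization_axioms p
        irreducible_lmodule_left_module[OF W'])
  obtain f where f: "f \<in> lmodule_hom (opposite_algebra \<A>) X.U Y.U" and
      bij: "bij_betw f (carrier X.U) (carrier Y.U)"
    using iso by (auto simp only: iso_lmodule_alt)
  note hom = lmodule_homD[OF f]
  obtain B c where bc: "dual_bases W B (\<lambda>x. x) c" using twisted_dual_bases[OF p(1) W] by blast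
  obtain \<mu> where \<mu>: "\<mu> \<in> carrier (dual_lmodule W)" "\<mu> \<noteq> \<zero>\<^bsub>dual_lmodule W\<^esub>"
    using dual_irreducible[OF W bc] by (rule irreducible_lmodule_nonzero)
  have f\<mu>: "f (X.coind \<nu>) \<in> carrier Y.U" if "\<nu> \<in> carrier (dual_lmodule W)" for \<nu>
    by (rule hom(1)[OF X.coind_carrier[OF that]])
  have nz: "f (X.coind \<mu>) \<noteq> \<zero>\<^bsub>Y.U\<^esub>"
  proof
    assume "f (X.coind \<mu>) = \<zero>\<^bsub>Y.U\<^esub>"
    also have "\<dots> = f \<zero>\<^bsub>X.U\<^esub>" by (rule lmodule_hom_zero[OF f X.U_module Y.U_module, symmetric])
    finally have "X.coind \<mu> = \<zero>\<^bsub>X.U\<^esub>"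
      using inj_onD[OF bij_betw_imp_inj_on[OF bij]] X.coind_carrier[OF \<mu>(1)] left_module_closed(3)[OF
          X.U_module] by blast
    then have "\<mu> = X.base \<zero>\<^bsub>X.U\<^esub>" using X.base_coind[OF \<mu>(1)] by (simp only:)
    then show False using \<mu>(2) X.base_linear(3)[OF X.coind_carrier[OF \<mu>(1)] X.coind_carrier[OF \<mu>(1)]]
      by (simp only:)
  qed
  have idem: "act Y.U (\<ee> (p, \<one>)) (f (X.coind \<nu>)) = f (X.coind \<nu>)" if "\<nu> \<in> carrier (dual_lmodule W)" for \<nu>
    using hom(4)[OF _ X.coind_carrier[OF that], of "\<ee> (p, \<one>)"] X.ep_carrier X.coind_idem[OF that]
    unfolding opposite_algebra_simps by (simp only:)
  obtain q x w where q: "q \<in> Q" "x \<in> F" "q \<triangleleft> x = p'" "w \<in> carrier W'" "f (X.coind \<mu>) (Y.tens (\<ee> (q, x)) w) \<noteq> 0"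
    using Y.U_nonzero_value[OF f\<mu>[OF \<mu>(1)] nz] by blast
  \<comment> \<open>The functional equals its own translate by the idempotent at \<open>p\<close>,
    which vanishes at (q, x) unless q = p; a nonzero value therefore puts \<open>p\<close> itself in
    the orbit of \<open>p'\<close>.\<close>
  have "f (X.coind \<mu>) (Y.tens (\<ee> (q, x)) w) =
      (if p \<triangleleft> \<one> = q then \<sigma> p \<one> x * f (X.coind \<mu>) (Y.tens (\<ee> (p, \<one> \<otimes> x)) w) else 0)"
    using Y.U_act_tens_basis[OF f\<mu>[OF \<mu>(1)] q(4) p(1) F.one_closed q(1,2)] by (simp only: idem[OF \<mu>(1)])
  with q(5) have "p = q" using ract_one[OF p(1)] by (metis (full_types))
  with q show "\<exists>x\<in>F. p \<triangleleft> x = p'" by blast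
  show "iso_lmodule (\<T> p) W' W" if pp: "p = p'"
  proof (rule dual_hom_imp_iso[OF W W'[folded pp] bc _ \<mu>(1)])
    let ?h = "\<lambda>\<mu>. Y.base (f (X.coind \<mu>))"
    show "?h \<in> lmodule_hom (opposite_algebra (\<T> p)) (dual_lmodule W) (dual_lmodule W')"
    proof (rule lmodule_homI, goal_cases)
      case (1 \<nu>)
      then show ?case by (intro Y.base_carrier f\<mu>)
    next
      case (2 \<nu> \<xi>)
      show ?case by (simp only: X.coind_add[OF 2] hom(2)[OF X.coind_carrier[OF 2(1)] X.coind_carrier[OF 2(2)]]
            Y.base_linear(1)[OF f\<mu>[OF 2(1)] f\<mu>[OF 2(2)]])
    next
      case (3 k \<nu>)
      show ?case by (simp only: X.coind_smult[OF 3] hom(3)[OF X.coind_carrier[OF 3]] Y.base_linear(2)[OF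
          f\<mu>[OF 3] f\<mu>[OF 3]])
    next
      case (4 b \<nu>)
      have b: "b \<in> carrier (\<T> p)" using 4 by simp
      have ib: "iota p b \<in> carrier (opposite_algebra \<A>)" using iota_smash[OF p(1) b] by simp
      have "Y.base (act Y.U (iota p b) (f (X.coind \<nu>))) = act (dual_lmodule W') b (?h \<nu>)"
        using Y.base_act[OF f\<mu>[OF 4(2)] b[unfolded pp]] by (simp only: pp)
      then show ?case
        by (simp only: X.coind_act[OF 4(2) b] hom(4)[OF ib X.coind_carrier[OF 4(2)]])
    qed
    \<comment> \<open>A corner element is determined by its base, so a zero base would make the
      image of \<open>X.coind \<mu>\<close> zero.\<close>
    show "?h \<mu> \<noteq> \<zero>\<^bsub>dual_lmodule W'\<^esub>"
    proof
      assume "?h \<mu> = \<zero>\<^bsub>dual_lmodule W'\<^esub>"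
      moreover have "act Y.U (\<ee> (p', \<one>)) (f (X.coind \<mu>)) = f (X.coind \<mu>)"
        using idem[OF \<mu>(1)] by (simp only: pp)
      ultimately have "f (X.coind \<mu>) = \<zero>\<^bsub>Y.U\<^esub>"
        using Y.ep_determined[OF f\<mu>[OF \<mu>(1)]] by (simp only: Y.coind_zero)
      with nz show False by simp
    qed
  qed
qed

end

theorem proposition5p5:
  fixes G :: "('g, 'm) monoid_scheme" (structure)
    and F Q P :: "'g set"
    and \<omega> \<sigma> :: "'g \<Rightarrow> 'g \<Rightarrow> 'g \<Rightarrow> 'k::{alg_closed_field, field_char_0}"
    and \<W> :: "'g \<Rightarrow> ('k, 'g \<Rightarrow> 'k, 'w) lmodule set"
  assumes setting: "twisted_factorization G F Q \<omega> \<sigma>"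
    and P: "P \<subseteq> Q" "representatives (double_cosets G F) P"
    and \<W>: "\<And>p. p \<in> P \<Longrightarrow> parametrizes_irreducibles TYPE(nat \<Rightarrow> 'k)
      (twisted_group_algebra G (isotropy G F Q p) (\<sigma> p)) (\<W> p) (\<lambda>W. W)"
  shows "parametrizes_irreducibles TYPE('u) (opposite_algebra (cocycle_smash G F Q \<sigma>))
      (SIGMA p:P. \<W> p) (\<lambda>(p, W). dual_lmodule (induced_lmodule G F Q \<sigma> p W)) \<and>
    (\<forall>p\<in>P. \<forall>W\<in>\<W> p. \<forall>q\<in>Q. \<forall>z\<in>F.
      \<forall>R. representatives ((\<lambda>y. y <# isotropy G F Q p) ` F) R \<longrightarrow>
      character (dual_lmodule (induced_lmodule G F Q \<sigma> p W)) (\<ee> (q, z)) =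
        (\<Sum>y | y \<in> R \<and> inv y \<otimes> z \<otimes> y \<in> isotropy G F Q p.
           (if p = right_act G F Q q y then 1 else 0) * \<sigma> q z y *
           inverse (\<sigma> q y (inv y \<otimes> z \<otimes> y)) *
           character W (\<ee> (inv y \<otimes> z \<otimes> y))))"
proof -
  interpret twisted_factorization G F Q \<omega> \<sigma> by (rule setting)
  have PQ: "p \<in> Q" if "p \<in> P" for p using that P by blast
  have irr: "irreducible_lmodule (\<T> p) W" if "p \<in> P" "W \<in> \<W> p" for p W
    using \<W>[OF that(1)] that(2) unfolding parametrizes_irreducibles_def by blast
  have noniso: "W = W'" if "p \<in> P" "W \<in> \<W> p" "W' \<in> \<W> p" "iso_lmodule (\<T> p) W W'" for p W W'
    using \<W>[OF that(1)] that(2-4) unfolding parametrizes_irreducibles_def by (metis (no_types))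
  have im: "isotropy_module G F Q \<omega> \<sigma> p W" if "p \<in> P" "W \<in> \<W> p" for p W
    using setting PQ[OF that(1)] irreducible_lmodule_left_module[OF irr[OF that]]
    by (simp add: isotropy_module_def isotropy_module_axioms_def)
  let ?U = "\<lambda>p W. dual_lmodule (induced_lmodule G F Q \<sigma> p W)"
  have U_irr: "irreducible_lmodule (opposite_algebra \<A>) (?U p W)" if "p \<in> P" "W \<in> \<W> p" for p W
    by (rule isotropy_module.U_irreducible[OF im[OF that] irr[OF that]])
  have U_iso: "p = p' \<and> W = W'"
    if pW: "p \<in> P" "W \<in> \<W> p" "p' \<in> P" "W' \<in> \<W> p'"
      and iso: "iso_lmodule (opposite_algebra \<A>) (?U p W) (?U p' W')" for p W p' W'
  proof -
    note i = induced_iso[OF PQ[OF pW(1)] PQ[OF pW(3)] irr[OF pW(1,2)] irr[OF pW(3,4)] iso]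
    have pp: "p = p'" using i(1) double_cosets_orbit(1)[OF P pW(1,3)] by blast
    moreover have "W = W'"
      using noniso[OF pW(1) pW(4)[folded pp] pW(2)] i(2)[OF pp] by blast
    ultimately show ?thesis by simp
  qed
  have U_all: "\<exists>p\<in>P. \<exists>W\<in>\<W> p. iso_lmodule (opposite_algebra \<A>) N (?U p W)"
    if N: "irreducible_lmodule (opposite_algebra \<A>) N" for N :: "('k, 'g \<times> 'g \<Rightarrow> 'k, 'u) lmodule"
  proof -
    have Nm: "left_module (opposite_algebra \<A>) N" using N by (rule irreducible_lmodule_left_module)
    interpret N: left_module "opposite_algebra \<A>" N by (rule Nm)
    obtain n where n: "n \<in> carrier N" "n \<noteq> \<zero>\<^bsub>N\<^esub>" using N by (rule irreducible_lmodule_nonzero)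
    \<comment> \<open>A nonzero vector has a nonzero component at some point: the decomposition is
      applied with the zero subspace as \<open>S\<close>.\<close>
    obtain q where q: "q \<in> Q" "act N (\<ee> (q, \<one>)) n \<noteq> \<zero>\<^bsub>N\<^esub>"
      using op_decompose[OF Nm n(1), of "{\<zero>\<^bsub>N\<^esub>}"] n(2) by auto
    obtain p x where p: "p \<in> P" "x \<in> F" "q \<triangleleft> x = p" using double_cosets_orbit(2)[OF P q(1)] by blast
    have pQ: "p \<in> Q" by (rule PQ[OF p(1)])
    have eqx: "\<ee> (q, x) \<in> carrier \<A>" and ep: "\<ee> (p, \<one>) \<in> carrier \<A>"
      using q p pQ subgroup.one_closed[OF subgroup_F] by simp_all
    \<comment> \<open>The component is moved to the chosen representative p of the orbit of q; it
      stays nonzero because the move is reversible up to a nonzero scalar.\<close>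
    let ?n = "act N (\<ee> (q, x)) n"
    have n': "?n \<in> carrier N" by (rule op_act_closed[OF Nm eqx n(1)])
    have "act N (\<ee> (q \<triangleleft> x, inv x)) \<zero>\<^bsub>N\<^esub> = \<zero>\<^bsub>N\<^esub>"
      using q(1) p(2) by (intro act_zero[OF Nm]) (simp add: ract_closed subgroup.m_inv_closed[OF subgroup_F])
    then have "?n \<noteq> \<zero>\<^bsub>N\<^esub>"
      using op_act_recover[OF Nm n(1) q(1) p(2)] q(2) by auto
    moreover have "act N (\<ee> (p, \<one>)) ?n = ?n"
      using op_act_mult[OF Nm eqx ep n(1)] smash_idem_mult(2)[OF pQ q(1) p(2)] p(3) by simp
    ultimately have n0: "?n \<in> carrier N" "?n \<noteq> \<zero>\<^bsub>N\<^esub>" "act N (\<ee> (p, \<one>)) ?n = ?n" using n' by auto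
    let ?M = "corner_lmodule p N"
    have M: "irreducible_lmodule (opposite_algebra (\<T> p)) ?M" by (rule corner_irreducible[OF N pQ n0])
    obtain B c where "dual_bases ?M B (\<lambda>x. x) c" using twisted_dual_bases[OF pQ M] by blast
    from dual_irreducible[OF M this] have DM: "irreducible_lmodule (\<T> p) (dual_lmodule ?M)"
      by (simp only: opposite_algebra_simps)
    obtain B' c' where "dual_bases (dual_lmodule ?M) B' (\<lambda>x. x) c'" using twisted_dual_bases[OF pQ DM] by blast
    \<comment> \<open>The dual of the corner has a carrier of functionals on the type of
      \<open>N\<close>; its copy on \<open>nat \<Rightarrow> 'k\<close> can be looked up in the list
      \<open>\<W> p\<close>.\<close>
    from irreducible_nat_copy[OF DM this] obtain L :: "('k, 'g \<Rightarrow> 'k, nat \<Rightarrow> 'k) lmodule"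
      where L: "irreducible_lmodule (\<T> p) L" "iso_lmodule (\<T> p) (dual_lmodule ?M) L" by blast
    obtain W where W: "W \<in> \<W> p" "iso_lmodule (\<T> p) L W"
      using \<W>[OF p(1)] L(1) unfolding parametrizes_irreducibles_def by blast
    have "iso_lmodule (opposite_algebra \<A>) N (?U p W)"
      by (rule isotropy_module.corner_dual_iso_imp_iso[OF im[OF p(1) W(1)] N irr[OF p(1) W(1)] n0
          iso_lmodule_trans[OF L(2) W(2)]])
    then show ?thesis using p W by blast
  qed
  have "parametrizes_irreducibles TYPE('u) (opposite_algebra \<A>) (SIGMA p:P. \<W> p) (\<lambda>(p, W). ?U p W)"
    unfolding parametrizes_irreducibles_def
  proof (intro conjI ballI allI impI)
    show "irreducible_lmodule (opposite_algebra \<A>) (case i of (p, W) \<Rightarrow> ?U p W)" if "i \<in> (SIGMA p:P. \<W> p)" for i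
      using that U_irr by auto
    show "\<not> iso_lmodule (opposite_algebra \<A>) (case i of (p, W) \<Rightarrow> ?U p W) (case j of (p, W) \<Rightarrow> ?U p W)"
      if "i \<in> (SIGMA p:P. \<W> p)" "j \<in> (SIGMA p:P. \<W> p)" "i \<noteq> j" for i j
      using that U_iso by auto
    show "\<exists>i\<in>SIGMA p:P. \<W> p. iso_lmodule (opposite_algebra \<A>) N (case i of (p, W) \<Rightarrow> ?U p W)"
      if "irreducible_lmodule (opposite_algebra \<A>) N" for N :: "('k, 'g \<times> 'g \<Rightarrow> 'k, 'u) lmodule"
      using U_all[OF that] by force
  qed
  moreover have "character (?U p W) (\<ee> (q, z)) =
      (\<Sum>y | y \<in> R \<and> inv y \<otimes> z \<otimes> y \<in> \<H> p.
         (if p = q \<triangleleft> y then 1 else 0) * \<sigma> q z y * inverse (\<sigma> q y (inv y \<otimes> z \<otimes> y)) *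
         character W (\<ee> (inv y \<otimes> z \<otimes> y)))"
    if "p \<in> P" "W \<in> \<W> p" "q \<in> Q" "z \<in> F" "representatives ((\<lambda>y. y <# \<H> p) ` F) R" for p W q z R
  proof -
    from twisted_dual_bases[OF PQ[OF that(1)] irr[OF that(1,2)]]
    obtain B c where "dual_bases W B (\<lambda>x. x) c" by blast
    from isotropy_module.U_character[OF im[OF that(1,2)] this that(5,3,4)] show ?thesis .
  qed
  ultimately show ?thesis by blast
qed

end
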